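(* Let $M$ be a smooth $7$-manifold and let $(\varphi,\nabla f,\lambda)$ be a gradient Ricci-harmonic soliton on $M$, i.e. $\varphi$ is a $\mathrm{G}_2$-structure, $f\in C^\infty(M)$, $\lambda\in\mathbb R$ and $$\left(-\mathrm{Ric}+3T^tT-|T|^2g\right)\diamond\varphi+\operatorname{div}T\lrcorner\psi=\lambda\varphi+\mathcal L_{\nabla f}\varphi.$$ Then the following identities hold: $$R+4|T|^2+\Delta f+\tfrac73\lambda=0,$$ $$\nabla_j\left(R+6|T|^2+|\nabla f|^2+\tfrac{2\lambda}{3}f\right)=6\,T_{pj}T_{pm}\nabla_mf-6\,\nabla_i(T_{pi}T_{pj})-2|T|^2\nabla_jf.$$
   Context: A $\mathrm{G}_2$-structure on a smooth $7$-manifold $M$ is a nondegenerate $3$-form $\varphi$, i.e. one that determines a Riemannian metric $g$ and an orientation by $(X\lrcorner\varphi)\wedge(Y\lrcorner\varphi)\wedge\varphi=-6\,g(X,Y)\,\mathrm{vol}$; put $\psi=*\varphi$. Indices refer to local orthonormal frames and repeated indices are summed. $\nabla$ is the Levi-Civita connection of $g$, $\mathrm{Ric}$ the Ricci tensor, $R$ the scalar curvature, $\Delta=\nabla_i\nabla_i$. The torsion of $\varphi$ is the $2$-tensor $T$ with $\nabla_m\varphi_{ijk}=T_{mp}\psi_{pijk}$. Further: $(T^tT)_{ij}=T_{pi}T_{pj}$, $|T|^2=T_{ij}T_{ij}$, $(\operatorname{div}T)_j=\nabla_iT_{ij}$. For a symmetric $2$-tensor $h$, $(h\diamond\varphi)_{ijk}=h_{ip}\varphi_{pjk}+h_{jp}\varphi_{ipk}+h_{kp}\varphi_{ijp}$,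 and for a vector field $X$, $(X\lrcorner\psi)_{ijk}=X_l\psi_{lijk}$. *)

theory Defs
  imports "HOL-Analysis.Analysis"
begin

section \<open>Calculus on open subsets of \<open>\<real>\<^sup>7\<close>\<close>

type_synonym R7 = "real ^ 7"

definition pd :: "7 \<Rightarrow> (R7 \<Rightarrow> real) \<Rightarrow> R7 \<Rightarrow> real" where
  "pd i F x = frechet_derivative F (at x) (axis i 1)"

lemma pd_cong:
  assumes "open V" "x \<in> V" "\<And>z. z \<in> V \<Longrightarrow> F z = G z"
  shows "pd i F x = pd i G x"
proof -
  have "(F has_derivative D) (at x) \<longleftrightarrow> (G has_derivative D) (at x)" for D
    using assms has_derivative_transform_within_open[of F D x UNIV V G]
      has_derivative_transform_within_open[of G D x UNIV V F] by auto
  then show ?thesis by (simp add: pd_def frechet_derivative_def)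
qed

text \<open>
  \<open>C\<^sup>\<infinity>\<close> on an open set \<open>V\<close>: every iterated partial derivative is (Frechet) differentiable,
  hence continuous.
\<close>
definition smooth_on :: "R7 set \<Rightarrow> (R7 \<Rightarrow> real) \<Rightarrow> bool" where
  "smooth_on V F \<longleftrightarrow> (\<forall>is. foldr pd is F differentiable_on V)"

section \<open>Smooth 7-manifolds and tensor fields\<close>

text \<open>A chart is a domain together with a coordinate map (relevant only on the domain).\<close>

type_synonym 'a chart = "'a set \<times> ('a \<Rightarrow> R7)"

definition chart_image :: "'a chart \<Rightarrow> R7 set" where
  "chart_image c = snd c ` fst c"

definition chart_inv :: "'a chart \<Rightarrow> R7 \<Rightarrow> 'a" where
  "chart_inv c = the_inv_into (fst c) (snd c)"

definition is_chart :: "'a topology \<Rightarrow> 'a chart \<Rightarrow> bool" where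
  "is_chart M c \<longleftrightarrow> openin M (fst c) \<and> open (chart_image c) \<and>
     homeomorphic_map (subtopology M (fst c)) (top_of_set (chart_image c)) (snd c)"

definition smooth_manifold7 :: "'a topology \<Rightarrow> 'a chart set \<Rightarrow> bool" where
  "smooth_manifold7 M A \<longleftrightarrow>
     Hausdorff_space M \<and> second_countable M \<and>
     (\<forall>c\<in>A. is_chart M c) \<and> (\<Union>c\<in>A. fst c) = topspace M \<and>
     (\<forall>c\<in>A. \<forall>d\<in>A. \<forall>a.
        smooth_on (snd c ` (fst c \<inter> fst d)) (\<lambda>x. snd d (chart_inv c x) $ a))"

text \<open>The Jacobian \<open>\<partial>y\<^sup>a/\<partial>x\<^sup>i\<close> of the change from the coordinates \<open>x\<close> of \<open>c\<close> to the coordinates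
  \<open>y\<close> of \<open>d\<close>.\<close>

definition jac :: "'a chart \<Rightarrow> 'a chart \<Rightarrow> R7 \<Rightarrow> 7 \<Rightarrow> 7 \<Rightarrow> real" where
  "jac c d x a i = pd i (\<lambda>z. snd d (chart_inv c z) $ a) x"

definition chart_rep :: "'a chart \<Rightarrow> ('a \<Rightarrow> real) \<Rightarrow> R7 \<Rightarrow> real" where
  "chart_rep c f = (\<lambda>x. f (chart_inv c x))"

definition smooth_function :: "'a chart set \<Rightarrow> ('a \<Rightarrow> real) \<Rightarrow> bool" where
  "smooth_function A f \<longleftrightarrow> (\<forall>c\<in>A. smooth_on (chart_image c) (chart_rep c f))"

text \<open>
  A covariant tensor field on a manifold is the family of its component functions with respect to
  the coordinate frames \<open>\<partial>/\<partial>x\<^sup>i\<close> of all charts, subject to the usual transformation law.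
  A 7-form is given by its coefficient with respect to \<open>dx\<^sup>1 \<and> \<dots> \<and> dx\<^sup>7\<close>.
  On the index type \<open>7\<close> the numeral \<open>7\<close> denotes the same element as \<open>0\<close>; the indices are
  always understood to be ordered as \<open>1, 2, \<dots>, 7\<close>.
\<close>

type_synonym cov2 = "R7 \<Rightarrow> 7 \<Rightarrow> 7 \<Rightarrow> real"
type_synonym cov3 = "R7 \<Rightarrow> 7 \<Rightarrow> 7 \<Rightarrow> 7 \<Rightarrow> real"
type_synonym cov4 = "R7 \<Rightarrow> 7 \<Rightarrow> 7 \<Rightarrow> 7 \<Rightarrow> 7 \<Rightarrow> real"

definition tensor2_field :: "'a chart set \<Rightarrow> ('a chart \<Rightarrow> cov2) \<Rightarrow> bool" where
  "tensor2_field A S \<longleftrightarrow>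
     (\<forall>c\<in>A. \<forall>i j. smooth_on (chart_image c) (\<lambda>x. S c x i j)) \<and>
     (\<forall>c\<in>A. \<forall>d\<in>A. \<forall>p\<in>fst c \<inter> fst d. \<forall>i j.
        S c (snd c p) i j =
          (\<Sum>a\<in>UNIV. \<Sum>b\<in>UNIV.
             jac c d (snd c p) a i * jac c d (snd c p) b j * S d (snd d p) a b))"

definition tensor3_field :: "'a chart set \<Rightarrow> ('a chart \<Rightarrow> cov3) \<Rightarrow> bool" where
  "tensor3_field A S \<longleftrightarrow>
     (\<forall>c\<in>A. \<forall>i j k. smooth_on (chart_image c) (\<lambda>x. S c x i j k)) \<and>
     (\<forall>c\<in>A. \<forall>d\<in>A. \<forall>p\<in>fst c \<inter> fst d. \<forall>i j k.
        S c (snd c p) i j k =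
          (\<Sum>a\<in>UNIV. \<Sum>b\<in>UNIV. \<Sum>e\<in>UNIV.
             jac c d (snd c p) a i * jac c d (snd c p) b j * jac c d (snd c p) e k *
             S d (snd d p) a b e))"

definition three_form :: "'a chart set \<Rightarrow> ('a chart \<Rightarrow> cov3) \<Rightarrow> bool" where
  "three_form A \<phi> \<longleftrightarrow> tensor3_field A \<phi> \<and>
     (\<forall>c\<in>A. \<forall>x\<in>chart_image c. \<forall>i j k.
        \<phi> c x i j k = - \<phi> c x j i k \<and> \<phi> c x i j k = - \<phi> c x i k j)"

definition seven_form :: "'a chart set \<Rightarrow> ('a chart \<Rightarrow> R7 \<Rightarrow> real) \<Rightarrow> bool" where
  "seven_form A \<nu> \<longleftrightarrow>
     (\<forall>c\<in>A. smooth_on (chart_image c) (\<nu> c)) \<and>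
     (\<forall>c\<in>A. \<forall>d\<in>A. \<forall>p\<in>fst c \<inter> fst d.
        \<nu> c (snd c p) = det (\<chi> a i. jac c d (snd c p) a i) * \<nu> d (snd d p))"

definition riemannian_metric :: "'a chart set \<Rightarrow> ('a chart \<Rightarrow> cov2) \<Rightarrow> bool" where
  "riemannian_metric A g \<longleftrightarrow> tensor2_field A g \<and>
     (\<forall>c\<in>A. \<forall>x\<in>chart_image c.
        (\<forall>i j. g c x i j = g c x j i) \<and>
        (\<forall>v::R7. v \<noteq> 0 \<longrightarrow> (\<Sum>i\<in>UNIV. \<Sum>j\<in>UNIV. g c x i j * v $ i * v $ j) > 0))"

text \<open>
  \<open>\<nu>\<close> is the volume form of \<open>g\<close> for an orientation: a 7-form of unit length.  The orientation is
  the one in which \<open>\<nu>\<close> is positive, and \<open>\<nu> = \<plusminus>\<surd>(det g) dx\<^sup>1 \<and> \<dots> \<and> dx\<^sup>7\<close> in a chart.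
\<close>
definition volume_form :: "'a chart set \<Rightarrow> ('a chart \<Rightarrow> cov2) \<Rightarrow> ('a chart \<Rightarrow> R7 \<Rightarrow> real) \<Rightarrow> bool"
  where
  "volume_form A g \<nu> \<longleftrightarrow> seven_form A \<nu> \<and>
     (\<forall>c\<in>A. \<forall>x\<in>chart_image c. (\<nu> c x)\<^sup>2 = det (\<chi> i j. g c x i j))"

section \<open>Riemannian geometry in a chart\<close>

text \<open>
  A repeated index that is summed over a local orthonormal frame becomes, in an arbitrary
  coordinate frame, a contraction with the inverse metric; \<open>contr g x (\<lambda>p q. F p q)\<close> is
  \<open>g\<^sup>p\<^sup>q F\<^sub>p\<^sub>q\<close> at \<open>x\<close>, that is \<open>F\<^sub>p\<^sub>p\<close> in an orthonormal frame.
\<close>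

definition ginv :: "cov2 \<Rightarrow> cov2" where
  "ginv g x i j = matrix_inv (\<chi> a b. g x a b) $ i $ j"

definition contr :: "cov2 \<Rightarrow> R7 \<Rightarrow> (7 \<Rightarrow> 7 \<Rightarrow> real) \<Rightarrow> real" where
  "contr g x F = (\<Sum>p\<in>UNIV. \<Sum>q\<in>UNIV. ginv g x p q * F p q)"

text \<open>\<open>christoffel g x k i j\<close> is \<open>\<Gamma>\<^sup>k\<^sub>i\<^sub>j\<close>, where \<open>\<nabla>\<^sub>i \<partial>\<^sub>j = \<Gamma>\<^sup>k\<^sub>i\<^sub>j \<partial>\<^sub>k\<close> for the Levi-Civita connection.\<close>

definition christoffel :: "cov2 \<Rightarrow> R7 \<Rightarrow> 7 \<Rightarrow> 7 \<Rightarrow> 7 \<Rightarrow> real" where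
  "christoffel g x k i j =
     (\<Sum>l\<in>UNIV. ginv g x k l *
        (pd i (\<lambda>z. g z j l) x + pd j (\<lambda>z. g z i l) x - pd l (\<lambda>z. g z i j) x)) / 2"

text \<open>In the covariant derivatives the first index is that of the direction of differentiation.\<close>

definition nabla2 :: "cov2 \<Rightarrow> cov2 \<Rightarrow> cov3" where
  "nabla2 g S x m i j = pd m (\<lambda>z. S z i j) x
     - (\<Sum>p\<in>UNIV. christoffel g x p m i * S x p j)
     - (\<Sum>p\<in>UNIV. christoffel g x p m j * S x i p)"

text \<open>The connection with symbols \<open>christoffel g\<close> is torsion free and metric.\<close>

lemma christoffel_torsion_free_metric:
  assumes V: "open V" "x \<in> V" and sym: "\<And>z i j. z \<in> V \<Longrightarrow> g z i j = g z j i"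
    and inv: "invertible (\<chi> a b. g x a b)"
  shows "christoffel g x k i j = christoffel g x k j i" and "nabla2 g g x m i j = 0"
proof -
  have pds: "pd m (\<lambda>z. g z i j) x = pd m (\<lambda>z. g z j i) x" for m i j
    using pd_cong[OF V, of "\<lambda>z. g z i j" "\<lambda>z. g z j i"] sym by blast
  show "christoffel g x k i j = christoffel g x k j i"
    unfolding christoffel_def using pds[of _ i j] by (simp add: algebra_simps)
  let ?G = "\<chi> a b. g x a b"
  have GG: "?G ** matrix_inv ?G = mat 1"
    using inv unfolding invertible_def matrix_inv_def
    by (rule someI2_ex) blast
  have d: "(\<Sum>p\<in>UNIV. g x j p * ginv g x p l) = (if j = l then 1 else 0)" for j l
    using arg_cong[OF GG, of "\<lambda>M. M $ j $ l"]
    by (simp add: matrix_matrix_mult_def mat_def ginv_def)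
  have low: "(\<Sum>p\<in>UNIV. christoffel g x p a b * g x e p) =
      (pd a (\<lambda>z. g z b e) x + pd b (\<lambda>z. g z a e) x - pd e (\<lambda>z. g z a b) x) / 2" for a b e
  proof -
    let ?h = "\<lambda>l. pd a (\<lambda>z. g z b l) x + pd b (\<lambda>z. g z a l) x - pd l (\<lambda>z. g z a b) x"
    have "(\<Sum>p\<in>UNIV. christoffel g x p a b * g x e p) =
        (\<Sum>p\<in>UNIV. \<Sum>l\<in>UNIV. (g x e p * ginv g x p l) * (?h l / 2))"
      by (simp add: christoffel_def sum_divide_distrib sum_distrib_left sum_distrib_right mult.assoc mult.left_commute mult.commute)
    also have "\<dots> = (\<Sum>l\<in>UNIV. (\<Sum>p\<in>UNIV. g x e p * ginv g x p l) * (?h l / 2))"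
      by (subst sum.swap) (simp only: sum_distrib_right)
    also have "\<dots> = (\<Sum>l\<in>UNIV. if e = l then ?h l / 2 else 0)"
      by (intro sum.cong refl) (simp add: d)
    also have "\<dots> = ?h e / 2"
      by (subst sum.delta') auto
    finally show ?thesis .
  qed
  have "(\<Sum>p\<in>UNIV. christoffel g x p m i * g x p j) = (\<Sum>p\<in>UNIV. christoffel g x p m i * g x j p)"
    by (intro sum.cong refl) (simp add: sym[OF V(2)])
  then show "nabla2 g g x m i j = 0"
    unfolding nabla2_def using low[of m i j] low[of m j i] pds[of m i j] pds[of i m j] pds[of j m i]
    by (simp add: field_simps)
qed

definition nabla3 :: "cov2 \<Rightarrow> cov3 \<Rightarrow> cov4" where
  "nabla3 g S x m i j k = pd m (\<lambda>z. S z i j k) x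
     - (\<Sum>p\<in>UNIV. christoffel g x p m i * S x p j k)
     - (\<Sum>p\<in>UNIV. christoffel g x p m j * S x i p k)
     - (\<Sum>p\<in>UNIV. christoffel g x p m k * S x i j p)"

text \<open>
  \<open>riemann g x l k i j\<close> is the \<open>\<partial>\<^sub>l\<close>-component of \<open>R(\<partial>\<^sub>i,\<partial>\<^sub>j)\<partial>\<^sub>k\<close>, where
  \<open>R(X,Y)Z = \<nabla>\<^sub>X\<nabla>\<^sub>Y Z - \<nabla>\<^sub>Y\<nabla>\<^sub>X Z - \<nabla>\<^bsub>[X,Y]\<^esub> Z\<close>; and \<open>Ric(Y,Z)\<close> is the trace of \<open>X \<mapsto> R(X,Y)Z\<close>,
  so that round spheres have positive Ricci curvature.
\<close>
definition riemann :: "cov2 \<Rightarrow> R7 \<Rightarrow> 7 \<Rightarrow> 7 \<Rightarrow> 7 \<Rightarrow> 7 \<Rightarrow> real" where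
  "riemann g x l k i j =
     pd i (\<lambda>z. christoffel g z l j k) x - pd j (\<lambda>z. christoffel g z l i k) x
     + (\<Sum>p\<in>UNIV. christoffel g x l i p * christoffel g x p j k
                 - christoffel g x l j p * christoffel g x p i k)"

definition ricci :: "cov2 \<Rightarrow> cov2" where
  "ricci g x j k = (\<Sum>i\<in>UNIV. riemann g x i k i j)"

definition scal :: "cov2 \<Rightarrow> R7 \<Rightarrow> real" where
  "scal g x = contr g x (ricci g x)"

definition grad :: "cov2 \<Rightarrow> (R7 \<Rightarrow> real) \<Rightarrow> R7 \<Rightarrow> 7 \<Rightarrow> real" where
  "grad g f x p = (\<Sum>q\<in>UNIV. ginv g x p q * pd q f x)"

definition grad_norm2 :: "cov2 \<Rightarrow> (R7 \<Rightarrow> real) \<Rightarrow> R7 \<Rightarrow> real" where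
  "grad_norm2 g f x = contr g x (\<lambda>p q. pd p f x * pd q f x)"

definition laplacian :: "cov2 \<Rightarrow> (R7 \<Rightarrow> real) \<Rightarrow> R7 \<Rightarrow> real" where
  "laplacian g f x =
     contr g x (\<lambda>i j. pd i (pd j f) x - (\<Sum>k\<in>UNIV. christoffel g x k i j * pd k f x))"

text \<open>\<open>(div S)\<^sub>j = \<nabla>\<^sub>i S\<^sub>i\<^sub>j\<close>\<close>

definition divergence :: "cov2 \<Rightarrow> cov2 \<Rightarrow> R7 \<Rightarrow> 7 \<Rightarrow> real" where
  "divergence g S x j = contr g x (\<lambda>m i. nabla2 g S x m i j)"

definition norm2 :: "cov2 \<Rightarrow> cov2 \<Rightarrow> R7 \<Rightarrow> real" where
  "norm2 g S x = contr g x (\<lambda>i a. contr g x (\<lambda>j b. S x i j * S x a b))"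

text \<open>\<open>(S\<^sup>tS)\<^sub>i\<^sub>j = S\<^sub>p\<^sub>i S\<^sub>p\<^sub>j\<close>\<close>

definition transpose_mult :: "cov2 \<Rightarrow> cov2 \<Rightarrow> cov2" where
  "transpose_mult g S x i j = contr g x (\<lambda>p q. S x p i * S x q j)"

text \<open>The Lie derivative of a 3-form \<open>\<phi>\<close> along the vector field with components \<open>X\<close>.\<close>

definition lie3 :: "(R7 \<Rightarrow> 7 \<Rightarrow> real) \<Rightarrow> cov3 \<Rightarrow> cov3" where
  "lie3 X \<phi> x i j k =
     (\<Sum>p\<in>UNIV. X x p * pd p (\<lambda>z. \<phi> z i j k) x
       + pd i (\<lambda>z. X z p) x * \<phi> x p j k
       + pd j (\<lambda>z. X z p) x * \<phi> x i p k
       + pd k (\<lambda>z. X z p) x * \<phi> x i j p)"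

section \<open>\<open>G\<^sub>2\<close>-structures and Ricci-harmonic solitons\<close>

text \<open>The coefficient of \<open>\<alpha> \<and> \<beta> \<and> \<gamma>\<close> with respect to \<open>dx\<^sup>1 \<and> \<dots> \<and> dx\<^sup>7\<close>, for two 2-forms and a
  3-form, with the normalisation \<open>(dx\<^sup>1 \<and> \<dots> \<and> dx\<^sup>k)(\<partial>\<^sub>1, \<dots>, \<partial>\<^sub>k) = 1\<close>.\<close>

definition wedge223 :: "(7 \<Rightarrow> 7 \<Rightarrow> real) \<Rightarrow> (7 \<Rightarrow> 7 \<Rightarrow> real) \<Rightarrow> (7 \<Rightarrow> 7 \<Rightarrow> 7 \<Rightarrow> real) \<Rightarrow> real" where
  "wedge223 \<alpha> \<beta> \<gamma> =
     (\<Sum>p | p permutes (UNIV::7 set).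
        of_int (sign p) * \<alpha> (p 1) (p 2) * \<beta> (p 3) (p 4) * \<gamma> (p 5) (p 6) (p 7))
     / (fact 2 * fact 2 * fact 3)"

definition levi_civita_symbol :: "7 \<Rightarrow> 7 \<Rightarrow> 7 \<Rightarrow> 7 \<Rightarrow> 7 \<Rightarrow> 7 \<Rightarrow> 7 \<Rightarrow> real" where
  "levi_civita_symbol a b c i j k l =
     (let p = (\<lambda>_. l)(1 := a, 2 := b, 3 := c, 4 := i, 5 := j, 6 := k)
      in if p permutes UNIV then of_int (sign p) else 0)"

text \<open>The Hodge star of a 3-form, \<open>(*\<phi>)\<^sub>i\<^sub>j\<^sub>k\<^sub>l = (1/3!) \<phi>\<^sub>a\<^sub>b\<^sub>c vol\<^sub>a\<^sub>b\<^sub>c\<^sub>i\<^sub>j\<^sub>k\<^sub>l\<close>.\<close>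

definition hodge3 :: "cov2 \<Rightarrow> (R7 \<Rightarrow> real) \<Rightarrow> cov3 \<Rightarrow> cov4" where
  "hodge3 g \<nu> \<phi> x i j k l =
     contr g x (\<lambda>a a'. contr g x (\<lambda>b b'. contr g x (\<lambda>c c'.
       \<phi> x a' b' c' * \<nu> x * levi_civita_symbol a b c i j k l))) / fact 3"

text \<open>
  \<open>\<phi>\<close> is a nondegenerate 3-form, determining the metric \<open>g\<close> and the volume form \<open>\<nu>\<close> (hence the
  orientation) by \<open>(X \<lrcorner> \<phi>) \<and> (Y \<lrcorner> \<phi>) \<and> \<phi> = -6 g(X,Y) \<nu>\<close>.
\<close>
definition g2_structure ::
  "'a chart set \<Rightarrow> ('a chart \<Rightarrow> cov3) \<Rightarrow> ('a chart \<Rightarrow> cov2) \<Rightarrow> ('a chart \<Rightarrow> R7 \<Rightarrow> real) \<Rightarrow> bool"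
  where
  "g2_structure A \<phi> g \<nu> \<longleftrightarrow>
     three_form A \<phi> \<and> riemannian_metric A g \<and> volume_form A g \<nu> \<and>
     (\<forall>c\<in>A. \<forall>x\<in>chart_image c. \<forall>i j.
        wedge223 (\<phi> c x i) (\<phi> c x j) (\<phi> c x) = - 6 * g c x i j * \<nu> c x)"

text \<open>The torsion: \<open>\<nabla>\<^sub>m \<phi>\<^sub>i\<^sub>j\<^sub>k = T\<^sub>m\<^sub>p \<psi>\<^sub>p\<^sub>i\<^sub>j\<^sub>k\<close> with \<open>\<psi> = *\<phi>\<close>.\<close>

definition is_torsion ::
  "'a chart set \<Rightarrow> ('a chart \<Rightarrow> cov3) \<Rightarrow> ('a chart \<Rightarrow> cov2) \<Rightarrow> ('a chart \<Rightarrow> R7 \<Rightarrow> real) \<Rightarrow>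
   ('a chart \<Rightarrow> cov2) \<Rightarrow> bool"
  where
  "is_torsion A \<phi> g \<nu> T \<longleftrightarrow> tensor2_field A T \<and>
     (\<forall>c\<in>A. \<forall>x\<in>chart_image c. \<forall>m i j k.
        nabla3 (g c) (\<phi> c) x m i j k =
          contr (g c) x (\<lambda>p q. T c x m p * hodge3 (g c) (\<nu> c) (\<phi> c) x q i j k))"

definition diamond :: "cov2 \<Rightarrow> cov2 \<Rightarrow> cov3 \<Rightarrow> cov3" where
  "diamond g h \<phi> x i j k =
     contr g x (\<lambda>p q. h x i p * \<phi> x q j k)
     + contr g x (\<lambda>p q. h x j p * \<phi> x i q k)
     + contr g x (\<lambda>p q. h x k p * \<phi> x i j q)"

text \<open>\<open>(X \<lrcorner> \<psi>)\<^sub>i\<^sub>j\<^sub>k = X\<^sub>l \<psi>\<^sub>l\<^sub>i\<^sub>j\<^sub>k\<close> for a vector field given by its lowered components \<open>X\<^sub>l\<close>.\<close>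

definition hook4 :: "cov2 \<Rightarrow> (R7 \<Rightarrow> 7 \<Rightarrow> real) \<Rightarrow> cov4 \<Rightarrow> cov3" where
  "hook4 g X \<psi> x i j k = contr g x (\<lambda>a l. X x a * \<psi> x l i j k)"

definition gradient_ricci_harmonic_soliton ::
  "'a chart set \<Rightarrow> ('a chart \<Rightarrow> cov3) \<Rightarrow> ('a chart \<Rightarrow> cov2) \<Rightarrow> ('a chart \<Rightarrow> R7 \<Rightarrow> real) \<Rightarrow>
   ('a chart \<Rightarrow> cov2) \<Rightarrow> ('a \<Rightarrow> real) \<Rightarrow> real \<Rightarrow> bool"
  where
  "gradient_ricci_harmonic_soliton A \<phi> g \<nu> T f lam \<longleftrightarrow>
     g2_structure A \<phi> g \<nu> \<and> is_torsion A \<phi> g \<nu> T \<and> smooth_function A f \<and>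
     (\<forall>c\<in>A. \<forall>x\<in>chart_image c. \<forall>i j k.
        diamond (g c)
          (\<lambda>y a b. - ricci (g c) y a b + 3 * transpose_mult (g c) (T c) y a b
                   - norm2 (g c) (T c) y * g c y a b) (\<phi> c) x i j k
        + hook4 (g c) (divergence (g c) (T c)) (hodge3 (g c) (\<nu> c) (\<phi> c)) x i j k
        = lam * \<phi> c x i j k + lie3 (grad (g c) (chart_rep c f)) (\<phi> c) x i j k)"

end

theory Submission
  imports Defs
begin

text \<open>
  The soliton equation is an equation of 3-forms. Since \<open>\<L>\<^bsub>\<nabla>f\<^esub>\<phi> = \<nabla>\<^bsub>\<nabla>f\<^esub>\<phi> + (Hess f) \<diamondop> \<phi>\<close> and
  \<open>\<nabla>\<phi>\<close> is the torsion contracted with \<open>\<psi>\<close> (\<open>lie3_grad\<close>), and since \<open>3 \<phi> = g \<diamondop> \<phi>\<close>, it reads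
  \<open>h \<diamondop> \<phi> + Y \<lrcorner> \<psi> = 0\<close> with \<open>Y = div T - \<nabla>f \<lrcorner> T\<close> and the symmetric tensor
  \<open>h = - Ric + 3 T\<^sup>tT - |T|\<^sup>2 g - Hess f - (\<lambda>/3) g\<close>. The two summands lie in complementary
  \<open>G\<^sub>2\<close>-modules, so \<open>h = 0\<close> (\<open>diamond_hook4_eq_0\<close>). The trace of \<open>h = 0\<close> is the first identity.
  Its divergence, together with the contracted Bianchi identity \<open>2 div Ric = dR\<close>
  (\<open>divergence_ricci\<close>), the Bochner formula \<open>div (Hess f) = d \<Delta>f + Ric(\<nabla>f)\<close>
  (\<open>divergence_hess\<close>), the differential of the first identity and \<open>h(\<nabla>f) = 0\<close>, gives the second one
  (\<open>soliton_identities\<close>).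
  
  The algebraic step uses only that \<open>(X \<lrcorner> \<phi>) \<and> (Y \<lrcorner> \<phi>) \<and> \<phi>\<close> is a nonzero multiple \<open>\<kappa>\<close> of
  \<open>g(X,Y) vol\<close>, and no normal form of \<open>\<phi>\<close>. Write \<open>\<times>\<close> for the cross product,
  \<open>g(x \<times> y, z) = \<phi>(x,y,z)\<close>, and let \<open>x * y\<close> be the product obtained in the same way from
  the trilinear form \<open>(y \<lrcorner> \<phi>) \<and> \<phi> \<and> x \<and> z\<close>. Contracting exterior products of degree
  eight, which vanish, shows that the second form is alternating too, and that
  \<open>x \<times> (x * u) = (\<kappa>/3) (g(x,x) u - g(x,u) x)\<close>. Polarisation turns this into
  \<open>x \<times> (n * u) = x * (n \<times> u)\<close>; applying it to \<open>n \<times> u\<close> compares \<open>x \<times> (x \<times> u)\<close> with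
  \<open>n \<times> (n \<times> u)\<close> (\<open>cross_cross_exchange\<close>), and traces over \<open>u\<close> and \<open>n\<close> yield the usual
  identity \<open>x \<times> (x \<times> u) = - \<mu> (g(x,x) u - g(x,u) x)\<close> with a constant \<open>\<mu> \<noteq> 0\<close>. Contracting
  \<open>h \<diamondop> \<phi> + Y \<lrcorner> \<psi> = 0\<close> with \<open>\<phi>\<close> in two indices and taking the symmetric part then
  leaves a multiple of \<open>2 h + tr(h) g\<close>: the contraction of \<open>\<psi>\<close> with \<open>\<phi>\<close> is dual to
  the form that defines \<open>*\<close>, hence alternating.
\<close>

abbreviation (input) index_sum :: "('i \<Rightarrow> 'a::comm_monoid_add) \<Rightarrow> 'a" (binder "\<Sum>:" 10) where
  "index_sum f \<equiv> sum f UNIV"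

section \<open>The exterior algebra\<close>

text \<open>
  The sign of the shuffle that sorts \<open>A\<close> followed by \<open>B\<close>: one factor \<open>-1\<close> for every inversion.
\<close>
definition inv_sign :: "'n::{finite,linorder} set \<Rightarrow> 'n set \<Rightarrow> real" where
  "inv_sign A B = (\<Prod>a\<in>A. \<Prod>b\<in>B. if b < a then - 1 else 1)"

lemma inv_sign_Un_left:
  "A \<inter> B = {} \<Longrightarrow> inv_sign (A \<union> B) C = inv_sign A C * inv_sign B C"
  unfolding inv_sign_def by (simp add: prod.union_disjoint)

lemma inv_sign_Un_right:
  "B \<inter> C = {} \<Longrightarrow> inv_sign A (B \<union> C) = inv_sign A B * inv_sign A C"
  unfolding inv_sign_def by (simp add: prod.union_disjoint prod.distrib)

lemma inv_sign_empty [simp]: "inv_sign {} B = 1" "inv_sign A {} = 1"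
  by (simp_all add: inv_sign_def)

text \<open>
  For disjoint sets, each pair is an inversion in exactly one of the two orders.
\<close>
lemma inv_sign_swap:
  assumes "A \<inter> B = {}"
  shows "inv_sign A B * inv_sign B A = (- 1) ^ (card A * card B)"
proof -
  have "inv_sign A B * inv_sign B A
      = (\<Prod>a\<in>A. \<Prod>b\<in>B. (if b < a then - 1 else 1) * (if a < b then - 1 else 1))"
    unfolding inv_sign_def prod.swap[of _ A B] by (simp add: prod.distrib)
  also have "\<dots> = (\<Prod>a\<in>A. \<Prod>b\<in>B. - 1)"
    using assms by (intro prod.cong refl) (auto simp: not_less_iff_gr_or_eq)
  also have "\<dots> = (- 1) ^ (card B * card A)"
    by (simp only: prod_constant power_mult)
  finally show ?thesis by (simp only: mult.commute)
qed

lemma inv_sign_square [simp]: "inv_sign A B * inv_sign A B = 1"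
proof -
  have "inv_sign A B * inv_sign A B = (\<Prod>a\<in>A. \<Prod>b\<in>B. 1)"
    unfolding inv_sign_def by (simp only: prod.distrib[symmetric], intro prod.cong refl) auto
  then show ?thesis by simp
qed

lemma inv_sign_commute:
  assumes "A \<inter> B = {}"
  shows "inv_sign B A = (- 1) ^ (card A * card B) * inv_sign A B"
  using inv_sign_swap[OF assms] inv_sign_square[of A B] by (metis mult.assoc mult.commute mult_1)

text \<open>
  A form is stored by its coefficients with respect to the basis \<open>dx\<^sub>S\<close>, the increasing exterior
  products indexed by the sets \<open>S\<close> of indices. Making this a ring lets identities between forms of
  mixed degree be computed as ordinary products.
\<close>
typedef (overloaded) 'n exterior = "UNIV :: ('n::{finite,linorder} set \<Rightarrow> real) set"
  morphisms coef Ext by simp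

lemma coef_Ext [simp]: "coef (Ext f) = f"
  by (simp add: Ext_inverse)

lemma exterior_eqI: "(\<And>S. coef x S = coef y S) \<Longrightarrow> x = y"
  by (metis coef_inverse ext)

instantiation exterior :: ("{finite,linorder}") real_algebra_1
begin

definition "0 = Ext (\<lambda>S. 0)"
definition "1 = Ext (\<lambda>S. if S = {} then 1 else 0)"
definition "x + y = Ext (\<lambda>S. coef x S + coef y S)"
definition "- x = Ext (\<lambda>S. - coef x S)"
definition "x - y = Ext (\<lambda>S. coef x S - coef y S)"
definition "r *\<^sub>R x = Ext (\<lambda>S. r * coef x S)"
definition "x * y = Ext (\<lambda>S. \<Sum>A\<in>Pow S. inv_sign A (S - A) * coef x A * coef y (S - A))"

lemma coef_simps [simp]:
  "coef 0 S = 0" "coef 1 S = (if S = {} then 1 else 0)" "coef (x + y) S = coef x S + coef y S"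
  "coef (- x) S = - coef x S" "coef (x - y) S = coef x S - coef y S"
  "coef (r *\<^sub>R x) S = r * coef x S"
  by (simp_all add: zero_exterior_def one_exterior_def plus_exterior_def uminus_exterior_def
      minus_exterior_def scaleR_exterior_def)

lemma coef_mult:
  "coef (x * y) S = (\<Sum>A\<in>Pow S. inv_sign A (S - A) * coef x A * coef y (S - A))"
  by (simp add: times_exterior_def)

text \<open>
  Both sides are sums over the ordered partitions of \<open>S\<close> into three sets, and the signs agree because
  \<open>inv_sign\<close> is multiplicative in each argument.
\<close>
lemma coef_mult_assoc: "coef (x * y * z) S = coef (x * (y * z)) S"
proof -
  have "coef (x * y * z) S = (\<Sum>A\<in>Pow S. \<Sum>B\<in>Pow A.
      inv_sign A (S - A) * inv_sign B (A - B) * coef x B * coef y (A - B) * coef z (S - A))"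
    by (simp add: coef_mult sum_distrib_left sum_distrib_right mult_ac)
  also have "\<dots> = (\<Sum>(A,B)\<in>Sigma (Pow S) Pow.
      inv_sign A (S - A) * inv_sign B (A - B) * coef x B * coef y (A - B) * coef z (S - A))"
    by (simp add: sum.Sigma)
  also have "\<dots> = (\<Sum>(B,C)\<in>Sigma (Pow S) (\<lambda>B. Pow (S - B)).
      inv_sign B (S - B) * inv_sign C (S - B - C) * coef x B * coef y C * coef z (S - B - C))"
  proof (rule sum.reindex_bij_witness[where i = "\<lambda>(B,C). (B \<union> C, B)" and j = "\<lambda>(A,B). (B, A - B)"])
    fix p assume "p \<in> Sigma (Pow S) Pow"
    then obtain A B where p: "p = (A, B)" "A \<subseteq> S" "B \<subseteq> A" by auto
    have SB: "S - B = (A - B) \<union> (S - A)" using p by auto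
    have "inv_sign A (S - A) = inv_sign B (S - A) * inv_sign (A - B) (S - A)"
      using inv_sign_Un_left[of B "A - B" "S - A"] p by (simp add: Un_absorb1)
    moreover have "inv_sign B (S - B) = inv_sign B (A - B) * inv_sign B (S - A)"
      using inv_sign_Un_right[of "A - B" "S - A" B] unfolding SB by blast
    moreover have "S - B - (A - B) = S - A" using p by auto
    ultimately show "(case (case p of (A, B) \<Rightarrow> (B, A - B)) of (B, C) \<Rightarrow>
        inv_sign B (S - B) * inv_sign C (S - B - C) * coef x B * coef y C * coef z (S - B - C)) =
      (case p of (A, B) \<Rightarrow>
        inv_sign A (S - A) * inv_sign B (A - B) * coef x B * coef y (A - B) * coef z (S - A))"
      by (simp add: p)
  qed auto
  also have "\<dots> = coef (x * (y * z)) S"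
    by (simp add: coef_mult sum_distrib_left sum_distrib_right sum.Sigma mult_ac)
  finally show ?thesis .
qed

instance
proof
  fix a b c :: "'a exterior" and r s :: real
  show "a * b * c = a * (b * c)" by (rule exterior_eqI) (rule coef_mult_assoc)
  show "1 * a = a"
  proof (rule exterior_eqI)
    fix S
    have "coef (1 * a) S = (\<Sum>A\<in>Pow S. if A = {} then coef a S else 0)"
      unfolding coef_mult by (intro sum.cong refl) simp
    then show "coef (1 * a) S = coef a S" by simp
  qed
  show "a * 1 = a"
  proof (rule exterior_eqI)
    fix S
    have "coef (a * 1) S = (\<Sum>A\<in>Pow S. if A = S then coef a S else 0)"
      unfolding coef_mult by (intro sum.cong refl) auto
    then show "coef (a * 1) S = coef a S" by simp
  qed
  show "(a + b) * c = a * c + b * c" "a * (b + c) = a * b + a * c"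
    by (rule exterior_eqI, simp add: coef_mult algebra_simps sum.distrib)+
  show "r *\<^sub>R a * b = r *\<^sub>R (a * b)" "a * r *\<^sub>R b = r *\<^sub>R (a * b)"
    by (rule exterior_eqI, simp add: coef_mult sum_distrib_left mult_ac)+
  show "(0::'a exterior) \<noteq> 1"
  proof
    assume "(0::'a exterior) = 1"
    then have "coef (0::'a exterior) {} = coef 1 {}" by simp
    then show False by simp
  qed
qed (rule exterior_eqI, simp add: algebra_simps)+

end

lemma coef_sum: "coef (sum f A) S = (\<Sum>a\<in>A. coef (f a) S)"
  by (induction A rule: infinite_finite_induct) auto

text \<open>
  The involution that is \<open>(-1)\<^sup>k\<close> on forms of degree \<open>k\<close>. It is all that the commutation rules and the
  Leibniz rule need to know about degrees.
\<close>
definition parity :: "'n::{finite,linorder} exterior \<Rightarrow> 'n exterior" where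
  "parity x = Ext (\<lambda>S. (- 1) ^ card S * coef x S)"

lemma coef_parity [simp]: "coef (parity x) S = (- 1) ^ card S * coef x S"
  by (simp add: parity_def)

lemma parity_simps [simp]: "parity 0 = 0" "parity 1 = 1" "parity (x + y) = parity x + parity y" "parity (x - y) = parity x - parity y"
  "parity (- x) = - parity x" "parity (r *\<^sub>R x) = r *\<^sub>R parity x" "parity (parity x) = x"
  by (rule exterior_eqI, simp add: algebra_simps flip: power_add)+

lemma parity_sum: "parity (sum f A) = (\<Sum>a\<in>A. parity (f a))"
  by (induction A rule: infinite_finite_induct) auto

lemma parity_mult [simp]: "parity (x * y) = parity x * parity y"
proof (rule exterior_eqI)
  fix S :: "'a set"
  have "(- 1 :: real) ^ card S = (- 1) ^ card A * (- 1) ^ card (S - A)" if "A \<subseteq> S" for A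
    using that by (metis card_Diff_subset card_mono finite le_add_diff_inverse power_add)
  then show "coef (parity (x * y)) S = coef (parity x * parity y) S"
    by (simp add: coef_mult sum_distrib_left mult_ac)
qed

definition even_form :: "'n::{finite,linorder} exterior \<Rightarrow> bool" where
  "even_form x \<longleftrightarrow> parity x = x"
definition odd_form :: "'n::{finite,linorder} exterior \<Rightarrow> bool" where
  "odd_form x \<longleftrightarrow> parity x = - x"

lemma coef_mult_flip:
  "coef (y * x) S = (\<Sum>A\<in>Pow S. inv_sign (S - A) A * coef x A * coef y (S - A))"
  unfolding coef_mult
  by (rule sum.reindex_bij_witness[where i = "\<lambda>A. S - A" and j = "\<lambda>A. S - A"])
     (auto simp: double_diff mult_ac)

lemma even_form_commute:
  assumes "even_form x" shows "x * y = y * x"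
proof (rule exterior_eqI)
  fix S :: "'a set"
  have *: "(- 1) ^ (card A * k) * coef x A = coef x A" for A k
    using arg_cong[OF assms[unfolded even_form_def], of "\<lambda>z. coef z A"]
    by (cases "even (card A)") auto
  show "coef (x * y) S = coef (y * x) S"
    unfolding coef_mult[of x y] coef_mult_flip[of y x]
  proof (intro sum.cong refl)
    fix A assume "A \<in> Pow S"
    show "inv_sign A (S - A) * coef x A * coef y (S - A) = inv_sign (S - A) A * coef x A * coef y (S - A)"
      unfolding inv_sign_commute[OF Diff_disjoint]
      using arg_cong[OF *[of A "card (S - A)"], of "\<lambda>z. inv_sign A (S - A) * z * coef y (S - A)", symmetric]
      by (simp only: mult_ac)
  qed
qed

lemma odd_form_commute:
  assumes "odd_form x" shows "x * y = parity y * x"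
proof (rule exterior_eqI)
  fix S :: "'a set"
  have *: "(- 1) ^ (card A * k) * coef x A = (- 1) ^ k * coef x A" for A k
    using arg_cong[OF assms[unfolded odd_form_def], of "\<lambda>z. coef z A"]
    by (cases "even (card A)"; cases "even k") auto
  show "coef (x * y) S = coef (parity y * x) S"
    unfolding coef_mult[of x y] coef_mult_flip[of "parity y" x]
  proof (intro sum.cong refl)
    fix A assume "A \<in> Pow S"
    define K where "K = ((- 1) ^ card (S - A) :: real)"
    have "K * K = 1" unfolding K_def by (simp flip: power_add)
    then have "coef x A = K * ((- 1) ^ (card A * card (S - A)) * coef x A)"
      unfolding * K_def by (metis mult.assoc mult_1)
    then show "inv_sign A (S - A) * coef x A * coef y (S - A) = inv_sign (S - A) A * coef x A * coef (parity y) (S - A)"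
      unfolding inv_sign_commute[OF Diff_disjoint] coef_parity K_def[symmetric]
      by (metis mult.assoc mult.commute)
  qed
qed

lemma odd_form_square: assumes "odd_form x" shows "x * x = 0"
proof -
  have "x * x = - (x * x)" using odd_form_commute[OF assms, of x] assms by (simp add: odd_form_def)
  then have "coef (x * x) S = - coef (x * x) S" for S
    by (metis coef_simps(4))
  then have "coef (x * x) S = 0" for S
    by (metis equal_neg_zero)
  then show ?thesis by (intro exterior_eqI) simp
qed

text \<open>
  The coefficients of the interior product with the \<open>i\<close>-th basis vector.
\<close>
definition deriv_coef :: "'n::{finite,linorder} \<Rightarrow> 'n exterior \<Rightarrow> 'n set \<Rightarrow> real" where
  "deriv_coef i x S = (if i \<in> S then 0 else inv_sign {i} S * coef x (insert i S))"

text \<open>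
  The graded Leibniz rule for one basis vector. If \<open>i\<close> is not in \<open>S\<close>, the subsets of \<open>S \<union> {i}\<close> are
  split according to which factor receives \<open>i\<close>.
\<close>
lemma deriv_coef_mult:
  "deriv_coef i (x * y) S =
     (\<Sum>A\<in>Pow S. inv_sign A (S - A) * deriv_coef i x A * coef y (S - A)) +
     (\<Sum>A\<in>Pow S. inv_sign A (S - A) * coef (parity x) A * deriv_coef i y (S - A))"
proof (cases "i \<in> S")
  case False
  have split: "Pow (insert i S) = Pow S \<union> insert i ` Pow S" by (rule Pow_insert)
  have disj: "Pow S \<inter> insert i ` Pow S = {}" using False by auto
  have inj: "inj_on (insert i) (Pow S)"
    by (rule inj_onI) (metis False PowD insert_ident subsetD)
  have s0: "coef (x * y) (insert i S) =
      (\<Sum>A\<in>Pow S. inv_sign A (insert i S - A) * coef x A * coef y (insert i S - A)) +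
      (\<Sum>A\<in>Pow S. inv_sign (insert i A) (insert i S - insert i A) * coef x (insert i A) *
         coef y (insert i S - insert i A))"
    unfolding coef_mult split by (simp add: sum.union_disjoint disj sum.reindex[OF inj])
  have s1: "inv_sign {i} S * (inv_sign A (insert i S - A) * coef x A * coef y (insert i S - A))
      = inv_sign A (S - A) * coef (parity x) A * deriv_coef i y (S - A)" if A: "A \<in> Pow S" for A
  proof -
    have eq: "insert i S - A = insert i (S - A)" using A False by auto
    have 1: "inv_sign {i} S = inv_sign {i} A * inv_sign {i} (S - A)"
      using inv_sign_Un_right[of A "S - A" "{i}"] A by (simp add: Un_absorb1)
    have 2: "inv_sign A (insert i (S - A)) = inv_sign A {i} * inv_sign A (S - A)"
      using inv_sign_Un_right[of "{i}" "S - A" A] A False by simp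
    have 3: "(- 1) ^ card A = inv_sign {i} A * inv_sign A {i}"
      using inv_sign_swap[of "{i}" A] subsetD[of A S i] A False by (cases "i \<in> A") auto
    have 4: "(i \<in> S - A) = False" using False by auto
    show ?thesis unfolding eq deriv_coef_def coef_parity 4 if_False 1 2 3 by (simp only: mult_ac)
  qed
  have s2: "inv_sign {i} S * (inv_sign (insert i A) (insert i S - insert i A) * coef x (insert i A) *
         coef y (insert i S - insert i A))
      = inv_sign A (S - A) * deriv_coef i x A * coef y (S - A)" if A: "A \<in> Pow S" for A
  proof -
    have eq: "insert i S - insert i A = S - A" using A False by auto
    have 1: "inv_sign {i} S = inv_sign {i} A * inv_sign {i} (S - A)"
      using inv_sign_Un_right[of A "S - A" "{i}"] A by (simp add: Un_absorb1)
    have 2: "inv_sign (insert i A) (S - A) = inv_sign {i} (S - A) * inv_sign A (S - A)"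
      using inv_sign_Un_left[of "{i}" A "S - A"] A False by auto
    have "inv_sign {i} (S - A) * inv_sign {i} (S - A) * (inv_sign {i} A * inv_sign A (S - A)) =
        inv_sign {i} A * inv_sign A (S - A)" by simp
    then have 3: "inv_sign {i} A * inv_sign {i} (S - A) * (inv_sign {i} (S - A) * inv_sign A (S - A)) =
        inv_sign {i} A * inv_sign A (S - A)" by (simp only: mult_ac)
    have 4: "(i \<in> A) = False" using A False by auto
    show ?thesis unfolding eq deriv_coef_def 4 if_False
      using arg_cong[OF 3[folded 1 2], of "\<lambda>z. z * coef x (insert i A) * coef y (S - A)"]
      by (simp only: mult_ac)
  qed
  show ?thesis
    unfolding deriv_coef_def[of i "x * y"] s0 distrib_left sum_distrib_left if_not_P[OF False]
    by (simp only: s1 s2 add.commute cong: sum.cong)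
next
  case True
  \<comment> \<open>The two sums cancel: remove \<open>i\<close> from the first factor or from the second.\<close>
  have "(\<Sum>A\<in>Pow S. inv_sign A (S - A) * deriv_coef i x A * coef y (S - A)) =
     (\<Sum>A\<in>Pow (S - {i}). inv_sign A (S - A) * deriv_coef i x A * coef y (S - A))"
    by (rule sum.mono_neutral_right) (auto simp: deriv_coef_def)
  moreover have "(\<Sum>A\<in>Pow S. inv_sign A (S - A) * coef (parity x) A * deriv_coef i y (S - A)) =
     (\<Sum>A\<in>insert i ` Pow (S - {i}). inv_sign A (S - A) * coef (parity x) A * deriv_coef i y (S - A))"
  proof (rule sum.mono_neutral_right)
    show "\<forall>A\<in>Pow S - insert i ` Pow (S - {i}). inv_sign A (S - A) * coef (parity x) A * deriv_coef i y (S - A) = 0"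
    proof
      fix A assume A: "A \<in> Pow S - insert i ` Pow (S - {i})"
      have "i \<notin> A"
      proof
        assume "i \<in> A"
        then have "A = insert i (A - {i})" "A - {i} \<in> Pow (S - {i})" using A by auto
        then show False using A by blast
      qed
      then show "inv_sign A (S - A) * coef (parity x) A * deriv_coef i y (S - A) = 0"
        using True by (simp add: deriv_coef_def)
    qed
  qed (use True in auto)
  moreover have "\<dots> = (\<Sum>A\<in>Pow (S - {i}). inv_sign (insert i A) (S - insert i A) *
      coef (parity x) (insert i A) * deriv_coef i y (S - insert i A))"
    by (rule sum.reindex_cong[where l = "insert i", OF inj_onI])
      (metis PowD insert_ident subset_Diff_insert, auto)
  moreover have "inv_sign (insert i A) (S - insert i A) * coef (parity x) (insert i A) *
      deriv_coef i y (S - insert i A) = - (inv_sign A (S - A) * deriv_coef i x A * coef y (S - A))"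
    if A: "A \<in> Pow (S - {i})" for A
  proof -
    define C where "C = S - insert i A"
    have C: "i \<notin> C" "S - A = insert i C" "i \<notin> A" using A True by (auto simp: C_def)
    have 1: "inv_sign (insert i A) C = inv_sign {i} C * inv_sign A C"
      using inv_sign_Un_left[of "{i}" A C] C by simp
    have 2: "inv_sign A (insert i C) = inv_sign A {i} * inv_sign A C"
      using inv_sign_Un_right[of "{i}" C A] C by simp
    have 3: "inv_sign {i} C * inv_sign {i} C = 1" by simp
    have 4: "inv_sign {i} A * inv_sign A {i} = (- 1) ^ card A"
      using inv_sign_swap[of "{i}" A] C by simp
    have 5: "(- 1 :: real) ^ card (insert i A) = - ((- 1) ^ card A)" using C by simp
    have 6: "(i \<in> C) = False" "(i \<in> A) = False" using C by auto
    have "inv_sign {i} C * inv_sign A C * (- ((- 1) ^ card A) * X) * (inv_sign {i} C * Y) =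
        (inv_sign {i} C * inv_sign {i} C) * (- (inv_sign A C * ((- 1) ^ card A) * X * Y))" for X Y
      by (simp only: mult_ac mult_minus_left mult_minus_right)
    also have "\<dots> X Y = - (inv_sign A {i} * inv_sign A C * (inv_sign {i} A * X) * Y)" for X Y
      unfolding 3 4[symmetric] by (simp only: mult_ac mult_1)
    finally show ?thesis
      unfolding C_def[symmetric] C(2) deriv_coef_def coef_parity 6 if_False 1 2 5 .
  qed
  ultimately show ?thesis using True by (simp add: deriv_coef_def[of i "x * y"] sum_negf)
qed

text \<open>
  The interior product \<open>v \<lrcorner> x\<close>.
\<close>
definition contract :: "real ^ 'n::{finite,linorder} \<Rightarrow> 'n exterior \<Rightarrow> 'n exterior" where
  "contract v x = Ext (\<lambda>S. \<Sum>:i. v $ i * deriv_coef i x S)"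

lemma coef_contract: "coef (contract v x) S = (\<Sum>:i. v $ i * deriv_coef i x S)"
  by (simp add: contract_def)

lemma deriv_coef_linear:
  "deriv_coef i 0 S = 0" "deriv_coef i (x + y) S = deriv_coef i x S + deriv_coef i y S"
  "deriv_coef i (x - y) S = deriv_coef i x S - deriv_coef i y S"
  "deriv_coef i (- x) S = - deriv_coef i x S" "deriv_coef i (r *\<^sub>R x) S = r * deriv_coef i x S"
  by (simp_all add: deriv_coef_def algebra_simps)

lemma contract_linear [simp]:
  "contract v 0 = 0" "contract v (x + y) = contract v x + contract v y"
  "contract v (x - y) = contract v x - contract v y"
  "contract v (- x) = - contract v x" "contract v (r *\<^sub>R x) = r *\<^sub>R contract v x"
  by (rule exterior_eqI, simp add: coef_contract deriv_coef_linear algebra_simps sum.distrib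
      sum_subtractf sum_negf sum_distrib_left)+

lemma contract_linear_vector:
  "contract (v + w) x = contract v x + contract w x" "contract (r *\<^sub>R v) x = r *\<^sub>R contract v x"
  by (rule exterior_eqI, simp add: coef_contract algebra_simps sum.distrib sum_distrib_left)+

lemma contract_sum: "contract v (sum f A) = (\<Sum>a\<in>A. contract v (f a))"
  by (induction A rule: infinite_finite_induct) auto

lemma contract_mult: "contract v (x * y) = contract v x * y + parity x * contract v y"
proof (rule exterior_eqI)
  fix S :: "'a set"
  have "coef (contract v (x * y)) S =
     (\<Sum>:i. \<Sum>A\<in>Pow S. v $ i * (inv_sign A (S - A) * deriv_coef i x A * coef y (S - A))) +
     (\<Sum>:i. \<Sum>A\<in>Pow S. v $ i * (inv_sign A (S - A) * coef (parity x) A * deriv_coef i y (S - A)))"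
    by (simp only: coef_contract deriv_coef_mult distrib_left sum.distrib sum_distrib_left)
  also have "\<dots> = coef (contract v x * y + parity x * contract v y) S"
    unfolding coef_simps coef_mult[of "contract v x"] coef_mult[of "parity x"] coef_contract
      sum_distrib_left sum_distrib_right sum.swap[of _ "UNIV :: 'a set" "Pow S"]
    by (intro arg_cong2[where f = "(+)"] sum.cong refl) (simp_all only: mult_ac)
  finally show "coef (contract v (x * y)) S = coef (contract v x * y + parity x * contract v y) S" .
qed

definition one_form :: "real ^ 'n::{finite,linorder} \<Rightarrow> 'n exterior" where
  "one_form a = Ext (\<lambda>S. \<Sum>:i. if S = {i} then a $ i else 0)"

lemma coef_one_form: "coef (one_form a) S = (\<Sum>:i. if S = {i} then a $ i else 0)"
  by (simp add: one_form_def)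

lemma one_form_linear:
  "one_form (a + b) = one_form a + one_form b" "one_form (r *\<^sub>R a) = r *\<^sub>R one_form a"
  by (rule exterior_eqI, simp only: coef_one_form coef_simps sum_distrib_left sum.distrib[symmetric],
      rule sum.cong, simp_all)+

lemma one_form_odd [simp]: "odd_form (one_form a)"
  unfolding odd_form_def
  by (rule exterior_eqI, simp only: coef_one_form coef_simps coef_parity sum_distrib_left sum_negf[symmetric],
      rule sum.cong, auto)

lemma contract_one_form [simp]: "contract v (one_form a) = (v \<bullet> a) *\<^sub>R 1"
proof (rule exterior_eqI)
  fix S :: "'a set"
  have "deriv_coef i (one_form a) S = (if S = {} then a $ i else 0)" for i
  proof -
    have "(\<Sum>:j. if insert i S = {j} then a $ j else 0) = (\<Sum>:j. if j = i then (if S = {} then a $ i else 0) else 0)"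
      if "i \<notin> S" using that by (intro sum.cong refl) auto
    then show ?thesis by (auto simp: deriv_coef_def coef_one_form)
  qed
  then show "coef (contract v (one_form a)) S = coef ((v \<bullet> a) *\<^sub>R 1) S"
    by (simp add: coef_contract inner_vec_def)
qed

definition top_coef :: "'n::{finite,linorder} exterior \<Rightarrow> real" where
  "top_coef x = coef x UNIV"

lemma top_coef_linear [simp]:
  "top_coef 0 = 0" "top_coef (x + y) = top_coef x + top_coef y"
  "top_coef (x - y) = top_coef x - top_coef y"
  "top_coef (- x) = - top_coef x" "top_coef (r *\<^sub>R x) = r * top_coef x"
  by (simp_all add: top_coef_def)

lemma top_coef_sum: "top_coef (sum f A) = (\<Sum>a\<in>A. top_coef (f a))"
  by (simp add: top_coef_def coef_sum)

text \<open>
  An interior product has no component of top degree. Applied to a product, this replaces every argument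
  that a form of degree larger than the dimension vanishes.
\<close>
lemma top_coef_contract [simp]: "top_coef (contract v x) = 0"
  by (simp add: top_coef_def coef_contract deriv_coef_def)

lemma parity_contract: "parity (contract v x) = - contract v (parity x)"
  by (rule exterior_eqI)
    (simp add: coef_contract deriv_coef_def sum_distrib_left mult_ac flip: sum_negf, intro sum.cong refl, simp)

lemma even_odd_contract [simp]:
  "odd_form x \<Longrightarrow> even_form (contract v x)" "even_form x \<Longrightarrow> odd_form (contract v x)"
  by (simp_all add: even_form_def odd_form_def parity_contract)

lemma even_odd_mult [simp]:
  "even_form x \<Longrightarrow> even_form y \<Longrightarrow> even_form (x * y)"
  "odd_form x \<Longrightarrow> odd_form y \<Longrightarrow> even_form (x * y)"
  "even_form x \<Longrightarrow> odd_form y \<Longrightarrow> odd_form (x * y)"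
  "odd_form x \<Longrightarrow> even_form y \<Longrightarrow> odd_form (x * y)"
  by (simp_all add: even_form_def odd_form_def)

lemma even_odd_scale [simp]:
  "even_form x \<Longrightarrow> even_form (r *\<^sub>R x)" "odd_form x \<Longrightarrow> odd_form (r *\<^sub>R x)"
  by (simp_all add: even_form_def odd_form_def)

lemma even_odd_sum:
  "(\<And>a. a \<in> A \<Longrightarrow> even_form (f a)) \<Longrightarrow> even_form (sum f A)"
  "(\<And>a. a \<in> A \<Longrightarrow> odd_form (f a)) \<Longrightarrow> odd_form (sum f A)"
  by (simp_all add: even_form_def odd_form_def parity_sum sum_negf)

lemma odd_anticommute: "odd_form x \<Longrightarrow> odd_form y \<Longrightarrow> x * y = - (y * x)"
  by (simp add: odd_form_commute[of x y]) (simp add: odd_form_def)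

lemma one_form_zero [simp]: "one_form 0 = 0"
  using one_form_linear(2)[of 0 0] by simp

lemma one_form_minus: "one_form (- a) = - one_form a"
  using one_form_linear(2)[of "-1" a] by simp

lemma one_form_sum: "one_form (sum f A) = (\<Sum>a\<in>A. one_form (f a))"
  by (induction A rule: infinite_finite_induct) (auto simp: one_form_linear)

lemma one_form_expand: "one_form a = (\<Sum>:i. a $ i *\<^sub>R one_form (axis i 1))"
proof -
  have "a = (\<Sum>:i. a $ i *\<^sub>R axis i 1)"
    using basis_expansion[of a] by (simp add: scalar_mult_eq_scaleR)
  then show ?thesis
    by (metis (no_types, lifting) one_form_linear(2) one_form_sum sum.cong)
qed

text \<open>
  The Leibniz rule for \<open>v \<lrcorner> (a \<and> b \<and> p \<and> \<alpha>)\<close>, read in top degree. Most relations between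
  a 3-form and its contractions are derived below from this one.
\<close>
lemma top_coef_leibniz:
  assumes "even_form a" "even_form b" "odd_form p"
  shows "top_coef (contract v a * b * p * one_form \<alpha>) + top_coef (a * contract v b * p * one_form \<alpha>)
     + top_coef (a * b * contract v p * one_form \<alpha>) = (v \<bullet> \<alpha>) * top_coef (a * b * p)"
proof -
  have "contract v (a * b * p * one_form \<alpha>) = contract v a * b * p * one_form \<alpha>
      + a * contract v b * p * one_form \<alpha> + a * b * contract v p * one_form \<alpha> - (v \<bullet> \<alpha>) *\<^sub>R (a * b * p)"
    using assms by (simp add: contract_mult even_form_def odd_form_def algebra_simps)
  from arg_cong[OF this, of top_coef] show ?thesis
    by (simp only: top_coef_linear top_coef_contract)
qed

lemma prod_list_transpose:
  fixes f :: "'b \<Rightarrow> 'n::{finite,linorder} exterior"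
  assumes odd: "\<And>i. odd_form (f i)" and L: "distinct L" "a \<in> set L" "b \<in> set L" "a \<noteq> b"
  shows "prod_list (map (f \<circ> Transposition.transpose a b) L) = - prod_list (map f L)"
proof -
  have ex: "x * Y * z = - (z * Y * x)" if "odd_form x" "odd_form z" for x Y z :: "'n exterior"
    using that odd_form_commute[of x Y] odd_form_commute[of z Y] odd_anticommute[of x z]
    by (simp add: mult.assoc)
  have main: "prod_list (map (f \<circ> Transposition.transpose a b) L) = - prod_list (map f L)"
    if "L = xs @ a # ys @ b # zs" for xs ys zs a b
  proof -
    have unmoved: "map (f \<circ> Transposition.transpose a b) l = map f l" if "a \<notin> set l" "b \<notin> set l" for l
      using that by (intro map_cong refl) (auto simp: Transposition.transpose_def)
    have "prod_list (map (f \<circ> Transposition.transpose a b) L) =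
        prod_list (map f xs) * (f b * prod_list (map f ys) * f a) * prod_list (map f zs)"
      using L(1) that by (simp add: unmoved mult.assoc)
    also have "\<dots> = - prod_list (map f L)"
      using that ex[OF odd odd, of b "prod_list (map f ys)" a] by (simp add: mult.assoc)
    finally show ?thesis .
  qed
  obtain xs r where r: "L = xs @ a # r" using L(2) by (meson split_list)
  show ?thesis
  proof (cases "b \<in> set r")
    case True
    then obtain ys zs where "r = ys @ b # zs" by (meson split_list)
    then show ?thesis using main r by blast
  next
    case False
    then have "b \<in> set xs" using L r by auto
    then obtain ys zs where "xs = ys @ b # zs" by (meson split_list)
    then have "L = ys @ b # zs @ a # r" using r by simp
    then show ?thesis using main[of ys b zs a r] by (simp add: transpose_commute)
  qed
qed

text \<open>
  A product of odd forms is alternating in its factors. A map that is not injective is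
  unchanged by the transposition of two indices with the same value, so the product is its own negative.
\<close>
lemma prod_list_permute:
  fixes f :: "'b::finite \<Rightarrow> 'n::{finite,linorder} exterior"
  assumes odd: "\<And>i. odd_form (f i)" and L: "distinct L" "set L = UNIV"
  shows "prod_list (map (f \<circ> p) L) =
    (if p permutes UNIV then of_int (sign p) *\<^sub>R prod_list (map f L) else 0)"
proof (cases "p permutes UNIV")
  case True
  have "prod_list (map (f \<circ> p) L) = of_int (sign p) *\<^sub>R prod_list (map f L)"
    using finite[of "UNIV :: 'b set"] True
  proof (induction rule: permutes_rev_induct)
    case id
    then show ?case by simp
  next
    case (swap a b p)
    have perm: "permutation p"
      unfolding permutation_permutes using swap finite[of "UNIV :: 'b set"] by blast
    have "sign (p \<circ> Transposition.transpose a b) = - sign p"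
      using swap perm by (simp add: sign_compose permutation_swap_id sign_swap_id)
    moreover have "prod_list (map (f \<circ> p \<circ> Transposition.transpose a b) L) = - prod_list (map (f \<circ> p) L)"
      by (rule prod_list_transpose) (use odd L swap in auto)
    ultimately show ?case
      unfolding comp_assoc[symmetric] by (simp only: swap.IH of_int_minus scaleR_minus_left)
  qed
  then show ?thesis using True by simp
next
  case False
  have "\<not> inj p"
  proof
    assume "inj p"
    then have "bij p" by (simp add: bij_def finite_UNIV_inj_surj)
    then have "p permutes UNIV" by (rule bij_imp_permutes) simp
    then show False using False by simp
  qed
  then obtain a b where ab: "a \<noteq> b" "p a = p b" by (auto simp: inj_def)
  have "f \<circ> p \<circ> Transposition.transpose a b = f \<circ> p" using ab by (auto simp: Transposition.transpose_def fun_eq_iff)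
  then have "prod_list (map (f \<circ> p) L) = - prod_list (map (f \<circ> p) L)"
    using prod_list_transpose[of "f \<circ> p" L a b] odd L ab by simp
  then have "coef (prod_list (map (f \<circ> p) L)) S = 0" for S
    by (metis coef_simps(4) equal_neg_zero)
  then have "prod_list (map (f \<circ> p) L) = 0"
    by (intro exterior_eqI) simp
  then show ?thesis using False by simp
qed

lemma coef_prod_list_axes:
  assumes "distinct L"
  shows "coef (prod_list (map (\<lambda>i. one_form (axis i 1)) L)) S \<noteq> 0 \<longleftrightarrow> S = set L"
  using assms
proof (induction L arbitrary: S)
  case Nil
  then show ?case by simp
next
  case (Cons i L)
  let ?x = "prod_list (map (\<lambda>i. one_form (axis i 1)) L)"
  have e: "coef (one_form (axis i 1)) A = (if A = {i} then 1 else 0)" for A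
  proof -
    have "coef (one_form (axis i 1)) A = (\<Sum>:j. if j = i then if A = {i} then 1 else 0 else 0)"
      unfolding coef_one_form by (intro sum.cong refl) (auto simp: axis_def)
    then show ?thesis by simp
  qed
  have *: "coef (one_form (axis i 1) * ?x) S = (if i \<in> S then inv_sign {i} (S - {i}) * coef ?x (S - {i}) else 0)"
  proof -
    have "coef (one_form (axis i 1) * ?x) S = (\<Sum>A\<in>Pow S. if A = {i} then inv_sign {i} (S - {i}) * coef ?x (S - {i}) else 0)"
      unfolding coef_mult by (intro sum.cong refl) (simp add: e)
    then show ?thesis by simp
  qed
  have "inv_sign {i} B \<noteq> 0" for B using inv_sign_square[of "{i}" B] by (metis mult_zero_left zero_neq_one)
  then have "coef (one_form (axis i 1) * ?x) S \<noteq> 0 \<longleftrightarrow> i \<in> S \<and> S - {i} = set L"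
    unfolding * using Cons by auto
  then show ?case using Cons.prems by auto
qed

lemma top_coef_prod_axes_nonzero:
  "distinct L \<Longrightarrow> set L = UNIV \<Longrightarrow> top_coef (prod_list (map (\<lambda>i. one_form (axis i 1)) L)) \<noteq> 0"
  using coef_prod_list_axes[of L UNIV] by (simp add: top_coef_def)

abbreviation dx :: "'n::{finite,linorder} \<Rightarrow> 'n exterior" where
  "dx i \<equiv> one_form (axis i 1)"

definition two_form :: "('n::{finite,linorder} \<Rightarrow> 'n \<Rightarrow> real) \<Rightarrow> 'n exterior" where
  "two_form \<beta> = (1 / 2) *\<^sub>R (\<Sum>:i j. \<beta> i j *\<^sub>R (dx i * dx j))"

text \<open>
  The 3-form with components \<open>\<gamma>\<close>; the sum runs over all index triples, hence the factor.
\<close>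
definition exterior3 :: "('n::{finite,linorder} \<Rightarrow> 'n \<Rightarrow> 'n \<Rightarrow> real) \<Rightarrow> 'n exterior" where
  "exterior3 \<gamma> = (1 / 6) *\<^sub>R (\<Sum>:i j k. \<gamma> i j k *\<^sub>R (dx i * dx j * dx k))"

lemma exterior3_odd [simp]: "odd_form (exterior3 \<gamma>)"
  unfolding exterior3_def by (intro even_odd_scale even_odd_sum) simp

lemma contract_two_form:
  assumes "\<And>i j. \<beta> i j = - \<beta> j i"
  shows "contract v (two_form \<beta>) = one_form (\<chi> j. \<Sum>:i. v $ i * \<beta> i j)"
proof -
  have parity_dx: "parity (dx i) = - dx i" for i :: 'a using one_form_odd[of "axis i 1"] by (simp add: odd_form_def)
  have "contract v (two_form \<beta>) = (1 / 2) *\<^sub>R ((\<Sum>:i j. (v $ i * \<beta> i j) *\<^sub>R dx j)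
      - (\<Sum>:i j. (v $ j * \<beta> i j) *\<^sub>R dx i))"
    by (simp add: two_form_def contract_sum contract_mult parity_dx sum_subtractf inner_axis algebra_simps)
  also have "(\<Sum>:i j. (v $ j * \<beta> i j) *\<^sub>R dx i) = - (\<Sum>:i j. (v $ i * \<beta> i j) *\<^sub>R dx j)"
  proof -
    have "(\<Sum>:i j. (v $ j * \<beta> i j) *\<^sub>R dx i) = (\<Sum>:j i. (v $ j * \<beta> i j) *\<^sub>R dx i)"
      by (rule sum.swap)
    also have "\<dots> = (\<Sum>:i j. - ((v $ i * \<beta> i j) *\<^sub>R dx j))"
    proof (intro sum.cong refl)
      fix i j show "(v $ i * \<beta> j i) *\<^sub>R dx j = - ((v $ i * \<beta> i j) *\<^sub>R dx j)"
        using assms[of j i] by simp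
    qed
    finally show ?thesis by (simp add: sum_negf)
  qed
  also have "(\<Sum>:i j. (v $ i * \<beta> i j) *\<^sub>R dx j) = one_form (\<chi> j. \<Sum>:i. v $ i * \<beta> i j)"
    by (subst sum.swap) (simp add: one_form_expand[of "\<chi> j. \<Sum>:i. v $ i * \<beta> i j"] scaleR_sum_left)
  finally show ?thesis by (simp flip: scaleR_2)
qed

text \<open>
  The three terms of the Leibniz rule agree after renaming the indices.
\<close>
lemma contract_exterior3:
  assumes "\<And>i j k. \<gamma> i j k = - \<gamma> j i k" "\<And>i j k. \<gamma> i j k = - \<gamma> i k j"
  shows "contract v (exterior3 \<gamma>) = two_form (\<lambda>j k. \<Sum>:i. v $ i * \<gamma> i j k)"
proof -
  have parity_dx: "parity (dx i) = - dx i" for i :: 'a using one_form_odd[of "axis i 1"] by (simp add: odd_form_def)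
  define S where "S = (\<Sum>:i j k. (v $ i * \<gamma> i j k) *\<^sub>R (dx j * dx k))"
  have 1: "(\<Sum>:i j k. (v $ j * \<gamma> i j k) *\<^sub>R (dx i * dx k)) = - S"
  proof -
    have "(\<Sum>:i j k. (v $ j * \<gamma> i j k) *\<^sub>R (dx i * dx k))
       = (\<Sum>:j i k. (v $ j * \<gamma> i j k) *\<^sub>R (dx i * dx k))"
      by (rule sum.swap)
    also have "\<dots> = (\<Sum>:i j k. - ((v $ i * \<gamma> i j k) *\<^sub>R (dx j * dx k)))"
    proof (intro sum.cong refl)
      fix i j k show "(v $ i * \<gamma> j i k) *\<^sub>R (dx j * dx k) = - ((v $ i * \<gamma> i j k) *\<^sub>R (dx j * dx k))"
        using assms(1)[of j i k] by simp
    qed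
    finally show ?thesis by (simp add: S_def sum_negf)
  qed
  have 2: "(\<Sum>:i j k. (v $ k * \<gamma> i j k) *\<^sub>R (dx i * dx j)) = S"
  proof -
    have "(\<Sum>:i j k. (v $ k * \<gamma> i j k) *\<^sub>R (dx i * dx j))
       = (\<Sum>:i k j. (v $ k * \<gamma> i j k) *\<^sub>R (dx i * dx j))"
      by (intro sum.cong refl sum.swap)
    also have "\<dots> = (\<Sum>:k i j. (v $ k * \<gamma> i j k) *\<^sub>R (dx i * dx j))"
      by (rule sum.swap)
    also have "\<dots> = S"
      unfolding S_def
    proof (intro sum.cong refl)
      fix k i j show "(v $ k * \<gamma> i j k) *\<^sub>R (dx i * dx j) = (v $ k * \<gamma> k i j) *\<^sub>R (dx i * dx j)"
        using assms(1)[of i k j] assms(2)[of i j k] by simp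
    qed
    finally show ?thesis .
  qed
  have "contract v (exterior3 \<gamma>) = (1 / 6) *\<^sub>R (S
      - (\<Sum>:i j k. (v $ j * \<gamma> i j k) *\<^sub>R (dx i * dx k))
      + (\<Sum>:i j k. (v $ k * \<gamma> i j k) *\<^sub>R (dx i * dx j)))"
    by (simp add: exterior3_def S_def contract_sum contract_mult parity_dx sum_subtractf sum.distrib inner_axis algebra_simps)
  also have "\<dots> = (1 / 2) *\<^sub>R S"
    unfolding 1 2 by (simp flip: scaleR_add_left add: scaleR_add_right)
  also have "S = (\<Sum>:j k i. (v $ i * \<gamma> i j k) *\<^sub>R (dx j * dx k))"
    unfolding S_def by (rule trans[OF sum.swap]) (rule sum.cong[OF refl sum.swap])
  finally show ?thesis by (simp add: two_form_def scaleR_sum_left)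
qed

section \<open>Top forms in dimension seven\<close>

text \<open>
  The order \<open>1, \<dots>, 7\<close> in which the Levi-Civita symbol reads the indices; the linear
  order of the type begins with \<open>7 = 0\<close> instead.
\<close>
definition indices7 :: "7 list" where "indices7 = [1, 2, 3, 4, 5, 6, 7]"

lemma indices7: "distinct indices7" "set indices7 = UNIV"
proof -
  show d: "distinct indices7" by (simp add: indices7_def)
  have "card (set indices7) = CARD(7)" using distinct_card[OF d] by (simp add: indices7_def)
  then show "set indices7 = UNIV" by (metis card_subset_eq finite subset_UNIV)
qed

lemma product_levi_civita:
  fixes a :: "7 \<Rightarrow> 'n::{finite,linorder} exterior"
  assumes "\<And>i. odd_form (a i)"
  shows "a i1 * (a i2 * (a i3 * (a i4 * (a i5 * (a i6 * a i7))))) =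
    levi_civita_symbol i1 i2 i3 i4 i5 i6 i7 *\<^sub>R prod_list (map a indices7)"
proof -
  define p where "p = (\<lambda>_::7. i7)(1 := i1, 2 := i2, 3 := i3, 4 := i4, 5 := i5, 6 := i6)"
  have 1: "prod_list (map (a \<circ> p) indices7) = a i1 * (a i2 * (a i3 * (a i4 * (a i5 * (a i6 * a i7)))))"
    by (simp add: indices7_def p_def)
  have 2: "levi_civita_symbol i1 i2 i3 i4 i5 i6 i7 = (if p permutes UNIV then of_int (sign p) else 0)"
    by (simp add: levi_civita_symbol_def p_def Let_def)
  have 3: "prod_list (map (a \<circ> p) indices7) = (if p permutes UNIV then of_int (sign p) *\<^sub>R prod_list (map a indices7) else 0)"
    by (rule prod_list_permute[OF assms indices7])
  show ?thesis unfolding 2 using 3[unfolded 1] by (cases "p permutes UNIV") simp_all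
qed

text \<open>
  Index tuples with a nonzero symbol are exactly the value tuples of permutations.
\<close>
lemma sum_levi_civita:
  "(\<Sum>:i1 i2 i3 i4 i5 i6 i7.
     levi_civita_symbol i1 i2 i3 i4 i5 i6 i7 * F i1 i2 i3 i4 i5 i6 i7) =
   (\<Sum>p | p permutes (UNIV::7 set). of_int (sign p) * F (p 1) (p 2) (p 3) (p 4) (p 5) (p 6) (p 7))"
proof -
  define mk :: "7 \<times> 7 \<times> 7 \<times> 7 \<times> 7 \<times> 7 \<times> 7 \<Rightarrow> 7 \<Rightarrow> 7" where
    "mk = (\<lambda>(a,b,c,d,e,f,g). (\<lambda>_. g)(1 := a, 2 := b, 3 := c, 4 := d, 5 := e, 6 := f))"
  have mk: "mk (p 1, p 2, p 3, p 4, p 5, p 6, p 7) = p" for p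
  proof
    fix i :: 7
    have "i \<in> {1, 2, 3, 4, 5, 6, 7}" using indices7(2) by (auto simp: indices7_def)
    then show "mk (p 1, p 2, p 3, p 4, p 5, p 6, p 7) i = p i" by (auto simp: mk_def)
  qed
  have "(\<Sum>p | p permutes (UNIV::7 set). of_int (sign p) * F (p 1) (p 2) (p 3) (p 4) (p 5) (p 6) (p 7)) =
    (\<Sum>(a,b,c,d,e,f,g)\<in>UNIV. levi_civita_symbol a b c d e f g * F a b c d e f g)"
  proof (rule sum.reindex_bij_witness_not_neutral[where S' = "{}"
      and T' = "{t. \<not> mk t permutes UNIV}" and i = mk and j = "\<lambda>p. (p 1, p 2, p 3, p 4, p 5, p 6, p 7)"])
    fix t assume "t \<in> UNIV - {t. \<not> mk t permutes UNIV}"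
    then show "mk t \<in> {p. p permutes UNIV} - {}" by simp
    show "(mk t 1, mk t 2, mk t 3, mk t 4, mk t 5, mk t 6, mk t 7) = t"
      by (cases t) (simp add: mk_def)
  next
    fix t assume "t \<in> {t. \<not> mk t permutes UNIV}"
    then show "(case t of (a,b,c,d,e,f,g) \<Rightarrow> levi_civita_symbol a b c d e f g * F a b c d e f g) = 0"
      by (cases t) (simp add: mk_def levi_civita_symbol_def Let_def)
  next
    fix p :: "7 \<Rightarrow> 7" assume p: "p \<in> {p. p permutes UNIV}"
    then show "(case (p 1, p 2, p 3, p 4, p 5, p 6, p 7) of
        (a,b,c,d,e,f,g) \<Rightarrow> levi_civita_symbol a b c d e f g * F a b c d e f g) =
      of_int (sign p) * F (p 1) (p 2) (p 3) (p 4) (p 5) (p 6) (p 7)"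
      using mk[of p] by (simp add: mk_def levi_civita_symbol_def Let_def)
  next
    fix p :: "7 \<Rightarrow> 7" assume p: "p \<in> {p. p permutes UNIV} - {}"
    then show "(p 1, p 2, p 3, p 4, p 5, p 6, p 7) \<in> UNIV - {t. \<not> mk t permutes UNIV}"
      using mk[of p] by simp
  qed (auto simp: mk)
  then show ?thesis
    by (simp only: sum.cartesian_product UNIV_Times_UNIV)
qed

text \<open>
  The coefficient of \<open>dx\<^sup>1 \<and> \<dots> \<and> dx\<^sup>7\<close>, a sign that depends on the order of the
  index type and cancels in the end.
\<close>
definition vol7 :: real where "vol7 = top_coef (prod_list (map dx indices7))"

lemma vol7_nonzero: "vol7 \<noteq> 0"
  unfolding vol7_def using top_coef_prod_axes_nonzero[OF indices7] .

lemma mult_two_form: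
  "two_form \<alpha> * z = (1 / 2) *\<^sub>R (\<Sum>:i j. \<alpha> i j *\<^sub>R (dx i * (dx j * z)))"
  by (simp add: two_form_def sum_distrib_right mult.assoc)

lemma mult_exterior3:
  "exterior3 \<gamma> * z = (1 / 6) *\<^sub>R (\<Sum>:i j k. \<gamma> i j k *\<^sub>R (dx i * (dx j * (dx k * z))))"
  by (simp add: exterior3_def sum_distrib_right mult.assoc)

lemma top_coef_wedge223:
  "top_coef (two_form \<alpha> * two_form \<beta> * exterior3 \<gamma>) = wedge223 \<alpha> \<beta> \<gamma> * vol7"
proof -
  have 3: "top_coef (dx i1 * (dx i2 * (dx i3 * (dx i4 * exterior3 \<gamma>)))) =
      (\<Sum>:i5 i6 i7. 1 / 6 * (\<gamma> i5 i6 i7 * (levi_civita_symbol i1 i2 i3 i4 i5 i6 i7 * vol7)))"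
    for i1 i2 i3 i4
    using product_levi_civita[of dx]
    by (simp add: mult_exterior3[of _ 1, simplified] sum_distrib_left top_coef_sum vol7_def mult.assoc)
  have 2: "top_coef (dx i1 * (dx i2 * (two_form \<beta> * exterior3 \<gamma>))) =
      (\<Sum>:i3 i4. 1 / 2 * (\<beta> i3 i4 * top_coef (dx i1 * (dx i2 * (dx i3 * (dx i4 * exterior3 \<gamma>))))))"
    for i1 i2
    by (simp add: mult_two_form sum_distrib_left top_coef_sum)
  have 1: "top_coef (two_form \<alpha> * (two_form \<beta> * exterior3 \<gamma>)) =
      (\<Sum>:i1 i2. 1 / 2 * (\<alpha> i1 i2 * top_coef (dx i1 * (dx i2 * (two_form \<beta> * exterior3 \<gamma>)))))"
    by (simp add: mult_two_form[of \<alpha>] sum_distrib_left top_coef_sum)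
  have "top_coef (two_form \<alpha> * (two_form \<beta> * exterior3 \<gamma>)) =
    (\<Sum>:i1 i2 i3 i4 i5 i6 i7.
      levi_civita_symbol i1 i2 i3 i4 i5 i6 i7 * (\<alpha> i1 i2 * \<beta> i3 i4 * \<gamma> i5 i6 i7 * (vol7 / 24)))"
    unfolding 1 2 3 sum_distrib_left
    by (intro sum.cong refl) (simp only: field_simps, simp)
  also have "\<dots> = wedge223 \<alpha> \<beta> \<gamma> * vol7"
    unfolding sum_levi_civita wedge223_def by (simp add: fact_numeral sum_distrib_left sum_distrib_right sum_divide_distrib mult_ac)
  finally show ?thesis by (simp add: mult.assoc)
qed

section \<open>Three-forms that induce a metric\<close>

text \<open>
  \<open>c v w\<close> is the covector \<open>\<Phi>(v, w, \<cdot>)\<close>, and the metric \<open>G\<close> is, up to the factor \<open>\<kappa>\<close>, the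
  symmetric form \<open>(u \<lrcorner> \<Phi>) \<and> (v \<lrcorner> \<Phi>) \<and> \<Phi>\<close>.
\<close>
locale cross_form =
  fixes \<Phi> :: "'n::{finite,linorder} exterior" and G :: "((real, 'n) vec, 'n) vec" and \<kappa> :: real
    and c :: "(real, 'n) vec \<Rightarrow> (real, 'n) vec \<Rightarrow> (real, 'n) vec"
  assumes odd: "odd_form \<Phi>"
    and contract2: "contract w (contract v \<Phi>) = one_form (c v w)"
    and alt12: "c v w = - c w v" and alt23: "c v w \<bullet> u = - (c v u \<bullet> w)"
    and kappa: "\<kappa> \<noteq> 0"
    and metric: "top_coef (contract u \<Phi> * contract v \<Phi> * \<Phi>) = \<kappa> * (u \<bullet> (G *v v))"
    and G_sym: "u \<bullet> (G *v v) = v \<bullet> (G *v u)"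
    and G_pos: "v \<noteq> 0 \<Longrightarrow> v \<bullet> (G *v v) > 0"
begin

abbreviation g where "g u v \<equiv> u \<bullet> (G *v v)"
abbreviation flat where "flat v \<equiv> one_form (G *v v)"
abbreviation \<omega> where "\<omega> v \<equiv> contract v \<Phi>"

lemma even_omega [simp]: "even_form (\<omega> v)" by (simp add: odd)

lemma contract_self [simp]: "contract v (\<omega> v) = 0"
proof -
  have "c v v = - c v v" by (rule alt12)
  then have "c v v $ i = - (c v v $ i)" for i by (metis vector_uminus_component)
  then have "c v v = 0" by (simp add: vec_eq_iff)
  then show ?thesis by (simp add: contract2)
qed

lemma contract_swap: "contract u (contract v \<Phi>) = - contract v (contract u \<Phi>)"
  using alt12[of v u] by (simp add: contract2 one_form_minus)

text \<open>
  The 2-form \<open>\<omega> X\<close> is nondegenerate transversally to \<open>X\<close>. For \<open>z\<close> as in the hypothesis,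
  \<open>E = \<omega> X \<and> \<omega> X \<and> \<omega> z\<close> is annihilated by \<open>X\<close>, so \<open>E \<and> \<gamma>\<close> depends only on \<open>\<gamma>(X)\<close>; the
  Leibniz rule evaluates it to a nonzero multiple of \<open>\<gamma>(z)\<close>, which vanishes for \<open>\<gamma> = g(X, \<cdot>)\<close> and
  therefore always.
\<close>
lemma nondegenerate:
  assumes X: "X \<noteq> 0" and z: "contract z (\<omega> X) = 0" "g z X = 0"
  shows "z = 0"
proof -
  have N: "g X X > 0" using G_pos[OF X] .
  define E where "E = \<omega> X * \<omega> X * \<omega> z"
  have E: "even_form E" unfolding E_def by (intro even_odd_mult) (simp_all add: odd)
  have XE: "contract X E = 0"
    using z(1) contract_swap[of X z] by (simp add: E_def contract_mult)
  have top: "top_coef (E * one_form \<gamma>) = (z \<bullet> \<gamma>) * (\<kappa> * g X X)" for \<gamma>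
    using top_coef_leibniz[of "\<omega> X" "\<omega> X" \<Phi> z \<gamma>] z(1) odd metric[of X X]
    by (simp add: E_def mult.assoc)
  have "z \<bullet> \<gamma> = 0" for \<gamma>
  proof -
    have "contract X (E * flat X * one_form \<gamma>) = g X X *\<^sub>R (E * one_form \<gamma>) - (X \<bullet> \<gamma>) *\<^sub>R (E * flat X)"
      using E one_form_odd[of "G *v X"] by (simp add: contract_mult XE even_form_def odd_form_def)
    from arg_cong[OF this, of top_coef]
    have "g X X * top_coef (E * one_form \<gamma>) = (X \<bullet> \<gamma>) * top_coef (E * flat X)" by simp
    then show ?thesis using top[of \<gamma>] top[of "G *v X"] z(2) N kappa by simp
  qed
  from this[of z] show ?thesis by simp
qed

text \<open>
  The restriction of \<open>\<Phi>\<close> to the hyperplane \<open>X\<^sup>\<bottom>\<close> is primitive with respect to \<open>\<omega> X\<close>. Contractions with \<open>X\<close> and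
  with \<open>v\<close> give two equations for the same \<open>P\<close> and \<open>Q\<close>, whose right hand sides agree because \<open>g\<close> is
  symmetric; hence \<open>3 P = 0\<close>. So the vector \<open>z\<close> that represents the 6-form in question is orthogonal
  to \<open>X\<close> and in the kernel of \<open>\<omega> X\<close>, and \<open>nondegenerate\<close> applies.
\<close>
lemma primitive:
  assumes X: "X \<noteq> 0"
  shows "top_coef (\<omega> X * \<Phi> * flat X * one_form b) = 0"
proof -
  have anti: "contract X (\<omega> v) = - contract v (\<omega> X)" for v by (rule contract_swap)
  have oddc: "odd_form (contract v (\<omega> X))" for v by simp
  have even: "even_form (\<Phi> * flat X)" using odd by simp
  have P: "top_coef (\<omega> X * contract v (\<omega> X) * \<Phi> * flat X) = 0" for v
  proof -
    define P where "P = top_coef (\<omega> X * contract v (\<omega> X) * \<Phi> * flat X)"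
    define Q where "Q = top_coef (\<omega> X * \<omega> X * \<omega> v * flat X)"
    have "- P + Q = g X X * (\<kappa> * g X v)"
      using top_coef_leibniz[of "\<omega> X" "\<omega> v" \<Phi> X "G *v X"] odd metric[of X v]
        even_form_commute[OF even_omega, of v "\<omega> X"]
      by (simp add: P_def Q_def anti mult.assoc)
    moreover have "2 * P + Q = g v X * (\<kappa> * g X X)"
      using top_coef_leibniz[of "\<omega> X" "\<omega> X" \<Phi> v "G *v X"] odd metric[of X X]
        even_form_commute[OF even_omega, of X "contract v (\<omega> X)"]
      by (simp add: P_def Q_def mult.assoc)
    ultimately show ?thesis unfolding P_def[symmetric] using G_sym[of v X] by (simp add: algebra_simps)
  qed
  define z where "z = (\<chi> m. top_coef (\<omega> X * \<Phi> * flat X * dx m))"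
  have z: "top_coef (\<omega> X * \<Phi> * flat X * one_form b) = b \<bullet> z" for b
    unfolding one_form_expand[of b]
    by (simp add: z_def inner_vec_def sum_distrib_left top_coef_sum)
  have "c X v \<bullet> z = 0" for v
  proof -
    have "top_coef (\<omega> X * (\<Phi> * flat X) * one_form (c X v)) = 0"
      using P[of v] even_form_commute[OF even, of "contract v (\<omega> X)"] by (simp add: contract2 mult.assoc)
    then show ?thesis using z[of "c X v"] by (simp add: mult.assoc)
  qed
  then have "c X z \<bullet> v = 0" for v using alt23[of X z v] by simp
  from this[of "c X z"] have "contract z (\<omega> X) = 0" by (simp add: contract2)
  moreover have "g z X = 0"
    using z[of "G *v X"] odd_form_square[OF one_form_odd, of "G *v X"] by (simp add: mult.assoc inner_commute)
  ultimately have "z = 0" using nondegenerate[OF X] by blast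
  then show ?thesis using z by simp
qed

text \<open>
  The vector that represents the functional \<open>b \<mapsto> (u \<lrcorner> \<Phi>) \<and> \<Phi> \<and> g(X, \<cdot>) \<and> b\<close> on covectors.
\<close>
definition star :: "(real, 'n) vec \<Rightarrow> (real, 'n) vec \<Rightarrow> (real, 'n) vec" where
  "star X u = (\<chi> m. top_coef (\<omega> u * \<Phi> * flat X * dx m))"

lemma star: "b \<bullet> star X u = top_coef (\<omega> u * \<Phi> * flat X * one_form b)"
  unfolding one_form_expand[of b]
  by (simp add: star_def inner_vec_def sum_distrib_left top_coef_sum)

lemma star_linear:
  "star (X + Y) u = star X u + star Y u" "star (r *\<^sub>R X) u = r *\<^sub>R star X u"
  "star X (u + v) = star X u + star X v" "star X (r *\<^sub>R u) = r *\<^sub>R star X u"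
  by (simp_all add: star_def vec_eq_iff contract_linear_vector matrix_vector_right_distrib
      matrix_vector_mult_scaleR one_form_linear algebra_simps)

lemma star_alternating12: "g m (star n u) = - g n (star m u)"
proof -
  have "g m (star n u) = top_coef (\<omega> u * \<Phi> * (flat n * flat m))" for m n
    using star[of "G *v m" n u] G_sym[of m] by (simp add: inner_commute mult.assoc)
  then show ?thesis using odd_anticommute[OF one_form_odd one_form_odd, of "G *v n" "G *v m"] by simp
qed

text \<open>
  Contracting with \<open>u\<close> (and using that \<open>\<omega> X \<and> \<Phi> \<and> X\<close> vanishes) shows that \<open>t\<close> is symmetric;
  contracting with \<open>X\<close> then determines it.
\<close>
lemma star_inner_c: "c X v \<bullet> star X u = \<kappa> / 3 * (g X u * g X v - g X X * g u v)"
proof (cases "X = 0")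
  case False
  \<comment> \<open>\<open>t u v\<close> is the left hand side; \<open>R\<close> is the other term that the Leibniz rule produces\<close>
  define t where "t u v = top_coef (\<omega> u * contract v (\<omega> X) * \<Phi> * flat X)" for u v
  define R where "R u v = top_coef (\<omega> u * \<omega> v * \<omega> X * flat X)" for u v
  have R_sym: "R u v = R v u" for u v
    using even_form_commute[OF even_omega, of u "\<omega> v"] by (simp add: R_def)
  have even: "even_form (\<Phi> * flat X)" using odd by simp
  have tR: "t v u + R u v = g u X * (\<kappa> * g X v)" for u v
  proof -
    have "top_coef (\<omega> X * contract u (\<omega> v) * \<Phi> * flat X) = 0"
      using primitive[OF False, of "c v u"] even_form_commute[OF even, of "contract u (\<omega> v)"]
      by (simp add: contract2 mult.assoc)
    moreover have "\<omega> X * \<omega> v * \<omega> u = \<omega> u * \<omega> v * \<omega> X"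
      by (metis even_form_commute even_omega mult.assoc)
    moreover have "contract u (\<omega> X) * \<omega> v = \<omega> v * contract u (\<omega> X)"
      by (metis even_form_commute even_omega)
    ultimately show ?thesis
      using top_coef_leibniz[of "\<omega> X" "\<omega> v" \<Phi> u "G *v X"] odd metric[of X v]
      by (simp add: t_def R_def)
  qed
  moreover have "t u v = t v u"
    using tR[of u v] tR[of v u] R_sym[of u v] G_sym[of u X] G_sym[of v X] by (simp add: mult_ac)
  moreover have "- t v u - t u v + R u v = g X X * (\<kappa> * g u v)"
  proof -
    have "contract u (\<omega> X) * \<omega> v = \<omega> v * contract u (\<omega> X)"
      by (metis even_form_commute even_omega)
    then show ?thesis
      using top_coef_leibniz[of "\<omega> u" "\<omega> v" \<Phi> X "G *v X"] odd metric[of u v]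
      by (simp add: t_def R_def contract_swap[of X])
  qed
  moreover have "c X v \<bullet> star X u = t u v"
    unfolding star t_def using even_form_commute[OF even, of "contract v (\<omega> X)"]
    by (simp add: contract2 mult.assoc)
  ultimately show ?thesis using tR[of u v] R_sym[of u v] G_sym[of u X] G_sym[of v X] by (simp add: algebra_simps)
next
  case True
  then show ?thesis by (simp add: star_def inner_vec_def)
qed

text \<open>
  As \<open>star n\<close> is, up to a factor, inverse to the skew form \<open>\<omega> n\<close> on the hyperplane orthogonal to \<open>n\<close>,
  it is skew as well.
\<close>
lemma star_alternating23: "g m (star n u) = - g u (star n m)"
proof (cases "n = 0")
  case False
  have "c n (star n v) \<bullet> star n u = - (\<kappa> / 3) * (g n n * g u (star n v))" for u v
    using star_inner_c[of n "star n v" u] star_alternating12[of n n v] by simp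
  from this[of u m] this[of m u] alt23[of n "star n m" "star n u"]
  have "\<kappa> / 3 * g n n * (g u (star n m) + g m (star n u)) = 0"
    by (simp add: algebra_simps)
  then show ?thesis using kappa G_pos[OF False] by simp
next
  case True
  then show ?thesis using star_linear(2)[of 0] by simp
qed

lemma star_swap: "star n u = - star u n"
proof -
  have "star n u \<bullet> (G *v m) = (- star u n) \<bullet> (G *v m)" for m
    using star_alternating12[of m n u] star_alternating23[of n m u] star_alternating12[of u m n] G_sym
    by (metis inner_minus_left minus_minus)
  from this[of "star n u + star u n"] have "g (star n u + star u n) (star n u + star u n) = 0"
    by (simp add: inner_add_left)
  then show ?thesis using G_pos[of "star n u + star u n"] by (metis add_eq_0_iff2 less_irrefl)
qed

lemma g_eqI: "(\<And>v. g v a = g v b) \<Longrightarrow> a = b"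
proof -
  assume "\<And>v. g v a = g v b"
  then have "g (a - b) (a - b) = 0"
    by (simp add: matrix_vector_mult_diff_distrib inner_diff_right)
  then show "a = b" using G_pos[of "a - b"] by force
qed

definition sharp :: "(real, 'n) vec \<Rightarrow> (real, 'n) vec" where
  "sharp a = matrix_inv G *v a"

lemma G_invertible: "invertible G"
proof -
  have "inj ((*v) G)"
    by (rule injI) (rule g_eqI, simp)
  then show ?thesis by (simp add: invertible_left_inverse matrix_left_invertible_injective)
qed

lemma G_sharp [simp]: "G *v sharp a = a"
proof -
  have "G ** matrix_inv G = mat 1"
    using G_invertible unfolding invertible_def matrix_inv_def by (rule someI2_ex) blast
  then show ?thesis by (simp add: sharp_def matrix_vector_mul_assoc)
qed

lemma sharp_G: "sharp (G *v a) = a"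
  by (rule g_eqI) simp

lemma sharp_linear: "sharp (a + b) = sharp a + sharp b" "sharp (r *\<^sub>R a) = r *\<^sub>R sharp a"
  by (simp_all add: sharp_def matrix_vector_right_distrib matrix_vector_mult_scaleR)

definition cross :: "(real, 'n) vec \<Rightarrow> (real, 'n) vec \<Rightarrow> (real, 'n) vec" where
  "cross x y = sharp (c x y)"

lemma g_cross: "g z (cross x y) = c x y \<bullet> z"
  by (simp add: cross_def inner_commute)

lemma one_form_inj: "one_form a = one_form (b :: (real, 'n) vec) \<Longrightarrow> a = b"
proof -
  assume "one_form a = one_form b"
  then have "coef (contract v (one_form a)) {} = coef (contract v (one_form b)) {}" for v by simp
  then have "(a - b) \<bullet> a = (a - b) \<bullet> b" by simp
  then have "(a - b) \<bullet> (a - b) = 0" by (simp add: inner_diff_right)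
  then show ?thesis by simp
qed

lemma c_linear: "c (x + y) z = c x z + c y z" "c (r *\<^sub>R x) z = r *\<^sub>R c x z"
  "c z (x + y) = c z x + c z y" "c z (r *\<^sub>R x) = r *\<^sub>R c z x"
  by (rule one_form_inj, simp add: contract2[symmetric] one_form_linear contract_linear_vector)+

lemma cross_linear: "cross (x + y) z = cross x z + cross y z" "cross (r *\<^sub>R x) z = r *\<^sub>R cross x z"
  "cross z (x + y) = cross z x + cross z y" "cross z (r *\<^sub>R x) = r *\<^sub>R cross z x"
  by (simp_all add: cross_def c_linear sharp_linear)

lemma linear_cross: "linear (cross x)"
  by (rule linearI) (simp_all add: cross_linear)

lemma cross_swap: "cross x y = - cross y x"
  using alt12[of x y] sharp_linear(2)[of "-1"] by (simp add: cross_def)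

lemma cross_skew: "g z (cross x y) = - g y (cross x z)"
  using alt23[of x y z] by (simp add: g_cross)

text \<open>
  Modulo metric terms, polarisation makes the left hand side alternating under exchanging \<open>x\<close> with \<open>n\<close>;
  it is alternating in \<open>x, v\<close> and in \<open>n, u\<close> anyway. Exchanging both pairs is an even permutation, and the
  metric terms are invariant under it.
\<close>
lemma pairing_symmetric: "c x v \<bullet> star n u = c n u \<bullet> star x v"
proof -
  have pol: "c x v \<bullet> star n u + c n v \<bullet> star x u =
      \<kappa> / 3 * (g x u * g n v + g n u * g x v - 2 * g x n * g u v)" for x v n u
    using star_inner_c[of "x + n" v u] star_inner_c[of x v u] star_inner_c[of n v u] G_sym[of n x]
    by (simp add: c_linear star_linear inner_add_left inner_add_right matrix_vector_right_distrib algebra_simps)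
  show ?thesis
    using pol[of x v n u] pol[of v n u x] alt12[of v n] alt12[of u n] star_swap[of u x] star_swap[of v x]
      G_sym[of v x] G_sym[of u n] G_sym[of u x] G_sym[of v n] G_sym[of v u] G_sym[of n x]
    by (simp add: algebra_simps)
qed

lemma cross_star: "cross x (star n u) = star x (cross n u)"
proof (rule g_eqI)
  fix v
  have "g v (cross x (star n u)) = - (c x v \<bullet> star n u)"
    using cross_skew[of v x "star n u"] by (simp add: cross_def inner_commute)
  moreover have "g v (star x (cross n u)) = - (c n u \<bullet> star x v)"
    using star_alternating23[of v x "cross n u"] G_sym[of "cross n u" "star x v"] by (simp add: cross_def inner_commute)
  ultimately show "g v (cross x (star n u)) = g v (star x (cross n u))"
    using pairing_symmetric by simp
qed

lemma cross_star_same: "cross x (star x u) = (\<kappa> / 3) *\<^sub>R (g x x *\<^sub>R u - g x u *\<^sub>R x)"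
proof (rule g_eqI)
  fix v
  have "g v (cross x (star x u)) = - (c x v \<bullet> star x u)"
    using cross_skew[of v x "star x u"] by (simp add: cross_def inner_commute)
  then show "g v (cross x (star x u)) = g v ((\<kappa> / 3) *\<^sub>R (g x x *\<^sub>R u - g x u *\<^sub>R x))"
    using star_inner_c[of x v u] G_sym[of x v] G_sym[of u v]
    by (simp add: matrix_vector_mult_scaleR matrix_vector_mult_diff_distrib algebra_simps inner_diff_right)
qed

abbreviation cc where "cc x u \<equiv> cross x (cross x u)"

text \<open>
  Evaluate \<open>x \<times> (x \<times> (n * (n \<times> u)))\<close> in two ways. Since \<open>n * (n \<times> u) = n \<times> (n * u)\<close>, the last factor is a
  combination of \<open>u\<close> and \<open>n\<close>; since \<open>x \<times> (n * w) = x * (n \<times> w)\<close>, the whole is a combination of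
  \<open>n \<times> (n \<times> u)\<close> and \<open>x\<close>.
\<close>
lemma cross_cross_exchange:
  "g n n *\<^sub>R cc x u - g n u *\<^sub>R cc x n = g x x *\<^sub>R cc n u - g x (cc n u) *\<^sub>R x"
proof -
  have lin: "cross x (a - b) = cross x a - cross x b" for a b
    using linear_diff[OF linear_cross] .
  have "cross x (cross x (star n (cross n u))) = cross x (star x (cc n u))"
    by (simp add: cross_star)
  then have "(\<kappa> / 3) *\<^sub>R (g n n *\<^sub>R cc x u - g n u *\<^sub>R cc x n) =
      (\<kappa> / 3) *\<^sub>R (g x x *\<^sub>R cc n u - g x (cc n u) *\<^sub>R x)"
    unfolding cross_star_same cross_star[symmetric, of n n] by (simp add: cross_linear lin)
  then show ?thesis using kappa by simp
qed

text \<open>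
  The basis dual to the coordinate basis with respect to the metric; it replaces an orthonormal basis in traces.
\<close>
definition dual :: "'n \<Rightarrow> (real, 'n) vec" where "dual i = sharp (axis i 1)"

lemma g_dual [simp]: "g v (dual i) = v $ i"
  by (simp add: dual_def inner_axis)

lemma g_dual' [simp]: "g (dual i) v = v $ i"
  using G_sym[of "dual i" v] by simp

lemma sum_g_axis: "(\<Sum>:i. g v (axis i 1) * w $ i) = g v w"
proof -
  have "w = (\<Sum>:i. w $ i *\<^sub>R axis i 1)"
    using basis_expansion[of w] by (simp add: scalar_mult_eq_scaleR)
  then have "g v w = g v (\<Sum>:i. w $ i *\<^sub>R axis i 1)" by simp
  also have "\<dots> = (\<Sum>:i. g v (axis i 1) * w $ i)"
    by (simp add: linear_sum[OF matrix_vector_mul_linear] inner_sum_right matrix_vector_mult_scaleR mult.commute)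
  finally show ?thesis by simp
qed

lemma sum_dual: "(\<Sum>:i. g (axis i 1) v *\<^sub>R dual i) = v"
proof (rule g_eqI)
  fix w
  show "g w (\<Sum>:i. g (axis i 1) v *\<^sub>R dual i) = g w v"
    using sum_g_axis[of v w] G_sym[of v w] G_sym[of v]
    by (simp add: linear_sum[OF matrix_vector_mul_linear] inner_sum_right matrix_vector_mult_scaleR)
qed

lemma sum_axis: "(\<Sum>:i. (v :: (real, 'n) vec) $ i *\<^sub>R axis i 1) = v"
  using basis_expansion[of v] by (simp add: scalar_mult_eq_scaleR)

definition tr :: "((real, 'n) vec \<Rightarrow> (real, 'n) vec) \<Rightarrow> real" where
  "tr L = (\<Sum>:i. L (axis i 1) $ i)"

lemma tr_compose: "linear L \<Longrightarrow> linear L' \<Longrightarrow> tr (\<lambda>u. L (L' u)) = tr (\<lambda>u. L' (L u))"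
proof -
  assume L: "linear L" "linear L'"
  have 1: "tr M = trace (matrix M)" for M by (simp add: tr_def trace_def matrix_def)
  have "tr (\<lambda>u. L (L' u)) = trace (matrix L ** matrix L')"
    using matrix_compose[OF L(2,1)] by (simp add: 1 comp_def)
  also have "\<dots> = trace (matrix L' ** matrix L)" by (rule trace_mul_sym)
  also have "\<dots> = tr (\<lambda>u. L' (L u))"
    using matrix_compose[OF L] by (simp add: 1 comp_def)
  finally show ?thesis .
qed

lemma tr_dual: assumes "linear L" shows "(\<Sum>:i. g (axis i 1) (L (dual i))) = tr L"
proof -
  have "L (dual i) = (\<Sum>:j. dual i $ j *\<^sub>R L (axis j 1))" for i
    by (subst sum_axis[of "dual i", symmetric]) (simp only: linear_sum[OF assms] linear_cmul[OF assms])
  then have "(\<Sum>:i. g (axis i 1) (L (dual i))) =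
      (\<Sum>:i j. g (axis i 1) (L (axis j 1)) * dual i $ j)"
    by (simp add: linear_sum[OF matrix_vector_mul_linear] inner_sum_right matrix_vector_mult_scaleR mult.commute)
  also have "\<dots> = (\<Sum>:j. (\<Sum>:i. g (axis i 1) (L (axis j 1)) *\<^sub>R dual i) $ j)"
    by (subst sum.swap) simp
  finally show ?thesis by (simp add: sum_dual tr_def)
qed

text \<open>
  Taking the trace over \<open>u\<close> in \<open>cross_cross_exchange\<close>: the terms that are not traces cancel, because both equal
  \<open>- |x \<times> n|\<^sup>2\<close>. So the trace form is proportional to the metric.
\<close>
lemma tr_cross_cross:
  obtains t where "\<And>x y. tr (\<lambda>u. cross x (cross y u)) = t * g x y"
proof -
  define Q where "Q x y = tr (\<lambda>u. cross x (cross y u))" for x y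
  have Q_sym: "Q x y = Q y x" for x y
    unfolding Q_def using tr_compose[OF linear_cross linear_cross] .
  have Q_add: "Q (x + y) z = Q x z + Q y z" "Q z (x + y) = Q z x + Q z y" for x y z
    by (simp_all add: Q_def tr_def cross_linear sum.distrib)
  have exch: "g n n * Q x x = g x x * Q n n" for x n
  proof -
    have 1: "g n (cc x n) = g x (cc n x)"
      using cross_skew[of n x "cross x n"] cross_skew[of x n "cross n x"] cross_swap[of n x]
      by (simp add: linear_neg[OF matrix_vector_mul_linear])
    have 2: "(\<Sum>:i. g n (axis i 1) * cc x n $ i) = g n (cc x n)" by (rule sum_g_axis)
    have 3: "(\<Sum>:i. g x (cc n (axis i 1)) * x $ i) = g x (cc n x)"
    proof -
      have "(\<Sum>:i. g x (cc n (axis i 1)) * x $ i) = (\<Sum>:i. g (cc n x) (axis i 1) * x $ i)"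
      proof (intro sum.cong refl)
        fix i
        show "g x (cc n (axis i 1)) * x $ i = g (cc n x) (axis i 1) * x $ i"
          using cross_skew[of x n "cross n (axis i 1)"] cross_skew[of "axis i 1" n "cross n x"]
            G_sym[of "cross n x" "cross n (axis i 1)"] G_sym[of "cc n x" "axis i 1"] by simp
      qed
      then show ?thesis using sum_g_axis[of "cc n x" x] G_sym[of x "cc n x"] by simp
    qed
    have "(\<Sum>:i. (g n n *\<^sub>R cc x (axis i 1) - g n (axis i 1) *\<^sub>R cc x n) $ i) =
       (\<Sum>:i. (g x x *\<^sub>R cc n (axis i 1) - g x (cc n (axis i 1)) *\<^sub>R x) $ i)"
      by (simp only: cross_cross_exchange)
    then show ?thesis
      using 1 2 3 by (simp add: Q_def tr_def sum_subtractf flip: sum_distrib_left)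
  qed
  \<comment> \<open>any fixed nonzero vector, to normalise the factor of proportionality\<close>
  define b :: "(real, 'n) vec" where "b = axis undefined 1"
  have "g b b > 0" by (rule G_pos) (simp add: b_def axis_eq_0_iff)
  then have diag: "Q x x = Q b b / g b b * g x x" for x
    using exch[of b x] by (simp add: field_simps)
  have "Q x y = Q b b / g b b * g x y" for x y
    using diag[of "x + y"] diag[of x] diag[of y] Q_sym[of x y] G_sym[of x y]
    by (simp add: Q_add inner_add_left matrix_vector_right_distrib algebra_simps)
  then show ?thesis using that unfolding Q_def by blast
qed

lemma linear_cc: "linear (cc x)"
  using linear_compose[OF linear_cross linear_cross] by (simp add: comp_def)

text \<open>
  Polarise \<open>cross_cross_exchange\<close> in \<open>n\<close> and take the trace over \<open>n\<close>; the sum of the right hand sides is the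
  trace form, with its arguments rearranged.
\<close>
lemma cross_cross:
  assumes t: "\<And>x y. tr (\<lambda>u. cross x (cross y u)) = t * g x y"
  shows "(real CARD('n) - 1) *\<^sub>R cc x u = t *\<^sub>R (g x x *\<^sub>R u - g x u *\<^sub>R x)"
proof -
  define B where "B n m = cross n (cross m u) + cross m (cross n u)" for n m
  have pol: "(2 * g n m) *\<^sub>R cc x u - g n u *\<^sub>R cc x m - g m u *\<^sub>R cc x n =
      g x x *\<^sub>R B n m - g x (B n m) *\<^sub>R x" for n m
  proof (subst vec_eq_iff, intro allI)
    fix k
    have ex: "g n n * cc x u $ k - g n u * cc x n $ k = g x x * cc n u $ k - g x (cc n u) * x $ k" for n
      using arg_cong[OF cross_cross_exchange[of n x u], of "\<lambda>v. v $ k"] by simp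
    show "((2 * g n m) *\<^sub>R cc x u - g n u *\<^sub>R cc x m - g m u *\<^sub>R cc x n) $ k =
        (g x x *\<^sub>R B n m - g x (B n m) *\<^sub>R x) $ k"
      using ex[of "n + m"] ex[of n] ex[of m] G_sym[of m n]
      by (simp add: B_def cross_linear inner_add_left inner_add_right matrix_vector_right_distrib algebra_simps)
  qed
  \<comment> \<open>the trace over the polarised pair \<open>n, m\<close>\<close>
  define S where "S = (\<Sum>:i. B (axis i 1) (dual i))"
  have "S = (2 * t) *\<^sub>R u"
  proof (rule g_eqI)
    fix v
    have sk: "g v (cross n (cross m u)) = g n (cross v (cross u m))" for n m
      using cross_skew[of v n "cross m u"] cross_skew[of n v "cross u m"] cross_swap[of n v] cross_swap[of u m]
        G_sym[of "cross m u" "cross v n"]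
      by (simp add: linear_neg[OF matrix_vector_mul_linear])
    have lin: "linear (\<lambda>w. cross v (cross u w))"
      using linear_compose[OF linear_cross linear_cross] by (simp add: comp_def)
    have "g v S = (\<Sum>:i. g (axis i 1) (cross v (cross u (dual i)))) + tr (\<lambda>w. cross v (cross u w))"
      by (simp add: S_def B_def linear_sum[OF matrix_vector_mul_linear] inner_sum_right sk
          matrix_vector_right_distrib inner_add_right sum.distrib tr_def)
    then show "g v S = g v ((2 * t) *\<^sub>R u)"
      using tr_dual[OF lin] t by (simp add: matrix_vector_mult_scaleR)
  qed
  moreover have "(\<Sum>:i. (2 * g (axis i 1) (dual i)) *\<^sub>R cc x u - g (axis i 1) u *\<^sub>R cc x (dual i)
       - g (dual i) u *\<^sub>R cc x (axis i 1)) = (2 * real CARD('n) - 2) *\<^sub>R cc x u"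
  proof -
    have "(\<Sum>:i. g (axis i 1) u *\<^sub>R cc x (dual i)) = cc x u"
      using arg_cong[OF sum_dual[of u], of "cc x"] by (simp add: linear_sum[OF linear_cc] linear_cmul[OF linear_cc])
    moreover have "(\<Sum>:i. g (dual i) u *\<^sub>R cc x (axis i 1)) = cc x u"
      using arg_cong[OF sum_axis[of u], of "cc x"] by (simp add: linear_sum[OF linear_cc] linear_cmul[OF linear_cc])
    moreover have "(\<Sum>:i. (2 * g (axis i 1) (dual i)) *\<^sub>R cc x u) = (2 * real CARD('n)) *\<^sub>R cc x u"
      by (simp add: sum_constant_scaleR mult.commute del: sum_constant)
    ultimately show ?thesis by (simp add: sum_subtractf scaleR_left_diff_distrib scaleR_2)
  qed
  moreover have "(\<Sum>:i. (2 * g (axis i 1) (dual i)) *\<^sub>R cc x u - g (axis i 1) u *\<^sub>R cc x (dual i)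
       - g (dual i) u *\<^sub>R cc x (axis i 1)) = g x x *\<^sub>R S - g x S *\<^sub>R x"
    unfolding pol S_def by (simp add: sum_subtractf scaleR_sum_left scaleR_sum_right
        linear_sum[OF matrix_vector_mul_linear] inner_sum_right)
  ultimately have "(2 * real CARD('n) - 2) *\<^sub>R cc x u = (2 * t) *\<^sub>R (g x x *\<^sub>R u - g x u *\<^sub>R x)"
    by (simp add: matrix_vector_mult_scaleR scaleR_diff_right mult.commute)
  then have "2 *\<^sub>R ((real CARD('n) - 1) *\<^sub>R cc x u) = 2 *\<^sub>R (t *\<^sub>R (g x x *\<^sub>R u - g x u *\<^sub>R x))"
    by (simp add: algebra_simps)
  then show ?thesis by (simp only: scaleR_cancel_left) simp
qed

lemma trace_nonzero:
  assumes t: "\<And>x y. tr (\<lambda>u. cross x (cross y u)) = t * g x y" and card: "CARD('n) > 1"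
  shows "t \<noteq> 0"
proof
  assume "t = 0"
  then have "cc x u = 0" for x u using cross_cross[OF t, of x u] card by simp
  then have "g (cross x u) (cross x u) = 0" for x u
    using cross_skew[of u x "cross x u"] by simp
  then have zero: "cross x u = 0" for x u
    using G_pos[of "cross x u"] by fastforce
  have "\<exists>i j :: 'n. i \<noteq> j"
  proof (rule ccontr)
    assume "\<nexists>i j :: 'n. i \<noteq> j"
    then have "CARD('n) \<le> 1" by (metis card_le_Suc0_iff_eq One_nat_def finite UNIV_I)
    then show False using card by simp
  qed
  then obtain i j :: 'n where "i \<noteq> j" by blast
  define x u :: "(real, 'n) vec" where "x = axis i 1" and "u = axis j 1"
  have "g x x *\<^sub>R u - g x u *\<^sub>R x = 0"
    using cross_star_same[of x u] zero kappa by simp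
  then have "(g x x *\<^sub>R u - g x u *\<^sub>R x) $ j = 0" by simp
  then have "g x x = 0" using \<open>i \<noteq> j\<close> by (simp add: x_def u_def axis_def)
  moreover have "g x x > 0" by (rule G_pos) (simp add: x_def axis_eq_0_iff)
  ultimately show False by simp
qed

text \<open>
  The equation says that \<open>H \<diamondop> \<Phi> + \<psi> = 0\<close>. Evaluating it on \<open>u, e\<^sub>i, u \<times> e\<^sup>i\<close> and summing over \<open>i\<close> removes
  \<open>\<psi>\<close>; by \<open>cross_cross\<close> the rest is a multiple of \<open>(n - 3) g(u, H u) + 2 tr(H) g(u,u)\<close>, which
  forces \<open>tr H = 0\<close> and then \<open>H = 0\<close>.
\<close>
lemma symmetric_part_unique:
  assumes card: "CARD('n) > 3"
    and h: "\<And>u v. g u (H v) = g v (H u)" "linear H"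
    and E: "\<And>u v w. c (H u) v \<bullet> w + c u (H v) \<bullet> w + c u v \<bullet> H w + \<psi> u v w = 0"
    and psi: "\<And>u. (\<Sum>:i. \<psi> u (axis i 1) (cross u (dual i))) = 0"
  shows "H u = 0"
proof -
  define n where "n = real CARD('n)"
  have n: "n > 3" using card by (simp add: n_def)
  obtain t where t: "\<And>x y. tr (\<lambda>u. cross x (cross y u)) = t * g x y" using tr_cross_cross by blast
  have t0: "t \<noteq> 0" using trace_nonzero[OF t] card by simp
  define r where "r = tr H"
  have lin: "linear (\<lambda>w. H (cross u w))" for u
    using linear_compose[OF linear_cross h(2)] by (simp add: comp_def)
  have trH: "(n - 1) * tr (\<lambda>w. cc u (H w)) = t * (g u u * r - g u (H u))" for u
  proof -
    have "(n - 1) * tr (\<lambda>w. cc u (H w)) = (\<Sum>:i. ((n - 1) *\<^sub>R cc u (H (axis i 1))) $ i)"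
      by (simp add: tr_def sum_distrib_left)
    also have "\<dots> = (\<Sum>:i. (t *\<^sub>R (g u u *\<^sub>R H (axis i 1) - g u (H (axis i 1)) *\<^sub>R u)) $ i)"
      by (simp only: n_def cross_cross[OF t])
    also have "\<dots> = t * (g u u * r - (\<Sum>:i. g u (H (axis i 1)) * u $ i))"
      by (simp add: r_def tr_def sum_subtractf sum_distrib_left right_diff_distrib)
    also have "(\<Sum>:i. g u (H (axis i 1)) * u $ i) = g u (H u)"
    proof -
      have "g u (H (axis i 1)) = g (H u) (axis i 1)" for i
        using h(1)[of u "axis i 1"] G_sym[of "axis i 1" "H u"] by (simp only:)
      then show ?thesis using sum_g_axis[of "H u" u] G_sym[of "H u" u] by (simp only:)
    qed
    finally show ?thesis .
  qed
  have key: "(n - 3) * g u (H u) + 2 * g u u * r = 0" for u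
  proof -
    let ?e = "\<lambda>i. axis i 1 :: (real, 'n) vec"
    have s: "c x y \<bullet> cross u (dual i) = - (cross u (cross x y) $ i)" for x y i
      using g_cross[of "cross u (dual i)" x y] cross_skew[of "cross x y" u "dual i"]
        G_sym[of "cross x y" "cross u (dual i)"] by (simp only: g_dual')
    have "(\<Sum>:i. c (H u) (?e i) \<bullet> cross u (dual i)) = - (t * g u (H u))"
      unfolding s using t[of u "H u"] by (simp add: tr_def sum_negf)
    moreover have "(\<Sum>:i. c u (H (?e i)) \<bullet> cross u (dual i)) = - tr (\<lambda>w. cc u (H w))"
      unfolding s by (simp add: tr_def sum_negf)
    moreover have "(\<Sum>:i. c u (?e i) \<bullet> H (cross u (dual i))) = - tr (\<lambda>w. cc u (H w))"
    proof -
      have "c u (?e i) \<bullet> H (cross u (dual i)) = - (cross u (H (cross u (?e i))) $ i)" for i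
        using h(1)[of "cross u (?e i)" "cross u (dual i)"] cross_skew[of "H (cross u (?e i))" u "dual i"]
          G_sym[of "H (cross u (?e i))" "cross u (dual i)"] g_cross[of "H (cross u (dual i))" u "?e i"]
          G_sym[of "H (cross u (dual i))" "cross u (?e i)"]
        by simp
      then have "(\<Sum>:i. c u (?e i) \<bullet> H (cross u (dual i))) = - tr (\<lambda>w. cross u (H (cross u w)))"
        by (simp add: tr_def sum_negf)
      then show ?thesis
        using tr_compose[OF linear_cross lin, of u u] tr_compose[OF h(2) linear_cc, of u] by simp
    qed
    moreover have "(\<Sum>:i. c (H u) (?e i) \<bullet> cross u (dual i) + c u (H (?e i)) \<bullet> cross u (dual i)
        + c u (?e i) \<bullet> H (cross u (dual i)) + \<psi> u (?e i) (cross u (dual i))) = 0"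
      by (simp only: E sum.neutral_const)
    ultimately have "t * g u (H u) + 2 * tr (\<lambda>w. cc u (H w)) = 0"
      using psi[of u] by (simp add: sum.distrib)
    with trH[of u] have "t * ((n - 3) * g u (H u) + 2 * g u u * r) = 0"
      by algebra
    then show ?thesis using t0 by simp
  qed
  have pol: "(n - 3) * g u (H v) + 2 * g u v * r = 0" for u v
    using key[of "u + v"] key[of u] key[of v] h(1)[of u v] G_sym[of u v]
    by (simp add: linear_add[OF h(2)] inner_add_left inner_add_right matrix_vector_right_distrib algebra_simps)
  have comp: "(n - 3) * (H v $ i) + 2 * (v $ i) * r = 0" for v i
    using pol[of "dual i" v] by simp
  have "(\<Sum>:i. (n - 3) * (H (axis i 1) $ i) + 2 * ((axis i 1 :: (real, 'n) vec) $ i) * r) = 0"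
    by (simp only: comp sum.neutral_const)
  then have "(n - 3) * r + 2 * n * r = 0"
    by (simp add: sum.distrib r_def tr_def n_def axis_def flip: sum_distrib_left)
  then have "(3 * n - 3) * r = 0" by (simp add: algebra_simps)
  then have "r = 0" using n by simp
  then show ?thesis using comp n by (simp add: vec_eq_iff)
qed

end

section \<open>The symmetric part of the soliton equation\<close>

text \<open>
  Forms of degree 1, 2, 3 in an arbitrary family of 1-forms in place of the \<open>dx i\<close>, nested so that a linear
  change of the family can be carried out one index at a time.
\<close>
definition expand1 :: "(7 \<Rightarrow> 7 exterior) \<Rightarrow> (7 \<Rightarrow> real) \<Rightarrow> 7 exterior" where
  "expand1 a y = (\<Sum>:i. y i *\<^sub>R a i)"
definition expand2 :: "(7 \<Rightarrow> 7 exterior) \<Rightarrow> (7 \<Rightarrow> 7 \<Rightarrow> real) \<Rightarrow> 7 exterior" where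
  "expand2 a \<beta> = (\<Sum>:i. a i * expand1 a (\<beta> i))"
definition expand3 :: "(7 \<Rightarrow> 7 exterior) \<Rightarrow> (7 \<Rightarrow> 7 \<Rightarrow> 7 \<Rightarrow> real) \<Rightarrow> 7 exterior" where
  "expand3 a \<gamma> = (\<Sum>:i. a i * expand2 a (\<gamma> i))"

lemma expand_mult:
  "expand1 a y * z = (\<Sum>:i. y i *\<^sub>R (a i * z))"
  "expand2 a \<beta> * z = (\<Sum>:i j. \<beta> i j *\<^sub>R (a i * (a j * z)))"
  "expand3 a \<gamma> * z = (\<Sum>:i j k. \<gamma> i j k *\<^sub>R (a i * (a j * (a k * z))))"
  by (simp_all add: expand1_def expand2_def expand3_def sum_distrib_left sum_distrib_right mult.assoc)

text \<open>
  For a fixed family of 1-forms the top coefficient is one alternating sum over the components, times a constant. So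
  lowering all indices multiplies an alternating sum by a constant, and no determinant need be computed.
\<close>
lemma top_coef_expand:
  assumes "\<And>i. odd_form (a i)"
  shows "top_coef (expand3 a \<gamma> * (expand1 a y * (expand1 a z * expand2 a \<beta>))) =
    (\<Sum>:i1 i2 i3 i4 i5 i6 i7.
      \<gamma> i1 i2 i3 * y i4 * z i5 * \<beta> i6 i7 * levi_civita_symbol i1 i2 i3 i4 i5 i6 i7)
    * top_coef (prod_list (map a indices7))"
proof -
  have 4: "top_coef (a i1 * (a i2 * (a i3 * (a i4 * (a i5 * expand2 a \<beta>))))) =
      (\<Sum>:i6 i7. \<beta> i6 i7 * levi_civita_symbol i1 i2 i3 i4 i5 i6 i7) * top_coef (prod_list (map a indices7))"
    for i1 i2 i3 i4 i5
    using product_levi_civita[of a, OF assms]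
    by (simp add: expand_mult(2)[of _ _ 1, simplified] sum_distrib_left sum_distrib_right top_coef_sum mult.assoc)
  have 3: "top_coef (a i1 * (a i2 * (a i3 * (a i4 * (expand1 a z * expand2 a \<beta>))))) =
      (\<Sum>:i5. z i5 * top_coef (a i1 * (a i2 * (a i3 * (a i4 * (a i5 * expand2 a \<beta>))))))" for i1 i2 i3 i4
    by (simp add: expand_mult(1) sum_distrib_left top_coef_sum)
  have 2: "top_coef (a i1 * (a i2 * (a i3 * (expand1 a y * (expand1 a z * expand2 a \<beta>))))) =
      (\<Sum>:i4. y i4 * top_coef (a i1 * (a i2 * (a i3 * (a i4 * (expand1 a z * expand2 a \<beta>))))))" for i1 i2 i3
    by (simp add: expand_mult(1)[of a y] sum_distrib_left top_coef_sum)
  have 1: "top_coef (expand3 a \<gamma> * (expand1 a y * (expand1 a z * expand2 a \<beta>))) =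
      (\<Sum>:i1 i2 i3. \<gamma> i1 i2 i3 *
         top_coef (a i1 * (a i2 * (a i3 * (expand1 a y * (expand1 a z * expand2 a \<beta>))))))"
    by (simp add: expand_mult(3) sum_distrib_left top_coef_sum)
  show ?thesis
    unfolding 1 2 3 4 sum_distrib_left sum_distrib_right
    by (intro sum.cong refl) (simp only: mult.assoc)
qed

lemma expand_change:
  fixes P :: "7 \<Rightarrow> 7 \<Rightarrow> real" and a :: "7 \<Rightarrow> 7 exterior"
  defines "b \<equiv> \<lambda>p. \<Sum>:i. P i p *\<^sub>R a i"
  shows "expand1 b y = expand1 a (\<lambda>i. \<Sum>:p. P i p * y p)"
    and "expand2 b \<beta> = expand2 a (\<lambda>i j. \<Sum>:p. P i p * (\<Sum>:q. P j q * \<beta> p q))"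
    and "expand3 b \<gamma> = expand3 a (\<lambda>i j k. \<Sum>:p. P i p *
       (\<Sum>:q. P j q * (\<Sum>:r. P k r * \<gamma> p q r)))"
proof -
  have lin: "(\<Sum>:p. b p * Z p) = (\<Sum>:i. a i * (\<Sum>:p. P i p *\<^sub>R Z p))" for Z
    unfolding b_def sum_distrib_left sum_distrib_right by (subst sum.swap) simp
  have e1: "(\<Sum>:p. k p *\<^sub>R expand1 a (y p)) = expand1 a (\<lambda>i. \<Sum>:p. k p * y p i)" for k :: "7 \<Rightarrow> real" and y
    unfolding expand1_def scaleR_sum_right scaleR_sum_left by (subst sum.swap) simp
  have e2: "(\<Sum>:p. k p *\<^sub>R expand2 a (\<beta> p)) = expand2 a (\<lambda>i j. \<Sum>:p. k p * \<beta> p i j)" for k :: "7 \<Rightarrow> real" and \<beta>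
  proof -
    have "(\<Sum>:p. k p *\<^sub>R expand2 a (\<beta> p)) = (\<Sum>:i. a i * (\<Sum>:p. k p *\<^sub>R expand1 a (\<beta> p i)))"
      unfolding expand2_def scaleR_sum_right sum_distrib_left by (subst sum.swap) simp
    then show ?thesis by (simp add: e1 expand2_def)
  qed
  show 1: "expand1 b y = expand1 a (\<lambda>i. \<Sum>:p. P i p * y p)" for y
    unfolding expand1_def b_def scaleR_sum_right scaleR_sum_left by (subst sum.swap) (simp add: mult.commute)
  show 2: "expand2 b \<beta> = expand2 a (\<lambda>i j. \<Sum>:p. P i p * (\<Sum>:q. P j q * \<beta> p q))" for \<beta>
    unfolding expand2_def[of b] lin 1 e1 by (simp only: expand2_def)
  show "expand3 b \<gamma> = expand3 a (\<lambda>i j k. \<Sum>:p. P i p *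
       (\<Sum>:q. P j q * (\<Sum>:r. P k r * \<gamma> p q r)))"
    unfolding expand3_def[of b] lin 2 e2 by (simp only: expand3_def)
qed

lemma hodge3_eq:
  "hodge3 g \<nu> \<phi> x l i j k = \<nu> x / 6 * (\<Sum>:a b c.
     (\<Sum>:p. ginv g x a p * (\<Sum>:q. ginv g x b q * (\<Sum>:r. ginv g x c r * \<phi> x p q r)))
     * levi_civita_symbol a b c l i j k)"
proof -
  let ?L = "\<lambda>a b c. levi_civita_symbol a b c l i j k"
  define K1 where "K1 p q c = (\<Sum>:r. ginv g x c r * \<phi> x p q r)" for p q c
  define K2 where "K2 p b c = (\<Sum>:q. ginv g x b q * K1 p q c)" for p b c
  define K3 where "K3 a b c = (\<Sum>:p. ginv g x a p * K2 p b c)" for a b c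
  have 1: "contr g x (\<lambda>c c'. \<phi> x p q c' * \<nu> x * ?L a b c) = (\<Sum>:c. K1 p q c * (\<nu> x * ?L a b c))" for p q a b
    unfolding contr_def K1_def sum_distrib_right by (simp only: mult.assoc)
  have 2: "contr g x (\<lambda>b q. \<Sum>:c. K1 p q c * (\<nu> x * ?L a b c)) =
     (\<Sum>:b c. K2 p b c * (\<nu> x * ?L a b c))" for p a
    unfolding contr_def K2_def sum_distrib_left sum_distrib_right
    by (rule sum.cong[OF refl], subst sum.swap) (simp only: mult.assoc)
  have 3: "contr g x (\<lambda>a p. \<Sum>:b c. K2 p b c * (\<nu> x * ?L a b c)) =
     (\<Sum>:a b c. K3 a b c * (\<nu> x * ?L a b c))"
  proof -
    have "(\<Sum>:p. ginv g x a p * (\<Sum>:b c. K2 p b c * (\<nu> x * ?L a b c))) =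
        (\<Sum>:b c p. ginv g x a p * (K2 p b c * (\<nu> x * ?L a b c)))" for a
      unfolding sum_distrib_left
      by (rule trans[OF sum.swap]) (rule sum.cong[OF refl sum.swap])
    then show ?thesis unfolding contr_def K3_def sum_distrib_right by (simp only: mult.assoc)
  qed
  have "hodge3 g \<nu> \<phi> x l i j k = (\<Sum>:a b c. K3 a b c * (\<nu> x * ?L a b c)) / fact 3"
    unfolding hodge3_def 1 2 3 ..
  also have "\<dots> = \<nu> x / 6 * (\<Sum>:a b c. K3 a b c * ?L a b c)"
    by (simp add: fact_numeral sum_distrib_left sum_divide_distrib mult_ac)
  finally show ?thesis unfolding K3_def K2_def K1_def .
qed

lemma sum_mult_axis:
  fixes F :: "'n::finite \<Rightarrow> real"
  shows "(\<Sum>:j. F j * axis i 1 $ j) = F i" "(\<Sum>:j. axis i 1 $ j * F j) = F i"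
    "(\<Sum>:j. axis i 1 $ j * (a * F j)) = a * F i"
proof -
  have "(\<Sum>:j. F j * axis i 1 $ j) = (\<Sum>:j. if j = i then F j else 0)" for F :: "'n \<Rightarrow> real"
    by (intro sum.cong refl) (simp add: axis_def)
  then show 1: "(\<Sum>:j. F j * axis i 1 $ j) = F i" for F :: "'n \<Rightarrow> real" by simp
  show "(\<Sum>:j. axis i 1 $ j * F j) = F i" using 1[of F] by (simp only: mult.commute)
  show "(\<Sum>:j. axis i 1 $ j * (a * F j)) = a * F i"
    using 1[of "\<lambda>j. a * F j"] by (simp only: mult.commute)
qed

lemma linear_zero_on_axes:
  fixes f :: "real ^ 'n \<Rightarrow> real"
  assumes "linear f" "\<And>i. f (axis i 1) = 0" shows "f v = 0"
proof -
  have "v = (\<Sum>:i. v $ i *\<^sub>R axis i 1)"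
    using basis_expansion[of v] by (simp add: scalar_mult_eq_scaleR)
  then have "f v = f (\<Sum>:i. v $ i *\<^sub>R axis i 1)" by (rule arg_cong)
  then show ?thesis by (simp add: linear_sum[OF assms(1)] linear_cmul[OF assms(1)] assms(2))
qed

lemma matrix_inv_symmetric:
  fixes G :: "real ^ 'n ^ 'n"
  assumes "invertible G" "Finite_Cartesian_Product.transpose G = G"
  shows "matrix_inv G $ i $ j = matrix_inv G $ j $ i"
proof -
  have GI: "G ** matrix_inv G = mat 1 \<and> matrix_inv G ** G = mat 1"
    using assms(1) unfolding invertible_def matrix_inv_def by (rule someI2_ex) blast
  have "Finite_Cartesian_Product.transpose (G ** matrix_inv G) = mat 1"
    using GI by (simp add: transpose_mat)
  then have TG: "Finite_Cartesian_Product.transpose (matrix_inv G) ** G = mat 1"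
    by (simp add: matrix_transpose_mul assms(2))
  have "Finite_Cartesian_Product.transpose (matrix_inv G) =
      Finite_Cartesian_Product.transpose (matrix_inv G) ** (G ** matrix_inv G)"
    using GI by simp
  also have "\<dots> = matrix_inv G" by (simp add: matrix_mul_assoc TG)
  finally have "Finite_Cartesian_Product.transpose (matrix_inv G) $ i $ j = matrix_inv G $ i $ j" by simp
  then show ?thesis by (simp add: Finite_Cartesian_Product.transpose_def)
qed

lemma exterior3_expand: "exterior3 \<gamma> = (1 / 6) *\<^sub>R expand3 dx \<gamma>"
  by (simp add: exterior3_def expand_mult(3)[of _ _ 1, simplified] mult.assoc)

lemma two_form_expand: "two_form \<beta> = (1 / 2) *\<^sub>R expand2 dx \<beta>"
  by (simp add: two_form_def expand_mult(2)[of _ _ 1, simplified])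

text \<open>
  The map \<open>h, Y \<mapsto> h \<diamondop> \<phi> + Y \<lrcorner> \<psi>\<close> is injective in the symmetric argument. What remains to be checked
  for \<open>symmetric_part_unique\<close> is that \<open>\<psi>(Y, u, e\<^sub>i, u \<times> e\<^sup>i)\<close> sums to zero. With \<open>\<psi> = *\<phi>\<close> this is an alternating
  sum of raised components of \<open>\<phi>\<close>, \<open>Y\<close>, \<open>u\<close> and \<open>u \<lrcorner> \<phi>\<close>; lowering the indices turns it into a multiple of
  \<open>\<phi> \<and> Y \<and> u \<and> (u \<lrcorner> \<phi>)\<close>, that is, of \<open>g(Y, u * u) = 0\<close>.
\<close>
lemma diamond_hook4_eq_0:
  fixes g h :: cov2 and \<phi> :: cov3 and \<nu> :: "R7 \<Rightarrow> real" and Y :: "R7 \<Rightarrow> 7 \<Rightarrow> real"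
  assumes alt: "\<And>i j k. \<phi> x i j k = - \<phi> x j i k" "\<And>i j k. \<phi> x i j k = - \<phi> x i k j"
    and g_sym: "\<And>i j. g x i j = g x j i"
    and g_pos: "\<And>v::R7. v \<noteq> 0 \<Longrightarrow> (\<Sum>:i j. g x i j * v $ i * v $ j) > 0"
    and nu: "\<nu> x \<noteq> 0"
    and wedge: "\<And>i j. wedge223 (\<phi> x i) (\<phi> x j) (\<phi> x) = - 6 * g x i j * \<nu> x"
    and h_sym: "\<And>i j. h x i j = h x j i"
    and eq: "\<And>i j k. diamond g h \<phi> x i j k + hook4 g Y (hodge3 g \<nu> \<phi>) x i j k = 0"
  shows "h x i j = 0"
proof -
  define G :: "((real, 7) vec, 7) vec" where "G = (\<chi> i j. g x i j)"
  define \<Phi> where "\<Phi> = exterior3 (\<phi> x)"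
  define cv where "cv v j k = (\<Sum>:i. v $ i * \<phi> x i j k)" for v :: R7 and j k
  define c :: "R7 \<Rightarrow> R7 \<Rightarrow> R7" where "c v w = (\<chi> k. \<Sum>:j. w $ j * cv v j k)" for v w
  have ip: "u \<bullet> (G *v v) = (\<Sum>:i j. g x i j * u $ i * v $ j)" for u v :: R7
    by (simp add: G_def inner_vec_def matrix_vector_mult_def sum_distrib_left mult_ac)
  have cv_alt: "cv v j k = - cv v k j" for v j k
    unfolding cv_def sum_negf[symmetric]
  proof (intro sum.cong refl)
    fix i show "v $ i * \<phi> x i j k = - (v $ i * \<phi> x i k j)" using alt(2)[of i j k] by simp
  qed
  have contract1: "contract v \<Phi> = two_form (cv v)" for v
  proof -
    have "cv v = (\<lambda>j k. \<Sum>:i. v $ i * \<phi> x i j k)" by (simp add: cv_def fun_eq_iff)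
    then show ?thesis by (simp only: \<Phi>_def contract_exterior3[OF alt])
  qed
  have contract2: "contract w (contract v \<Phi>) = one_form (c v w)" for v w
    unfolding contract1 contract_two_form[OF cv_alt] c_def ..
  have c_comp: "c v w $ k = (\<Sum>:i j. v $ i * w $ j * \<phi> x i j k)" for v w k
    unfolding c_def cv_def by (simp add: sum_distrib_left mult_ac) (rule sum.swap)
  have c_inner: "c v w \<bullet> u = (\<Sum>:j k. w $ j * u $ k * cv v j k)" for v w u
    unfolding c_def inner_vec_def by (simp add: sum_distrib_left sum_distrib_right mult_ac) (rule sum.swap)
  interpret cross_form \<Phi> G "- 6 * \<nu> x * vol7" c
  proof
    show "odd_form \<Phi>" by (simp add: \<Phi>_def)
    show "contract w (contract v \<Phi>) = one_form (c v w)" for v w by (rule contract2)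
    show "c v w = - c w v" for v w
    proof (subst vec_eq_iff, intro allI)
      fix k
      have "c v w $ k = (\<Sum>:j i. v $ i * w $ j * \<phi> x i j k)"
        unfolding c_comp by (rule sum.swap)
      also have "\<dots> = (\<Sum>:j i. - (w $ j * v $ i * \<phi> x j i k))"
      proof (intro sum.cong refl)
        fix i j show "v $ i * w $ j * \<phi> x i j k = - (w $ j * v $ i * \<phi> x j i k)"
          using alt(1)[of i j k] by simp
      qed
      finally show "c v w $ k = (- c w v) $ k" by (simp add: c_comp sum_negf)
    qed
    show "c v w \<bullet> u = - (c v u \<bullet> w)" for v w u
    proof -
      have "c v w \<bullet> u = (\<Sum>:k j. w $ j * u $ k * cv v j k)"
        unfolding c_inner by (rule sum.swap)
      also have "\<dots> = (\<Sum>:k j. - (u $ k * w $ j * cv v k j))"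
      proof (intro sum.cong refl)
        fix j k show "w $ j * u $ k * cv v j k = - (u $ k * w $ j * cv v k j)"
          using cv_alt[of v j k] by simp
      qed
      finally show ?thesis by (simp add: c_inner sum_negf)
    qed
    show "- 6 * \<nu> x * vol7 \<noteq> 0" using nu vol7_nonzero by simp
    show "top_coef (contract u \<Phi> * contract v \<Phi> * \<Phi>) = - 6 * \<nu> x * vol7 * (u \<bullet> (G *v v))" for u v
    proof -
      have "two_form (cv w) = (\<Sum>:i. w $ i *\<^sub>R two_form (\<phi> x i))" for w
      proof -
        have "(\<Sum>:a b. cv w a b *\<^sub>R (dx a * dx b)) =
            (\<Sum>:i. w $ i *\<^sub>R (\<Sum>:a b. \<phi> x i a b *\<^sub>R (dx a * dx b)))"
        proof -
          have "(\<Sum>:a b. cv w a b *\<^sub>R (dx a * dx b)) =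
              (\<Sum>:a b i. w $ i *\<^sub>R \<phi> x i a b *\<^sub>R (dx a * dx b))"
            by (simp add: cv_def scaleR_sum_left)
          also have "\<dots> = (\<Sum>:a i b. w $ i *\<^sub>R \<phi> x i a b *\<^sub>R (dx a * dx b))"
            by (rule sum.cong[OF refl sum.swap])
          also have "\<dots> = (\<Sum>:i a b. w $ i *\<^sub>R \<phi> x i a b *\<^sub>R (dx a * dx b))"
            by (rule sum.swap)
          finally show ?thesis by (simp only: scaleR_sum_right)
        qed
        then show ?thesis by (simp add: two_form_def scaleR_sum_right mult.commute)
      qed
      then have "top_coef (contract u \<Phi> * contract v \<Phi> * \<Phi>) =
          (\<Sum>:i j. u $ i * (v $ j * top_coef (two_form (\<phi> x i) * two_form (\<phi> x j) * exterior3 (\<phi> x))))"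
        unfolding contract1 unfolding \<Phi>_def by (simp add: sum_distrib_left sum_distrib_right top_coef_sum)
          (subst sum.swap, simp only: mult.left_commute)
      also have "\<dots> = - 6 * \<nu> x * vol7 * (u \<bullet> (G *v v))"
        unfolding top_coef_wedge223 wedge ip by (simp add: sum_distrib_left mult_ac)
      finally show ?thesis .
    qed
    show "u \<bullet> (G *v v) = v \<bullet> (G *v u)" for u v
    proof -
      have "u \<bullet> (G *v v) = (\<Sum>:j i. g x i j * u $ i * v $ j)"
        unfolding ip by (rule sum.swap)
      also have "\<dots> = v \<bullet> (G *v u)"
        unfolding ip
      proof (intro sum.cong refl)
        fix i j show "g x i j * u $ i * v $ j = g x j i * v $ j * u $ i"
          using g_sym[of i j] by simp
      qed
      finally show ?thesis .
    qed
    show "v \<noteq> 0 \<Longrightarrow> v \<bullet> (G *v v) > 0" for v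
      using g_pos[of v] by (simp add: ip)
  qed

  have ginv_sym: "ginv g x i j = ginv g x j i" for i j
  proof -
    have "Finite_Cartesian_Product.transpose G = G"
      by (simp add: G_def Finite_Cartesian_Product.transpose_def vec_eq_iff g_sym)
    from matrix_inv_symmetric[OF G_invertible this] show ?thesis
      by (simp add: ginv_def G_def)
  qed
  have ginvG: "ginv g x i j = matrix_inv G $ i $ j" for i j
    by (simp add: ginv_def G_def)
  have sharp_comp: "sharp a $ i = (\<Sum>:j. ginv g x i j * a $ j)" for a i
    by (simp add: sharp_def matrix_vector_mult_def ginvG)
  have dual_comp: "dual i $ j = ginv g x j i" for i j
    by (simp add: dual_def sharp_comp sum_mult_axis)
  define hM :: "((real, 7) vec, 7) vec" where "hM = (\<chi> i j. h x i j)"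
  define H where "H u = sharp (hM *v u)" for u
  have H_comp: "H (axis i 1) $ q = (\<Sum>:p. ginv g x q p * h x p i)" for i q
    by (simp add: H_def sharp_comp hM_def matrix_vector_mult_def sum_mult_axis)
  have H_lin: "linear H"
    by (rule linearI)
      (simp_all add: H_def sharp_linear matrix_vector_right_distrib matrix_vector_mult_scaleR)
  have H_sym: "u \<bullet> (G *v H v) = v \<bullet> (G *v H u)" for u v
  proof -
    have ip: "u \<bullet> (G *v H v) = (\<Sum>:i j. h x i j * u $ i * v $ j)" for u v :: R7
    proof -
      have "u \<bullet> (G *v H v) = u \<bullet> (hM *v v)" by (simp add: H_def)
      then show ?thesis by (simp add: hM_def inner_vec_def matrix_vector_mult_def sum_distrib_left mult_ac)
    qed
    have "u \<bullet> (G *v H v) = (\<Sum>:j i. h x i j * u $ i * v $ j)"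
      unfolding ip by (rule sum.swap)
    also have "\<dots> = v \<bullet> (G *v H u)"
      unfolding ip
    proof (intro sum.cong refl)
      fix i j show "h x i j * u $ i * v $ j = h x j i * v $ j * u $ i"
        using h_sym[of i j] by simp
    qed
    finally show ?thesis .
  qed
  define K where "K i j k = hook4 g Y (hodge3 g \<nu> \<phi>) x i j k" for i j k
  define \<psi> where "\<psi> u v w = (\<Sum>:i j k. u $ i * v $ j * w $ k * K i j k)"
    for u v w :: R7
  have \<psi>_lin: "\<psi> (u + u') v w = \<psi> u v w + \<psi> u' v w" "\<psi> (r *\<^sub>R u) v w = r * \<psi> u v w"
    "\<psi> u (v + v') w = \<psi> u v w + \<psi> u v' w" "\<psi> u (r *\<^sub>R v) w = r * \<psi> u v w"
    "\<psi> u v (w + w') = \<psi> u v w + \<psi> u v w'" "\<psi> u v (r *\<^sub>R w) = r * \<psi> u v w" for u u' v v' w w' r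
    unfolding \<psi>_def by (simp_all add: algebra_simps sum.distrib sum_distrib_left)
  define E where "E u v w = c (H u) v \<bullet> w + c u (H v) \<bullet> w + c u v \<bullet> H w + \<psi> u v w" for u v w
  have H_lin': "H (u + v) = H u + H v" "H (r *\<^sub>R u) = r *\<^sub>R H u" for u v r
    using linear_add[OF H_lin] linear_cmul[OF H_lin] by auto
  have E_base: "E (axis i 1) (axis j 1) (axis k 1) = 0" for i j k
  proof -
    note ax = sum_mult_axis
    have contr_h: "contr g x (\<lambda>p q. h x i p * F q) = (\<Sum>:q. H (axis i 1) $ q * F q)" for i F
    proof -
      have "contr g x (\<lambda>p q. h x i p * F q) = (\<Sum>:q p. ginv g x p q * (h x i p * F q))"
        unfolding contr_def by (rule sum.swap)
      also have "\<dots> = (\<Sum>:q. H (axis i 1) $ q * F q)"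
        unfolding H_comp sum_distrib_right
      proof (intro sum.cong refl)
        fix p q show "ginv g x p q * (h x i p * F q) = ginv g x q p * h x p i * F q"
          using ginv_sym[of p q] h_sym[of i p] by simp
      qed
      finally show ?thesis .
    qed
    have 1: "c (H (axis i 1)) (axis j 1) \<bullet> axis k 1 = contr g x (\<lambda>p q. h x i p * \<phi> x q j k)"
      unfolding contr_h inner_axis c_comp
      by (simp add: mult.assoc sum_distrib_left[symmetric] ax)
    have 2: "c (axis i 1) (H (axis j 1)) \<bullet> axis k 1 = contr g x (\<lambda>p q. h x j p * \<phi> x i q k)"
      unfolding contr_h inner_axis c_comp
      by (simp add: mult.assoc sum_distrib_left[symmetric] ax)
    have 3: "c (axis i 1) (axis j 1) \<bullet> H (axis k 1) = contr g x (\<lambda>p q. h x k p * \<phi> x i j q)"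
    proof -
      have "c (axis i 1) (axis j 1) $ q = \<phi> x i j q" for q
        unfolding c_comp by (simp add: mult.assoc sum_distrib_left[symmetric] ax)
      then show ?thesis unfolding contr_h inner_vec_def by (simp add: mult.commute)
    qed
    have 4: "\<psi> (axis i 1) (axis j 1) (axis k 1) = K i j k"
      unfolding \<psi>_def by (simp add: mult.assoc sum_distrib_left[symmetric] ax)
    show ?thesis
      using eq[of i j k] unfolding E_def 1 2 3 4 K_def diamond_def .
  qed
  have E1: "linear (\<lambda>u. E u v w)" and E2: "linear (\<lambda>v. E u v w)" and E3: "linear (\<lambda>w. E u v w)" for u v w
    unfolding E_def
    by (rule linearI; simp only: H_lin' c_linear \<psi>_lin inner_add_left inner_add_right inner_scaleR_left
        inner_scaleR_right real_scaleR_def distrib_left; simp)+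
  have "E u (axis j 1) (axis k 1) = 0" for u j k
    by (rule linear_zero_on_axes[OF E1 E_base])
  then have "E u v (axis k 1) = 0" for u v k
    by (rule linear_zero_on_axes[OF E2])
  then have E: "E u v w = 0" for u v w
    by (rule linear_zero_on_axes[OF E3])
  have psi: "(\<Sum>:i. \<psi> u (axis i 1) (cross u (dual i))) = 0" for u
  proof -
    define Yv :: R7 where "Yv = (\<chi> i. Y x i)"
    define y where "y = sharp Yv"
    define m where "m j k = cross u (dual j) $ k" for j k
    define \<gamma> where "\<gamma> a b c = (\<Sum>:p. ginv g x a p *
      (\<Sum>:q. ginv g x b q * (\<Sum>:r. ginv g x c r * \<phi> x p q r)))" for a b c
    define L :: "7 \<Rightarrow> 7 \<Rightarrow> 7 \<Rightarrow> 7 \<Rightarrow> 7 \<Rightarrow> 7 \<Rightarrow> 7 \<Rightarrow> real"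
      where "L a b c l i j k = levi_civita_symbol a b c l i j k" for a b c l i j k
    \<comment> \<open>the raised coordinate 1-forms: expanding lowered components in \<open>\<delta>\<close> equals expanding raised components in \<open>dx\<close>\<close>
    define \<delta> where "\<delta> p = (\<Sum>:i. ginv g x i p *\<^sub>R dx i)" for p
    have \<delta>_odd: "odd_form (\<delta> p)" for p
      unfolding \<delta>_def by (intro even_odd_sum even_odd_scale) simp
    have \<delta>: "\<delta> = (\<lambda>p. \<Sum>:i. ginv g x i p *\<^sub>R dx i)" by (simp add: fun_eq_iff \<delta>_def)
    \<comment> \<open>the contraction is an alternating sum over seven indices\<close>
    have K_eq: "K i j k = (\<Sum>:l. y $ l * hodge3 g \<nu> \<phi> x l i j k)" for i j k
    proof -
      have "K i j k = (\<Sum>:l a. ginv g x a l * (Y x a * hodge3 g \<nu> \<phi> x l i j k))"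
        unfolding K_def hook4_def contr_def by (rule sum.swap)
      also have "\<dots> = (\<Sum>:l. y $ l * hodge3 g \<nu> \<phi> x l i j k)"
        unfolding y_def sharp_comp sum_distrib_right
      proof (intro sum.cong refl)
        fix a l show "ginv g x a l * (Y x a * hodge3 g \<nu> \<phi> x l i j k) =
            ginv g x l a * Yv $ a * hodge3 g \<nu> \<phi> x l i j k"
          using ginv_sym[of a l] by (simp add: Yv_def)
      qed
      finally show ?thesis .
    qed
    have swap4: "(\<Sum>:k a b c. F k a b c) =
        (\<Sum>:a b c k. (F k a b c :: real))" for F :: "7 \<Rightarrow> 7 \<Rightarrow> 7 \<Rightarrow> 7 \<Rightarrow> real"
    proof -
      have "(\<Sum>:k a b c. F k a b c) =
          (\<Sum>:a k b c. F k a b c)" by (rule sum.swap)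
      also have "\<dots> = (\<Sum>:a b k c. F k a b c)"
        by (rule sum.cong[OF refl sum.swap])
      also have "\<dots> = (\<Sum>:a b c k. F k a b c)"
        by (rule sum.cong[OF refl], rule sum.cong[OF refl sum.swap])
      finally show ?thesis .
    qed
    define Z where "Z = (\<Sum>:a b c l i j k.
      \<gamma> a b c * y $ l * u $ i * m j k * L a b c l i j k)"
    have "(\<Sum>:j. \<psi> u (axis j 1) (cross u (dual j))) =
        (\<Sum>:i j k. u $ i * m j k * K i j k)"
    proof -
      have "\<psi> u (axis j 1) (cross u (dual j)) = (\<Sum>:i k. u $ i * m j k * K i j k)" for j
      proof -
        have "\<psi> u (axis j 1) (cross u (dual j)) = (\<Sum>:i j'. if j' = j then
            (\<Sum>:k. u $ i * m j k * K i j k) else 0)"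
          unfolding \<psi>_def by (intro sum.cong refl) (simp add: axis_def m_def)
        then show ?thesis by simp
      qed
      then show ?thesis by simp (rule sum.swap)
    qed
    also have "\<dots> = (\<Sum>:i j k l. u $ i * m j k * (y $ l * hodge3 g \<nu> \<phi> x l i j k))"
      unfolding K_eq sum_distrib_left ..
    also have "\<dots> = (\<Sum>:l i j k. u $ i * m j k * (y $ l * hodge3 g \<nu> \<phi> x l i j k))"
      by (rule swap4[symmetric])
    also have "\<dots> = (\<Sum>:l i j k. \<nu> x / 6 * (\<Sum>:a b c.
        \<gamma> a b c * y $ l * u $ i * m j k * L a b c l i j k))"
      unfolding hodge3_eq \<gamma>_def[symmetric] L_def[symmetric]
      by (intro sum.cong refl) (simp add: sum_distrib_left mult_ac)
    also have "\<dots> = \<nu> x / 6 * (\<Sum>:l i j k a b c.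
        \<gamma> a b c * y $ l * u $ i * m j k * L a b c l i j k)"
      by (simp only: sum_distrib_left)
    also have "(\<Sum>:l i j k a b c.
        \<gamma> a b c * y $ l * u $ i * m j k * L a b c l i j k) = Z"
    proof -
      let ?F = "\<lambda>a b c l i j k. \<gamma> a b c * y $ l * u $ i * m j k * L a b c l i j k"
      have "(\<Sum>:l i j k a b c. ?F a b c l i j k)
        = (\<Sum>:l i j a b c k. ?F a b c l i j k)"
        by (rule sum.cong[OF refl], rule sum.cong[OF refl], rule sum.cong[OF refl], rule swap4)
      also have "\<dots> = (\<Sum>:l i a b c j k. ?F a b c l i j k)"
        by (rule sum.cong[OF refl], rule sum.cong[OF refl], rule swap4)
      also have "\<dots> = (\<Sum>:l a b c i j k. ?F a b c l i j k)"
        by (rule sum.cong[OF refl], rule swap4)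
      also have "\<dots> = Z" unfolding Z_def by (rule swap4)
      finally show ?thesis .
    qed
    finally have total: "(\<Sum>:j. \<psi> u (axis j 1) (cross u (dual j))) = \<nu> x / 6 * Z" .
    \<comment> \<open>lowering all seven indices multiplies the alternating sum by a constant\<close>
    have one: "expand1 dx z = one_form (\<chi> i. z i)" for z
      by (simp add: expand1_def one_form_expand[of "\<chi> i. z i"])
    have "Z * vol7 = top_coef (expand3 dx \<gamma> * (expand1 dx (($) y) * (expand1 dx (($) u) * expand2 dx m)))"
      using top_coef_expand[of dx \<gamma> "($) y" "($) u" m] by (simp add: Z_def L_def vol7_def)
    also have "expand3 dx \<gamma> = expand3 \<delta> (\<phi> x)"
      unfolding \<delta> expand_change(3) by (rule arg_cong[where f = "expand3 dx"]) (simp add: fun_eq_iff \<gamma>_def)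
    also have "expand1 dx (($) y) = expand1 \<delta> (Y x)"
      unfolding \<delta> expand_change(1)
      by (rule arg_cong[where f = "expand1 dx"]) (simp add: fun_eq_iff y_def sharp_comp Yv_def)
    also have "expand1 dx (($) u) = expand1 \<delta> (($) (G *v u))"
      unfolding \<delta> expand_change(1)
      by (rule arg_cong[where f = "expand1 dx"]) (simp add: fun_eq_iff sharp_comp[symmetric] sharp_G)
    also have "expand2 dx m = expand2 \<delta> (cv u)"
      unfolding \<delta> expand_change(2)
    proof (rule arg_cong[where f = "expand2 dx"], intro ext)
      fix j k
      have "m j k = (\<Sum>:q p. ginv g x k q * (ginv g x p j * cv u p q))"
        by (simp add: m_def cross_def sharp_comp c_def dual_comp sum_distrib_left)
      also have "\<dots> = (\<Sum>:p q. ginv g x k q * (ginv g x p j * cv u p q))"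
        by (rule sum.swap)
      also have "\<dots> = (\<Sum>:p. ginv g x j p * (\<Sum>:q. ginv g x k q * cv u p q))"
        unfolding sum_distrib_left
      proof (intro sum.cong refl)
        fix p q show "ginv g x k q * (ginv g x p j * cv u p q) = ginv g x j p * (ginv g x k q * cv u p q)"
          using ginv_sym[of j p] by simp
      qed
      finally show "m j k = (\<Sum>:p. ginv g x j p * (\<Sum>:q. ginv g x k q * cv u p q))" .
    qed
    finally have Z: "Z * vol7 = top_coef (expand3 \<delta> (\<phi> x) * (expand1 \<delta> (Y x) * (expand1 \<delta> (($) (G *v u)) * expand2 \<delta> (cv u))))" .
    have "top_coef (expand3 dx (\<phi> x) * (expand1 dx (Y x) * (expand1 dx (($) (G *v u)) * expand2 dx (cv u)))) = 0"
    proof -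
      have "expand3 dx (\<phi> x) = 6 *\<^sub>R \<Phi>" by (simp add: \<Phi>_def exterior3_expand)
      moreover have "expand2 dx (cv u) = 2 *\<^sub>R contract u \<Phi>" by (simp add: contract1 two_form_expand)
      moreover have "expand1 dx (Y x) = one_form Yv" by (simp add: one Yv_def)
      moreover have "expand1 dx (($) (G *v u)) = one_form (G *v u)" by (simp add: one)
      moreover have "top_coef (\<Phi> * (one_form Yv * (one_form (G *v u) * contract u \<Phi>))) = 0"
      proof -
        have "star u u = - star u u" by (rule star_swap)
        then have "star u u $ i = - (star u u $ i)" for i by (metis vector_uminus_component)
        then have "star u u = 0" by (simp add: vec_eq_iff)
        then have "top_coef (contract u \<Phi> * (\<Phi> * (one_form (G *v u) * one_form Yv))) = 0"
          using star[of Yv u u] by (simp add: mult.assoc)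
        then have "top_coef (contract u \<Phi> * (\<Phi> * (one_form Yv * one_form (G *v u)))) = 0"
          using odd_anticommute[OF one_form_odd one_form_odd, of "G *v u" Yv] by simp
        then show ?thesis
          using even_form_commute[OF even_omega, of u "\<Phi> * (one_form Yv * one_form (G *v u))"]
          by (simp add: mult.assoc)
      qed
      ultimately show ?thesis by simp
    qed
    then have "Z = 0"
      using Z vol7_nonzero unfolding top_coef_expand[of dx, OF one_form_odd] top_coef_expand[of \<delta>, OF \<delta>_odd]
      by (auto simp: vol7_def)
    then show ?thesis using total by simp
  qed
  have "H (axis j 1) = 0"
    by (rule symmetric_part_unique[of H \<psi>]) (use H_sym H_lin E psi in \<open>simp_all add: E_def\<close>)
  then have "G *v H (axis j 1) = 0" by simp
  then have "(hM *v axis j 1) $ i = 0" by (simp add: H_def)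
  then show ?thesis
    by (simp add: hM_def matrix_vector_mult_def sum_mult_axis)
qed

section \<open>Smooth functions on open sets\<close>

lemma pd_eqI: "(F has_derivative D) (at x) \<Longrightarrow> pd i F x = D (axis i 1)"
  by (simp add: pd_def frechet_derivative_at[symmetric])

lemma differentiable_imp_pd:
  "F differentiable (at x) \<Longrightarrow> (F has_derivative frechet_derivative F (at x)) (at x)"
  by (simp add: frechet_derivative_works)

lemma pd_const [simp]: "pd i (\<lambda>z. c) x = 0"
  by (rule trans[OF pd_eqI[OF has_derivative_const]]) simp

lemma pd_add:
  assumes "F differentiable (at x)" "G differentiable (at x)"
  shows "pd i (\<lambda>z. F z + G z) x = pd i F x + pd i G x"
  using pd_eqI[OF has_derivative_add[OF assms[THEN differentiable_imp_pd]]] by (simp add: pd_def)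

lemma pd_diff:
  assumes "F differentiable (at x)" "G differentiable (at x)"
  shows "pd i (\<lambda>z. F z - G z) x = pd i F x - pd i G x"
  using pd_eqI[OF has_derivative_diff[OF assms[THEN differentiable_imp_pd]]] by (simp add: pd_def)

lemma pd_mult:
  assumes "F differentiable (at x)" "G differentiable (at x)"
  shows "pd i (\<lambda>z. F z * G z) x = pd i F x * G x + F x * pd i G x"
  using pd_eqI[OF has_derivative_mult[OF assms[THEN differentiable_imp_pd]]] by (simp add: pd_def)

lemma pd_cmult:
  assumes "F differentiable (at x)"
  shows "pd i (\<lambda>z. c * F z) x = c * pd i F x"
  using pd_mult[OF differentiable_const assms, of i c] by simp

lemma pd_sum:
  assumes "\<And>a. a \<in> A \<Longrightarrow> F a differentiable (at x)"
  shows "pd i (\<lambda>z. \<Sum>a\<in>A. F a z) x = (\<Sum>a\<in>A. pd i (F a) x)"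
proof -
  have "((\<lambda>z. \<Sum>a\<in>A. F a z) has_derivative (\<lambda>h. \<Sum>a\<in>A. frechet_derivative (F a) (at x) h)) (at x)"
    using assms by (intro has_derivative_sum differentiable_imp_pd)
  from pd_eqI[OF this] show ?thesis by (simp add: pd_def)
qed

lemma pd_inverse:
  assumes "F differentiable (at x)" "F x \<noteq> 0"
  shows "pd i (\<lambda>z. inverse (F z)) x = - (inverse (F x) * pd i F x * inverse (F x))"
  using pd_eqI[OF Deriv.has_derivative_inverse[OF assms(2) differentiable_imp_pd[OF assms(1)]]]
  by (simp add: pd_def)

text \<open>
  Differentiability of all iterated partial derivatives of order at most \<open>k\<close>, by recursion on the order, so that
  closure properties can be proved by induction.
\<close>
primrec Ck :: "R7 set \<Rightarrow> nat \<Rightarrow> (R7 \<Rightarrow> real) \<Rightarrow> bool" where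
  "Ck V 0 F \<longleftrightarrow> F differentiable_on V"
| "Ck V (Suc k) F \<longleftrightarrow> F differentiable_on V \<and> (\<forall>i. Ck V k (pd i F))"

lemma Ck_iff: "Ck V k F \<longleftrightarrow> (\<forall>is. length is \<le> k \<longrightarrow> foldr pd is F differentiable_on V)"
proof (induction k arbitrary: F)
  case (Suc k)
  show ?case
  proof
    assume *: "Ck V (Suc k) F"
    show "\<forall>is. length is \<le> Suc k \<longrightarrow> foldr pd is F differentiable_on V"
    proof (intro allI impI)
      fix "is" :: "7 list" assume "length is \<le> Suc k"
      then show "foldr pd is F differentiable_on V"
        using * Suc by (cases "is" rule: rev_cases) auto
    qed
  next
    assume *: "\<forall>is. length is \<le> Suc k \<longrightarrow> foldr pd is F differentiable_on V"
    have "foldr pd is (pd i F) differentiable_on V" if "length is \<le> k" for "is" i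
      using *[rule_format, of "is @ [i]"] that by simp
    then show "Ck V (Suc k) F" using Suc *[rule_format, of "[]"] by simp
  qed
qed simp

lemma smooth_on_iff_Ck: "smooth_on V F \<longleftrightarrow> (\<forall>k. Ck V k F)"
  unfolding smooth_on_def Ck_iff by auto

lemma Ck_differentiable: "Ck V k F \<Longrightarrow> F differentiable_on V"
  by (cases k) auto

lemma Ck_Suc_imp: "Ck V (Suc k) F \<Longrightarrow> Ck V k F"
  by (induction k arbitrary: F) auto

context
  fixes V :: "R7 set"
  assumes V: "open V"
begin

lemma diff_on: "F differentiable_on V \<longleftrightarrow> (\<forall>x\<in>V. F differentiable (at x))"
  using V by (simp add: differentiable_on_eq_differentiable_at)

lemma differentiable_on_cong:
  assumes "F differentiable_on V" "\<And>z. z \<in> V \<Longrightarrow> F z = G z"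
  shows "G differentiable_on V"
  unfolding diff_on
proof
  fix x assume x: "x \<in> V"
  then obtain D where "(F has_derivative D) (at x)"
    using assms(1) by (auto simp: diff_on differentiable_def)
  then have "(G has_derivative D) (at x)"
    using has_derivative_transform_within_open[of F D x UNIV V G] V x assms(2) by auto
  then show "G differentiable (at x)" by (auto simp: differentiable_def)
qed

lemma Ck_cong:
  assumes "Ck V k F" "\<And>z. z \<in> V \<Longrightarrow> F z = G z"
  shows "Ck V k G"
  using assms
proof (induction k arbitrary: F G)
  case 0
  then show ?case using differentiable_on_cong[of F G] by simp
next
  case (Suc k)
  have "G differentiable_on V" using Suc.prems differentiable_on_cong[of F G] by simp
  moreover have "Ck V k (pd i G)" for i
  proof (rule Suc.IH)
    show "Ck V k (pd i F)" using Suc.prems(1) by simp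
    show "pd i F z = pd i G z" if "z \<in> V" for z
      using pd_cong[OF V that, of F G i] Suc.prems(2) by simp
  qed
  ultimately show ?case by simp
qed

lemma Ck_const: "Ck V k (\<lambda>z. c)"
proof (induction k arbitrary: c)
  case (Suc k)
  have "pd i (\<lambda>z. c) = (\<lambda>z. 0)" for i by (rule ext) simp
  then show ?case using Suc by simp
qed simp

lemma Ck_add: "Ck V k F \<Longrightarrow> Ck V k G \<Longrightarrow> Ck V k (\<lambda>z. F z + G z)"
proof (induction k arbitrary: F G)
  case (Suc k)
  have d: "F differentiable (at z)" "G differentiable (at z)" if "z \<in> V" for z
    using Suc.prems that by (auto simp: diff_on)
  have "Ck V k (\<lambda>z. pd i F z + pd i G z)" for i
    using Suc.prems by (intro Suc.IH) simp_all
  then have "Ck V k (pd i (\<lambda>z. F z + G z))" for i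
    by (rule Ck_cong) (simp add: pd_add d)
  then show ?case using d by (simp add: diff_on)
qed (simp add: diff_on)

lemma Ck_mult: "Ck V k F \<Longrightarrow> Ck V k G \<Longrightarrow> Ck V k (\<lambda>z. F z * G z)"
proof (induction k arbitrary: F G)
  case (Suc k)
  have d: "F differentiable (at z)" "G differentiable (at z)" if "z \<in> V" for z
    using Suc.prems that by (auto simp: diff_on)
  have "Ck V k (\<lambda>z. pd i F z * G z + F z * pd i G z)" for i
    using Suc.prems Ck_Suc_imp[OF Suc.prems(1)] Ck_Suc_imp[OF Suc.prems(2)]
    by (intro Ck_add Suc.IH) simp_all
  then have "Ck V k (pd i (\<lambda>z. F z * G z))" for i
    by (rule Ck_cong) (simp add: pd_mult d)
  then show ?case using d by (simp add: diff_on)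
qed (simp add: diff_on)

lemma Ck_inverse: "Ck V k F \<Longrightarrow> (\<And>z. z \<in> V \<Longrightarrow> F z \<noteq> 0) \<Longrightarrow> Ck V k (\<lambda>z. inverse (F z))"
proof (induction k)
  case (Suc k)
  have d: "F differentiable (at z)" if "z \<in> V" for z
    using Suc.prems that by (auto simp: diff_on)
  have inv: "Ck V k (\<lambda>z. inverse (F z))" by (rule Suc.IH[OF Ck_Suc_imp[OF Suc.prems(1)] Suc.prems(2)])
  have "Ck V k (\<lambda>z. - 1 * (inverse (F z) * pd i F z * inverse (F z)))" for i
    using Suc.prems(1) by (intro Ck_mult Ck_const inv) simp
  then have "Ck V k (pd i (\<lambda>z. inverse (F z)))" for i
    by (rule Ck_cong) (simp add: pd_inverse d Suc.prems(2))
  then show ?case using d Suc.prems(2) by (simp add: diff_on)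
qed (simp add: diff_on)

lemma smooth_on_const [simp]: "smooth_on V (\<lambda>z. c)"
  by (simp add: smooth_on_iff_Ck Ck_const)

lemma smooth_on_add: "smooth_on V F \<Longrightarrow> smooth_on V G \<Longrightarrow> smooth_on V (\<lambda>z. F z + G z)"
  by (simp add: smooth_on_iff_Ck Ck_add)

lemma smooth_on_mult: "smooth_on V F \<Longrightarrow> smooth_on V G \<Longrightarrow> smooth_on V (\<lambda>z. F z * G z)"
  by (simp add: smooth_on_iff_Ck Ck_mult)

lemma smooth_on_diff: "smooth_on V F \<Longrightarrow> smooth_on V G \<Longrightarrow> smooth_on V (\<lambda>z. F z - G z)"
proof -
  assume F: "smooth_on V F" and G: "smooth_on V G"
  have "smooth_on V (\<lambda>z. F z + - 1 * G z)"
    by (intro smooth_on_add smooth_on_mult smooth_on_const F G)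
  then show ?thesis by simp
qed

lemma smooth_on_divide:
  "smooth_on V F \<Longrightarrow> smooth_on V G \<Longrightarrow> (\<And>z. z \<in> V \<Longrightarrow> G z \<noteq> 0) \<Longrightarrow> smooth_on V (\<lambda>z. F z / G z)"
  by (simp add: smooth_on_iff_Ck Ck_mult Ck_inverse divide_inverse)

lemma smooth_on_sum: "(\<And>a. a \<in> A \<Longrightarrow> smooth_on V (F a)) \<Longrightarrow> smooth_on V (\<lambda>z. \<Sum>a\<in>A. F a z)"
  by (induction A rule: infinite_finite_induct) (simp_all add: smooth_on_add)

lemma smooth_on_prod: "(\<And>a. a \<in> A \<Longrightarrow> smooth_on V (F a)) \<Longrightarrow> smooth_on V (\<lambda>z. \<Prod>a\<in>A. F a z)"
  by (induction A rule: infinite_finite_induct) (simp_all add: smooth_on_mult)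

lemma smooth_on_cong: "smooth_on V F \<Longrightarrow> (\<And>z. z \<in> V \<Longrightarrow> F z = G z) \<Longrightarrow> smooth_on V G"
  unfolding smooth_on_iff_Ck using Ck_cong[of _ F G] by blast

end

lemma smooth_on_pd: "smooth_on V F \<Longrightarrow> smooth_on V (pd i F)"
  unfolding smooth_on_iff_Ck using Ck.simps(2) by blast

lemma smooth_on_differentiable: "smooth_on V F \<Longrightarrow> open V \<Longrightarrow> x \<in> V \<Longrightarrow> F differentiable (at x)"
  unfolding smooth_on_iff_Ck using diff_on[of V F] Ck_differentiable[of V 0 F] by blast

lemma smooth_on_det:
  assumes "open V" "\<And>a b. smooth_on V (\<lambda>z. A z a b)"
  shows "smooth_on V (\<lambda>z. det (\<chi> a b. A z a b :: real ^ 7 ^ 7))"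
  unfolding det_def vec_lambda_beta
  by (intro smooth_on_sum[OF assms(1)] smooth_on_mult[OF assms(1)] smooth_on_prod[OF assms(1)]
      smooth_on_const[OF assms(1)] assms(2))

lemma line_derivative:
  assumes "F differentiable (at (y + t *\<^sub>R axis i 1))"
  shows "((\<lambda>t. F (y + t *\<^sub>R axis i 1)) has_real_derivative pd i F (y + t *\<^sub>R axis i 1)) (at t)"
proof -
  let ?D = "frechet_derivative F (at (y + t *\<^sub>R axis i 1))"
  have D: "(F has_derivative ?D) (at (y + t *\<^sub>R axis i 1))"
    using assms by (rule differentiable_imp_pd)
  have "((\<lambda>t. F (y + t *\<^sub>R axis i 1)) has_derivative (\<lambda>h. ?D (h *\<^sub>R axis i 1))) (at t)"
    by (rule has_derivative_compose[where f = "\<lambda>t. y + t *\<^sub>R axis i 1", OF _ D])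
      (auto intro!: derivative_eq_intros)
  moreover have "(\<lambda>h. ?D (h *\<^sub>R axis i 1)) = (*) (?D (axis i 1))"
    by (rule ext) (simp add: linear_cmul[OF has_derivative_linear[OF D]] mult.commute)
  ultimately show ?thesis
    unfolding has_field_derivative_def pd_def by simp
qed

text \<open>
  The mean value theorem in the direction \<open>i\<close> and then in the direction \<open>j\<close>.
\<close>
lemma second_difference:
  assumes F: "smooth_on V F" "open V" and h: "0 < h" "\<And>y. dist x y \<le> 2 * h \<Longrightarrow> y \<in> V"
  obtains p where "dist x p \<le> 2 * h"
    "F (x + h *\<^sub>R axis i 1 + h *\<^sub>R axis j 1) - F (x + h *\<^sub>R axis i 1) - F (x + h *\<^sub>R axis j 1) + F x
     = h * (h * pd j (pd i F) p)"
proof -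
  let ?a = "axis i 1 :: R7" and ?b = "axis j 1 :: R7"
  have near: "dist x (x + s *\<^sub>R ?a + t *\<^sub>R ?b) \<le> 2 * h" if "0 \<le> s" "s \<le> h" "0 \<le> t" "t \<le> h" for s t
  proof -
    have "norm (s *\<^sub>R ?a + t *\<^sub>R ?b) \<le> norm (s *\<^sub>R ?a) + norm (t *\<^sub>R ?b)" by (rule norm_triangle_ineq)
    then show ?thesis using that by (simp add: dist_norm norm_minus_commute algebra_simps)
  qed
  have d: "F differentiable (at (x + s *\<^sub>R ?a + t *\<^sub>R ?b))" "pd i F differentiable (at (x + s *\<^sub>R ?a + t *\<^sub>R ?b))"
    if "0 \<le> s" "s \<le> h" "0 \<le> t" "t \<le> h" for s t
    using smooth_on_differentiable[OF F(1,2) h(2)[OF near[OF that]]]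
      smooth_on_differentiable[OF smooth_on_pd[OF F(1)] F(2) h(2)[OF near[OF that]]] by auto
  define u where "u s = F (x + h *\<^sub>R ?b + s *\<^sub>R ?a) - F (x + s *\<^sub>R ?a)" for s
  have "(u has_real_derivative (pd i F (x + h *\<^sub>R ?b + s *\<^sub>R ?a) - pd i F (x + s *\<^sub>R ?a))) (at s)"
    if "0 \<le> s" "s \<le> h" for s
    unfolding u_def
    using that d(1)[of s h] d(1)[of s 0] h(1)
    by (intro DERIV_diff line_derivative) (simp_all add: add_ac)
  then obtain s where s: "0 < s" "s < h" "u h - u 0 = (h - 0) * (pd i F (x + h *\<^sub>R ?b + s *\<^sub>R ?a) - pd i F (x + s *\<^sub>R ?a))"
    using MVT2[of 0 h u "\<lambda>s. pd i F (x + h *\<^sub>R ?b + s *\<^sub>R ?a) - pd i F (x + s *\<^sub>R ?a)"] h(1) by blast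
  define v where "v t = pd i F (x + s *\<^sub>R ?a + t *\<^sub>R ?b)" for t
  have "(v has_real_derivative pd j (pd i F) (x + s *\<^sub>R ?a + t *\<^sub>R ?b)) (at t)"
    if "0 \<le> t" "t \<le> h" for t
    unfolding v_def using that d(2)[of s t] s by (intro line_derivative) simp_all
  then obtain t where t: "0 < t" "t < h" "v h - v 0 = (h - 0) * pd j (pd i F) (x + s *\<^sub>R ?a + t *\<^sub>R ?b)"
    using MVT2[of 0 h v "\<lambda>t. pd j (pd i F) (x + s *\<^sub>R ?a + t *\<^sub>R ?b)"] h(1) by blast
  show ?thesis
  proof (rule that)
    show "dist x (x + s *\<^sub>R ?a + t *\<^sub>R ?b) \<le> 2 * h" using near s t by simp
    show "F (x + h *\<^sub>R ?a + h *\<^sub>R ?b) - F (x + h *\<^sub>R ?a) - F (x + h *\<^sub>R ?b) + F x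
        = h * (h * pd j (pd i F) (x + s *\<^sub>R ?a + t *\<^sub>R ?b))"
      using s(3) t(3) by (simp add: u_def v_def add_ac)
  qed
qed

text \<open>
  The second difference is symmetric in \<open>i\<close> and \<open>j\<close>, so \<open>\<partial>\<^sub>j\<partial>\<^sub>iF\<close> and \<open>\<partial>\<^sub>i\<partial>\<^sub>jF\<close> take a common value at points arbitrarily
  near \<open>x\<close>; both are continuous.
\<close>
lemma pd_commute:
  assumes F: "smooth_on V F" "open V" "x \<in> V"
  shows "pd i (pd j F) x = pd j (pd i F) x"
proof (rule ccontr)
  let ?A = "pd j (pd i F)" and ?B = "pd i (pd j F)"
  assume ne: "?B x \<noteq> ?A x"
  \<comment> \<open>half the assumed gap between the two mixed derivatives\<close>
  define e where "e = \<bar>?A x - ?B x\<bar> / 2"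
  have e: "e > 0" using ne by (simp add: e_def)
  have cont: "isCont ?A x" "isCont ?B x"
    by (rule differentiable_imp_continuous_within,
        rule smooth_on_differentiable[OF smooth_on_pd[OF smooth_on_pd[OF F(1)]] F(2,3)])+
  obtain r where r: "r > 0" "ball x r \<subseteq> V" using F(2,3) open_contains_ball by blast
  obtain d1 where d1: "d1 > 0" "\<And>y. dist y x < d1 \<Longrightarrow> dist (?A y) (?A x) < e"
    using cont(1) e unfolding continuous_at_eps_delta by blast
  obtain d2 where d2: "d2 > 0" "\<And>y. dist y x < d2 \<Longrightarrow> dist (?B y) (?B x) < e"
    using cont(2) e unfolding continuous_at_eps_delta by blast
  define h where "h = min r (min d1 d2) / 3"
  have h: "h > 0" "2 * h < r" "2 * h < d1" "2 * h < d2" using r d1 d2 by (auto simp: h_def)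
  have inV: "y \<in> V" if "dist x y \<le> 2 * h" for y using that h(2) r(2) by (meson in_mono le_less_trans mem_ball)
  obtain p where p: "dist x p \<le> 2 * h"
    "F (x + h *\<^sub>R axis i 1 + h *\<^sub>R axis j 1) - F (x + h *\<^sub>R axis i 1) - F (x + h *\<^sub>R axis j 1) + F x = h * (h * ?A p)"
    using second_difference[OF F(1,2) h(1) inV] by blast
  obtain q where q: "dist x q \<le> 2 * h"
    "F (x + h *\<^sub>R axis j 1 + h *\<^sub>R axis i 1) - F (x + h *\<^sub>R axis j 1) - F (x + h *\<^sub>R axis i 1) + F x = h * (h * ?B q)"
    using second_difference[OF F(1,2) h(1) inV] by blast
  have flip: "x + h *\<^sub>R axis i 1 + h *\<^sub>R axis j 1 = x + h *\<^sub>R axis j 1 + h *\<^sub>R axis i 1"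
    by (simp add: add_ac)
  have "h * (h * ?A p) = h * (h * ?B q)" using p(2)[unfolded flip] q(2) by linarith
  then have pq: "?A p = ?B q" using h(1) by simp
  have "dist (?A p) (?A x) < e" "dist (?B q) (?B x) < e"
    using d1(2)[of p] d2(2)[of q] p(1) q(1) h(3,4) dist_commute[of x p] dist_commute[of x q] by linarith+
  then have "\<bar>?A x - ?B x\<bar> < e + e"
    using abs_triangle_ineq4[of "?A p - ?B x" "?A p - ?A x"] pq by (simp add: dist_real_def)
  then show False by (simp add: e_def)
qed

section \<open>The Levi-Civita connection and its curvature in a chart\<close>

locale metric_chart =
  fixes V :: "R7 set" and g :: cov2
  assumes V: "open V"
    and g_smooth: "\<And>i j. smooth_on V (\<lambda>x. g x i j)"
    and g_sym: "\<And>x i j. x \<in> V \<Longrightarrow> g x i j = g x j i"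
    and g_pos: "\<And>x v. x \<in> V \<Longrightarrow> v \<noteq> 0 \<Longrightarrow> (\<Sum>:i j. g x i j * (v :: R7) $ i * v $ j) > 0"
begin

abbreviation gi where "gi \<equiv> ginv g"
abbreviation \<Gamma> where "\<Gamma> \<equiv> christoffel g"

lemmas smooth_intros = smooth_on_add[OF V] smooth_on_diff[OF V] smooth_on_mult[OF V] smooth_on_const[OF V]
  smooth_on_sum[OF V] smooth_on_divide[OF V] smooth_on_pd

lemma smooth_diff: "x \<in> V \<Longrightarrow> smooth_on V F \<Longrightarrow> F differentiable (at x)"
  using smooth_on_differentiable V by blast

lemma G_invertible: assumes x: "x \<in> V" shows "invertible ((\<chi> a b. g x a b) :: real ^ 7 ^ 7)"
proof -
  let ?G = "(\<chi> a b. g x a b) :: real ^ 7 ^ 7"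
  have "v = 0" if v: "?G *v v = 0" for v :: R7
  proof (rule ccontr)
    assume "v \<noteq> 0"
    then have "(\<Sum>:i j. g x i j * v $ i * v $ j) > 0" using g_pos x by blast
    moreover have "(\<Sum>:i j. g x i j * v $ i * v $ j) = v \<bullet> (?G *v v)"
      by (simp add: inner_vec_def matrix_vector_mult_def sum_distrib_left mult_ac)
    ultimately show False using v by simp
  qed
  then show ?thesis using matrix_left_invertible_ker invertible_left_inverse by blast
qed

lemma inverse_metric:
  assumes x: "x \<in> V"
  shows "(\<Sum>:p. g x i p * gi x p j) = (if i = j then 1 else 0)"
    and "(\<Sum>:p. gi x i p * g x p j) = (if i = j then 1 else 0)"
    and "gi x i j = gi x j i"
proof -
  let ?G = "(\<chi> a b. g x a b) :: real ^ 7 ^ 7"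
  have GI: "?G ** matrix_inv ?G = mat 1 \<and> matrix_inv ?G ** ?G = mat 1"
    using G_invertible[OF x] unfolding invertible_def matrix_inv_def by (rule someI2_ex) blast
  have 1: "(\<Sum>:p. g x i p * gi x p j) = (if i = j then 1 else 0)" for i j
    using arg_cong[OF GI[THEN conjunct1], of "\<lambda>M. M $ i $ j"] by (simp add: matrix_matrix_mult_def mat_def ginv_def)
  have 2: "(\<Sum>:p. gi x i p * g x p j) = (if i = j then 1 else 0)" for i j
    using arg_cong[OF GI[THEN conjunct2], of "\<lambda>M. M $ i $ j"] by (simp add: matrix_matrix_mult_def mat_def ginv_def)
  show "(\<Sum>:p. g x i p * gi x p j) = (if i = j then 1 else 0)"
    and "(\<Sum>:p. gi x i p * g x p j) = (if i = j then 1 else 0)" by (fact 1, fact 2)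
  have "(\<Sum>:q. gi x i q * (\<Sum>:p. g x q p * gi x j p)) = gi x i j"
  proof -
    have "(\<Sum>:p. g x q p * gi x j p) = (if j = q then 1 else 0)" for q
    proof -
      have "(\<Sum>:p. g x q p * gi x j p) = (\<Sum>:p. gi x j p * g x p q)"
        by (intro sum.cong refl) (simp add: g_sym[OF x, of q])
      then show ?thesis using 2 by simp
    qed
    then show ?thesis by (simp add: if_distrib[of "\<lambda>z. _ * z"] cong: if_cong)
  qed
  moreover have "(\<Sum>:q. gi x i q * (\<Sum>:p. g x q p * gi x j p)) = gi x j i"
  proof -
    have "(\<Sum>:q. gi x i q * (\<Sum>:p. g x q p * gi x j p)) =
        (\<Sum>:q p. gi x i q * g x q p * gi x j p)"
      by (simp only: sum_distrib_left mult.assoc)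
    also have "\<dots> = (\<Sum>:p q. gi x i q * g x q p * gi x j p)" by (rule sum.swap)
    also have "\<dots> = (\<Sum>:p. (if i = p then 1 else 0) * gi x j p)"
      by (simp only: sum_distrib_right[symmetric] 2)
    finally show ?thesis by (simp add: if_distrib[of "\<lambda>z. z * _"] cong: if_cong)
  qed
  ultimately show "gi x i j = gi x j i" by simp
qed

lemma lower_raise:
  assumes x: "x \<in> V"
  shows "(\<Sum>:p. gi x i p * (\<Sum>:q. g x p q * S q)) = S i"
    and "(\<Sum>:p. g x i p * (\<Sum>:q. gi x p q * S q)) = S i"
proof -
  have *: "(\<Sum>:p. A i p * (\<Sum>:q. B p q * S q)) = S i"
    if "\<And>i j. (\<Sum>:p. A i p * B p j) = (if i = j then 1 else 0)" for A B :: "7 \<Rightarrow> 7 \<Rightarrow> real"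
  proof -
    have "(\<Sum>:p. A i p * (\<Sum>:q. B p q * S q)) = (\<Sum>:p q. A i p * B p q * S q)"
      by (simp only: sum_distrib_left mult.assoc)
    also have "\<dots> = (\<Sum>:q p. A i p * B p q * S q)" by (rule sum.swap)
    also have "\<dots> = (\<Sum>:q. (if i = q then 1 else 0) * S q)"
      by (simp only: sum_distrib_right[symmetric] that)
    finally show ?thesis by (simp add: if_distrib[of "\<lambda>z. z * _"] cong: if_cong)
  qed
  show "(\<Sum>:p. gi x i p * (\<Sum>:q. g x p q * S q)) = S i"
    and "(\<Sum>:p. g x i p * (\<Sum>:q. gi x p q * S q)) = S i"
    by (rule *, rule inverse_metric[OF x])+
qed

text \<open>
  By Cramer's rule the entries of the inverse are quotients of determinants.
\<close>
lemma gi_smooth: "smooth_on V (\<lambda>x. gi x i j)"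
proof -
  let ?G = "\<lambda>x. (\<chi> a b. g x a b) :: real ^ 7 ^ 7"
  let ?N = "\<lambda>x. (\<chi> a b. if b = i then axis j 1 $ a else g x a b) :: real ^ 7 ^ 7"
  have det: "det (?G x) \<noteq> 0" if "x \<in> V" for x
    using G_invertible[OF that] by (simp add: invertible_det_nz)
  have cr: "det (?N x) / det (?G x) = gi x i j" if "x \<in> V" for x
  proof -
    have "?G x *v (\<chi> p. gi x p j) = axis j 1"
      using inverse_metric(1)[OF that] by (simp add: vec_eq_iff matrix_vector_mult_def axis_def)
    then have "(\<chi> p. gi x p j) = (\<chi> k. det (\<chi> a b. if b = k then axis j 1 $ a else ?G x $ a $ b) / det (?G x))"
      using cramer[OF det[OF that]] by blast
    from arg_cong[OF this, of "\<lambda>v. v $ i"] show ?thesis by (simp only: vec_lambda_beta)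
  qed
  have "smooth_on V (\<lambda>x. if b = i then axis j 1 $ a else g x a b)" for a b
    by (cases "b = i") (simp_all add: smooth_intros g_smooth)
  then have "smooth_on V (\<lambda>x. det (?N x) / det (?G x))"
    by (intro smooth_intros smooth_on_det V g_smooth det) auto
  then show ?thesis by (rule smooth_on_cong[OF V]) (rule cr)
qed

lemma Gamma_smooth: "smooth_on V (\<lambda>x. \<Gamma> x k i j)"
  unfolding christoffel_def by (intro smooth_intros gi_smooth g_smooth) simp

lemma Gamma_sym: "x \<in> V \<Longrightarrow> \<Gamma> x k i j = \<Gamma> x k j i"
  using christoffel_torsion_free_metric(1)[OF V, of x g k i j] g_sym G_invertible by simp

lemma pd_g: "x \<in> V \<Longrightarrow> pd m (\<lambda>z. g z i j) x =
    (\<Sum>:p. \<Gamma> x p m i * g x p j) + (\<Sum>:p. \<Gamma> x p m j * g x i p)"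
proof -
  assume x: "x \<in> V"
  have "nabla2 g g x m i j = 0"
    by (rule christoffel_torsion_free_metric(2)[where g = g, OF V x g_sym G_invertible[OF x]])
  then show ?thesis by (simp add: nabla2_def)
qed

text \<open>
  \<open>\<nabla>g\<^sup>-\<^sup>1 = 0\<close>, from differentiating \<open>g g\<^sup>-\<^sup>1 = 1\<close>.
\<close>
lemma pd_gi:
  assumes x: "x \<in> V"
  shows "pd m (\<lambda>z. gi z k j) x = - (\<Sum>:p. \<Gamma> x k m p * gi x p j) - (\<Sum>:p. \<Gamma> x j m p * gi x k p)"
proof -
  note d = smooth_diff[OF x g_smooth] smooth_diff[OF x gi_smooth]
  have *: "(\<Sum>:p. g x i p * pd m (\<lambda>z. gi z p j) x) = - (\<Sum>:p. pd m (\<lambda>z. g z i p) x * gi x p j)" for i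
  proof -
    have "pd m (\<lambda>z. \<Sum>:p. g z i p * gi z p j) x = pd m (\<lambda>z. if i = j then 1 else 0) x"
      by (rule pd_cong[OF V x]) (rule inverse_metric)
    also have "\<dots> = 0" by simp
    finally have "(\<Sum>:p. pd m (\<lambda>z. g z i p) x * gi x p j + g x i p * pd m (\<lambda>z. gi z p j) x) = 0"
      by (simp add: pd_sum pd_mult d differentiable_mult)
    then show ?thesis by (simp add: sum.distrib)
  qed
  have "pd m (\<lambda>z. gi z k j) x = (\<Sum>:i. gi x k i * (\<Sum>:p. g x i p * pd m (\<lambda>z. gi z p j) x))"
    by (rule lower_raise(1)[OF x, symmetric])
  also have "\<dots> = - (\<Sum>:i. gi x k i * (\<Sum>:p. pd m (\<lambda>z. g z i p) x * gi x p j))"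
    unfolding * by (simp add: sum_negf)
  also have "(\<Sum>:i. gi x k i * (\<Sum>:p. pd m (\<lambda>z. g z i p) x * gi x p j)) =
      (\<Sum>:p. \<Gamma> x k m p * gi x p j) + (\<Sum>:p. \<Gamma> x j m p * gi x k p)"
  proof -
    have "(\<Sum>:p. (\<Sum>:q. \<Gamma> x q m i * g x q p) * gi x p j) = \<Gamma> x j m i" for i
    proof -
      have "(\<Sum>:p. (\<Sum>:q. \<Gamma> x q m i * g x q p) * gi x p j) =
          (\<Sum>:p. gi x j p * (\<Sum>:q. g x p q * \<Gamma> x q m i))"
        by (intro sum.cong refl) (simp add: inverse_metric(3)[OF x, of _ j] g_sym[OF x, of _ p for p] mult.commute)
      then show ?thesis using lower_raise(1)[OF x, of j "\<lambda>q. \<Gamma> x q m i"] by simp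
    qed
    moreover have "(\<Sum>:i. gi x k i * (\<Sum>:p. (\<Sum>:q. \<Gamma> x q m p * g x i q) * gi x p j)) =
        (\<Sum>:p. \<Gamma> x k m p * gi x p j)"
    proof -
      have "(\<Sum>:p. (\<Sum>:q. \<Gamma> x q m p * g x i q) * gi x p j) =
          (\<Sum>:q. g x i q * (\<Sum>:p. \<Gamma> x q m p * gi x p j))" for i
        unfolding sum_distrib_left sum_distrib_right by (subst sum.swap) (simp only: mult_ac)
      then show ?thesis using lower_raise(1)[OF x, of k "\<lambda>q. \<Sum>:p. \<Gamma> x q m p * gi x p j"] by simp
    qed
    ultimately show ?thesis
      by (simp add: pd_g[OF x] distrib_left distrib_right sum.distrib mult.commute)
  qed
  finally show ?thesis by simp
qed

text \<open>
  Contraction commutes with the covariant derivative.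
\<close>
lemma pd_contr:
  assumes x: "x \<in> V" and S: "\<And>i j. smooth_on V (\<lambda>z. S z i j)"
  shows "pd j (\<lambda>z. contr g z (S z)) x = contr g x (\<lambda>m k. nabla2 g S x j m k)"
proof -
  note d = smooth_diff[OF x gi_smooth] smooth_diff[OF x S]
  have "pd j (\<lambda>z. contr g z (S z)) x =
      (\<Sum>:m k. pd j (\<lambda>z. gi z m k) x * S x m k + gi x m k * pd j (\<lambda>z. S z m k) x)"
    unfolding contr_def by (simp add: pd_sum pd_mult d differentiable_mult differentiable_sum)
  also have "\<dots> = (\<Sum>:m k. gi x m k * pd j (\<lambda>z. S z m k) x)
     - (\<Sum>:m k p. \<Gamma> x m j p * gi x p k * S x m k)
     - (\<Sum>:m k p. \<Gamma> x k j p * gi x m p * S x m k)"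
    by (simp add: pd_gi[OF x] sum.distrib left_diff_distrib sum_subtractf sum_negf sum_distrib_right)
  also have "(\<Sum>:m k p. \<Gamma> x m j p * gi x p k * S x m k)
     = (\<Sum>:p k m. \<Gamma> x m j p * gi x p k * S x m k)"
  proof -
    have "(\<Sum>:m k p. \<Gamma> x m j p * gi x p k * S x m k)
       = (\<Sum>:m p k. \<Gamma> x m j p * gi x p k * S x m k)"
      by (rule sum.cong[OF refl sum.swap])
    also have "\<dots> = (\<Sum>:p m k. \<Gamma> x m j p * gi x p k * S x m k)" by (rule sum.swap)
    also have "\<dots> = (\<Sum>:p k m. \<Gamma> x m j p * gi x p k * S x m k)"
      by (rule sum.cong[OF refl sum.swap])
    finally show ?thesis .
  qed
  also have "(\<Sum>:m k p. \<Gamma> x k j p * gi x m p * S x m k)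
     = (\<Sum>:m p k. \<Gamma> x k j p * gi x m p * S x m k)"
    by (rule sum.cong[OF refl sum.swap])
  finally show ?thesis
    unfolding contr_def nabla2_def
    by (simp add: right_diff_distrib sum_subtractf sum_distrib_left mult_ac)
qed

abbreviation R where "R \<equiv> riemann g"

definition lowered :: "R7 \<Rightarrow> 7 \<Rightarrow> 7 \<Rightarrow> 7 \<Rightarrow> 7 \<Rightarrow> real" where
  "lowered x l k i j = (\<Sum>:a. g x l a * R x a k i j)"

lemma riemann_smooth: "smooth_on V (\<lambda>x. R x l k i j)"
  unfolding riemann_def by (intro smooth_intros Gamma_smooth)

lemma ricci_smooth: "smooth_on V (\<lambda>x. ricci g x i j)"
  unfolding ricci_def by (intro smooth_intros riemann_smooth)

lemma lowered_smooth: "smooth_on V (\<lambda>x. lowered x l k i j)"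
  unfolding lowered_def by (intro smooth_intros riemann_smooth g_smooth)

lemma riemann_swap: "R x l k i j = - R x l k j i"
  by (simp add: riemann_def sum_subtractf)

lemma riemann_raise: "x \<in> V \<Longrightarrow> R x a k i j = (\<Sum>:l. gi x a l * lowered x l k i j)"
  unfolding lowered_def by (rule lower_raise(1)[symmetric])

lemma bianchi_first:
  assumes x: "x \<in> V"
  shows "R x l k i j + R x l i j k + R x l j k i = 0"
proof -
  have "pd m (\<lambda>z. \<Gamma> z a b c) x = pd m (\<lambda>z. \<Gamma> z a c b) x" for m a b c
    by (rule pd_cong[OF V x]) (rule Gamma_sym)
  from this[of i l j k] this[of j l i k] this[of k l j i] show ?thesis
    using Gamma_sym[OF x, of _ j k] Gamma_sym[OF x, of _ i k] Gamma_sym[OF x, of _ i j]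
    unfolding riemann_def by (simp add: sum_subtractf)
qed

text \<open>
  Write \<open>\<partial>\<^sub>i\<partial>\<^sub>jg\<^sub>k\<^sub>l\<close> in terms of Christoffel symbols, differentiating \<open>\<nabla>g = 0\<close>. Its symmetry in \<open>i, j\<close> is the
  assertion; the terms \<open>C\<close> are already symmetric together.
\<close>
lemma lowered_antisym:
  assumes x: "x \<in> V"
  shows "lowered x l k i j = - lowered x k l i j"
proof -
  note d = smooth_diff[OF x g_smooth] smooth_diff[OF x Gamma_smooth]
  define A where "A i j k l = (\<Sum>:p. pd i (\<lambda>z. \<Gamma> z p j k) x * g x p l)" for i j k l
  define B where "B i j k l = (\<Sum>:p q. \<Gamma> x p j k * \<Gamma> x q i p * g x q l)" for i j k l
  define C where "C i j k l = (\<Sum>:p q. \<Gamma> x p j k * \<Gamma> x q i l * g x p q)" for i j k l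
  have gp: "g x p l = g x l p" for p l by (rule g_sym[OF x])
  have half: "pd i (\<lambda>z. \<Sum>:p. \<Gamma> z p j k * g z p l) x = A i j k l + B i j k l + C i j k l" for i j k l
  proof -
    have "pd i (\<lambda>z. \<Sum>:p. \<Gamma> z p j k * g z p l) x =
        (\<Sum>:p. pd i (\<lambda>z. \<Gamma> z p j k) x * g x p l + \<Gamma> x p j k * pd i (\<lambda>z. g z p l) x)"
      by (simp add: pd_sum pd_mult d differentiable_mult)
    also have "\<dots> = A i j k l + B i j k l + C i j k l"
      unfolding A_def B_def C_def pd_g[OF x] by (simp add: sum.distrib distrib_left sum_distrib_left mult.assoc)
    finally show ?thesis .
  qed
  have half': "pd i (\<lambda>z. \<Sum>:p. \<Gamma> z p j l * g z k p) x = A i j l k + B i j l k + C i j l k" for i j k l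
    unfolding half[symmetric]
  proof (rule pd_cong[OF V x], rule sum.cong[OF refl])
    fix z p assume "z \<in> V"
    then show "\<Gamma> z p j l * g z k p = \<Gamma> z p j l * g z p k" by (simp add: g_sym[of z k p])
  qed
  have second: "pd i (pd j (\<lambda>z. g z k l)) x = A i j k l + B i j k l + C i j k l + A i j l k + B i j l k + C i j l k" for i j
  proof -
    have "pd i (pd j (\<lambda>z. g z k l)) x = pd i (\<lambda>z. (\<Sum>:p. \<Gamma> z p j k * g z p l) + (\<Sum>:p. \<Gamma> z p j l * g z k p)) x"
      by (rule pd_cong[OF V x]) (rule pd_g)
    also have "\<dots> = pd i (\<lambda>z. \<Sum>:p. \<Gamma> z p j k * g z p l) x + pd i (\<lambda>z. \<Sum>:p. \<Gamma> z p j l * g z k p) x"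
      by (rule pd_add) (simp_all add: d differentiable_mult differentiable_sum)
    finally show ?thesis unfolding half half' by simp
  qed
  have C_sym: "C i j l k = C j i k l" for i j k l
  proof -
    have "C i j l k = (\<Sum>:q p. \<Gamma> x p j l * \<Gamma> x q i k * g x p q)"
      unfolding C_def by (rule sum.swap)
    also have "\<dots> = C j i k l" unfolding C_def
    proof (intro sum.cong refl)
      fix p q show "\<Gamma> x p j l * \<Gamma> x q i k * g x p q = \<Gamma> x q i k * \<Gamma> x p j l * g x q p"
        using gp[of p q] by simp
    qed
    finally show ?thesis .
  qed
  have low: "lowered x l k i j = A i j k l - A j i k l + B i j k l - B j i k l" for k l
  proof -
    have B: "(\<Sum>:a. g x l a * (\<Sum>:p. \<Gamma> x a i p * \<Gamma> x p j k)) = B i j k l" for i j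
    proof -
      have "(\<Sum>:a. g x l a * (\<Sum>:p. \<Gamma> x a i p * \<Gamma> x p j k)) =
          (\<Sum>:a p. g x l a * (\<Gamma> x a i p * \<Gamma> x p j k))" by (simp only: sum_distrib_left)
      also have "\<dots> = (\<Sum>:p a. g x l a * (\<Gamma> x a i p * \<Gamma> x p j k))" by (rule sum.swap)
      also have "\<dots> = B i j k l" unfolding B_def
      proof (intro sum.cong refl)
        fix p a show "g x l a * (\<Gamma> x a i p * \<Gamma> x p j k) = \<Gamma> x p j k * \<Gamma> x a i p * g x a l"
          using gp[of l a] by simp
      qed
      finally show ?thesis .
    qed
    have A: "(\<Sum>:a. g x l a * pd i (\<lambda>z. \<Gamma> z a j k) x) = A i j k l" for i j
      unfolding A_def by (intro sum.cong refl) (simp add: gp[of l])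
    show ?thesis
      unfolding lowered_def riemann_def sum_subtractf
      by (simp add: distrib_left right_diff_distrib sum.distrib sum_subtractf A B)
  qed
  have "pd i (pd j (\<lambda>z. g z k l)) x = pd j (pd i (\<lambda>z. g z k l)) x"
    by (rule pd_commute[OF g_smooth V x])
  then have "lowered x l k i j + lowered x k l i j = 0"
    unfolding second low using C_sym[of i j l k] C_sym[of j i l k] by simp
  then show ?thesis by simp
qed

lemma riemann_trace_zero:
  assumes x: "x \<in> V"
  shows "(\<Sum>:a. R x a a i j) = 0"
proof -
  have "(\<Sum>:a. R x a a i j) = (\<Sum>:a l. gi x a l * lowered x l a i j)"
    by (simp only: riemann_raise[OF x])
  moreover have "(\<Sum>:a l. gi x a l * lowered x l a i j) =
      - (\<Sum>:a l. gi x a l * lowered x l a i j)"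
  proof -
    have "(\<Sum>:a l. gi x a l * lowered x l a i j) =
        (\<Sum>:l a. gi x a l * lowered x l a i j)" by (rule sum.swap)
    also have "\<dots> = (\<Sum>:l a. - (gi x l a * lowered x a l i j))"
    proof (intro sum.cong refl)
      fix a l show "gi x a l * lowered x l a i j = - (gi x l a * lowered x a l i j)"
        using lowered_antisym[OF x, of l a i j] inverse_metric(3)[OF x, of a l] by simp
    qed
    finally show ?thesis by (simp only: sum_negf)
  qed
  ultimately show ?thesis by simp
qed

text \<open>
  The trace of the first Bianchi identity; its third term is a trace of an endomorphism that is skew for the metric.
\<close>
lemma ricci_sym:
  assumes x: "x \<in> V"
  shows "ricci g x j k = ricci g x k j"
proof -
  have "(\<Sum>:i. R x i k i j + R x i i j k + R x i j k i) = 0"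
    by (simp only: bianchi_first[OF x] sum.neutral_const)
  moreover have "(\<Sum>:i. R x i j k i) = - ricci g x k j"
    unfolding ricci_def sum_negf[symmetric] by (rule sum.cong[OF refl riemann_swap])
  ultimately show ?thesis
    using riemann_trace_zero[OF x] by (simp add: sum.distrib ricci_def)
qed

text \<open>
  The covariant derivative \<open>\<nabla>\<^sub>mR\<^sup>l\<^sub>k\<^sub>i\<^sub>j\<close>.
\<close>
definition nabla_R :: "R7 \<Rightarrow> 7 \<Rightarrow> 7 \<Rightarrow> 7 \<Rightarrow> 7 \<Rightarrow> 7 \<Rightarrow> real" where
  "nabla_R x m l k i j = pd m (\<lambda>z. R z l k i j) x
     + (\<Sum>:p. \<Gamma> x l m p * R x p k i j) - (\<Sum>:p. \<Gamma> x p m k * R x l p i j)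
     - (\<Sum>:p. \<Gamma> x p m i * R x l k p j) - (\<Sum>:p. \<Gamma> x p m j * R x l k i p)"

lemma nabla_R_swap:
  assumes x: "x \<in> V"
  shows "nabla_R x m l k i j = - nabla_R x m l k j i"
proof -
  have "pd m (\<lambda>z. R z l k i j) x = pd m (\<lambda>z. -1 * R z l k j i) x"
    by (rule pd_cong[OF V x]) (simp add: riemann_swap[of _ l k i j])
  also have "\<dots> = - pd m (\<lambda>z. R z l k j i) x"
    by (subst pd_cmult) (simp_all add: smooth_diff[OF x riemann_smooth])
  finally show ?thesis
    unfolding nabla_R_def riemann_swap[of x _ _ i j] riemann_swap[of x _ _ _ j] riemann_swap[of x _ _ i]
    by (simp add: sum_negf)
qed

text \<open>
  With matrix-valued \<open>\<Gamma>\<^sub>i\<close>, the curvature is \<open>\<partial>\<^sub>i\<Gamma>\<^sub>j - \<partial>\<^sub>j\<Gamma>\<^sub>i + [\<Gamma>\<^sub>i, \<Gamma>\<^sub>j]\<close>. The terms \<open>D2\<close>, \<open>W\<close>, \<open>U\<close>, \<open>T\<close> of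
  \<open>\<partial>\<^sub>mR\<^sub>i\<^sub>j + [\<Gamma>\<^sub>m, R\<^sub>i\<^sub>j]\<close> cancel in the cyclic sum, and so do the terms \<open>Q\<close> of the form indices, by the symmetry of
  \<open>\<Gamma>\<close>.
\<close>
lemma bianchi_second:
  assumes x: "x \<in> V"
  shows "nabla_R x m l k i j + nabla_R x i l k j m + nabla_R x j l k m i = 0"
proof -
  note d = smooth_diff[OF x Gamma_smooth] smooth_diff[OF x smooth_on_pd[OF Gamma_smooth]]
  define D2 where "D2 m i j = pd m (pd i (\<lambda>z. \<Gamma> z l j k)) x" for m i j
  define W where "W m i j = (\<Sum>:p. pd m (\<lambda>z. \<Gamma> z l i p) x * \<Gamma> x p j k)" for m i j
  define U where "U m i j = (\<Sum>:p. \<Gamma> x l m p * pd i (\<lambda>z. \<Gamma> z p j k) x)" for m i j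
  define T where "T m i j = (\<Sum>:p q. \<Gamma> x l m p * (\<Gamma> x p i q * \<Gamma> x q j k))" for m i j
  define Q where "Q m i j = (\<Sum>:p. \<Gamma> x p m i * R x l k p j)" for m i j
  have D2: "D2 m i j = D2 i m j" for m i j
    unfolding D2_def by (rule pd_commute[OF Gamma_smooth V x])
  have Q: "Q m i j = Q i m j" for m i j
    unfolding Q_def by (intro sum.cong refl) (simp add: Gamma_sym[OF x, of _ m i])
  have Q': "(\<Sum>:p. \<Gamma> x p m j * R x l k i p) = - Q m j i" for m i j
    unfolding Q_def sum_negf[symmetric] by (intro sum.cong refl) (simp add: riemann_swap[of x l k i])
  have pdR: "pd m (\<lambda>z. R z l k i j) x = D2 m i j - D2 m j i + (W m i j + U i m j - W m j i - U j m i)" for m i j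
  proof -
    have "pd m (\<lambda>z. R z l k i j) x = D2 m i j - D2 m j i +
        (\<Sum>:p. pd m (\<lambda>z. \<Gamma> z l i p) x * \<Gamma> x p j k + \<Gamma> x l i p * pd m (\<lambda>z. \<Gamma> z p j k) x
           - (pd m (\<lambda>z. \<Gamma> z l j p) x * \<Gamma> x p i k + \<Gamma> x l j p * pd m (\<lambda>z. \<Gamma> z p i k) x))"
      unfolding riemann_def D2_def
      by (simp add: pd_add pd_diff pd_sum pd_mult d differentiable_mult differentiable_sum
          differentiable_diff differentiable_add)
    then show ?thesis by (simp add: W_def U_def sum.distrib sum_subtractf)
  qed
  have GR: "(\<Sum>:p. \<Gamma> x l m p * R x p k i j) = U m i j - U m j i + T m i j - T m j i" for m i j
    unfolding riemann_def U_def T_def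
    by (simp add: sum_subtractf sum.distrib distrib_left right_diff_distrib sum_distrib_left)
  have RG: "(\<Sum>:p. \<Gamma> x p m k * R x l p i j) = W i j m - W j i m + T i j m - T j i m" for m i j
  proof -
    have T': "(\<Sum>:p. \<Gamma> x p m k * (\<Sum>:q. \<Gamma> x l i q * \<Gamma> x q j p)) = T i j m" for i j
    proof -
      have "(\<Sum>:p. \<Gamma> x p m k * (\<Sum>:q. \<Gamma> x l i q * \<Gamma> x q j p)) =
          (\<Sum>:p q. \<Gamma> x l i q * (\<Gamma> x q j p * \<Gamma> x p m k))"
        by (simp only: sum_distrib_left mult_ac)
      also have "\<dots> = T i j m" unfolding T_def by (rule sum.swap)
      finally show ?thesis .
    qed
    have W': "(\<Sum>:p. \<Gamma> x p m k * pd i (\<lambda>z. \<Gamma> z l j p) x) = W i j m" for i j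
      unfolding W_def by (simp only: mult.commute)
    show ?thesis
      unfolding riemann_def
      by (simp add: sum_subtractf sum.distrib distrib_left right_diff_distrib T' W')
  qed
  have "nabla_R x m l k i j = D2 m i j - D2 m j i + (W m i j + U i m j - W m j i - U j m i)
      + (U m i j - U m j i + T m i j - T m j i) - (W i j m - W j i m + T i j m - T j i m) - Q m i j + Q m j i"
    for m i j
    unfolding nabla_R_def pdR GR RG Q' by (simp add: Q_def)
  then show ?thesis
    using D2[of m i j] D2[of i j m] D2[of j m i] Q[of m i j] Q[of i j m] Q[of j m i] by simp
qed

definition nabla_low :: "R7 \<Rightarrow> 7 \<Rightarrow> 7 \<Rightarrow> 7 \<Rightarrow> 7 \<Rightarrow> 7 \<Rightarrow> real" where
  "nabla_low x m b k i j = (\<Sum>:a. g x b a * nabla_R x m a k i j)"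

text \<open>
  As \<open>\<nabla>g = 0\<close>, this is the covariant derivative of the lowered curvature, which has the asserted symmetry at every point.
\<close>
lemma nabla_low_antisym:
  assumes x: "x \<in> V"
  shows "nabla_low x m l k i j = - nabla_low x m k l i j"
proof -
  note d = smooth_diff[OF x g_smooth] smooth_diff[OF x riemann_smooth]
  have eq: "nabla_low x m l k i j = pd m (\<lambda>z. lowered z l k i j) x
     - (\<Sum>:p. \<Gamma> x p m l * lowered x p k i j) - (\<Sum>:p. \<Gamma> x p m k * lowered x l p i j)
     - (\<Sum>:p. \<Gamma> x p m i * lowered x l k p j) - (\<Sum>:p. \<Gamma> x p m j * lowered x l k i p)" for l k
  proof -
    have pull: "(\<Sum>:a. g x l a * (\<Sum>:p. c p * S p a)) = (\<Sum>:p. c p * (\<Sum>:a. g x l a * S p a))"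
      for c :: "7 \<Rightarrow> real" and S
      unfolding sum_distrib_left by (subst sum.swap) (simp only: mult_ac)
    have "pd m (\<lambda>z. lowered z l k i j) x =
        (\<Sum>:a. pd m (\<lambda>z. g z l a) x * R x a k i j + g x l a * pd m (\<lambda>z. R z a k i j) x)"
      unfolding lowered_def by (simp add: pd_sum pd_mult d differentiable_mult)
    also have "\<dots> = (\<Sum>:a. (\<Sum>:p. \<Gamma> x p m l * g x p a) * R x a k i j)
        + (\<Sum>:a. (\<Sum>:p. \<Gamma> x p m a * g x l p) * R x a k i j)
        + (\<Sum>:a. g x l a * pd m (\<lambda>z. R z a k i j) x)"
      by (simp add: pd_g[OF x] sum.distrib distrib_right)
    also have "(\<Sum>:a. (\<Sum>:p. \<Gamma> x p m l * g x p a) * R x a k i j) =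
        (\<Sum>:p. \<Gamma> x p m l * lowered x p k i j)"
      unfolding lowered_def sum_distrib_left sum_distrib_right by (subst sum.swap) (simp only: mult.assoc)
    also have "(\<Sum>:a. (\<Sum>:p. \<Gamma> x p m a * g x l p) * R x a k i j) =
        (\<Sum>:p. g x l p * (\<Sum>:a. \<Gamma> x p m a * R x a k i j))"
      unfolding sum_distrib_left sum_distrib_right by (subst sum.swap) (simp only: mult_ac)
    finally have "pd m (\<lambda>z. lowered z l k i j) x = (\<Sum>:p. \<Gamma> x p m l * lowered x p k i j)
        + (\<Sum>:p. g x l p * (\<Sum>:a. \<Gamma> x p m a * R x a k i j))
        + (\<Sum>:a. g x l a * pd m (\<lambda>z. R z a k i j) x)" .
    then show ?thesis
      unfolding nabla_low_def nabla_R_def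
      by (simp add: distrib_left right_diff_distrib sum.distrib sum_subtractf pull flip: lowered_def)
  qed
  have "pd m (\<lambda>z. lowered z l k i j) x = pd m (\<lambda>z. -1 * lowered z k l i j) x"
    by (rule pd_cong[OF V x]) (simp add: lowered_antisym[of _ l k])
  also have "\<dots> = - pd m (\<lambda>z. lowered z k l i j) x"
    by (subst pd_cmult) (simp_all add: smooth_diff[OF x lowered_smooth])
  finally have 1: "pd m (\<lambda>z. lowered z l k i j) x = - pd m (\<lambda>z. lowered z k l i j) x" .
  have 2: "(\<Sum>:p. c p * lowered x p k i j) = - (\<Sum>:p. c p * lowered x k p i j)" for c :: "7 \<Rightarrow> real" and k
    unfolding sum_negf[symmetric] by (intro sum.cong refl) (simp add: lowered_antisym[OF x, of _ k])
  have 3: "(\<Sum>:p. c p * lowered x l k (F p) (F' p)) = - (\<Sum>:p. c p * lowered x k l (F p) (F' p))"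
    for c :: "7 \<Rightarrow> real" and F F'
    unfolding sum_negf[symmetric] by (intro sum.cong refl) (simp add: lowered_antisym[OF x, of l k])
  show ?thesis
    unfolding eq 1 using 2[of "\<lambda>p. \<Gamma> x p m l" k] 2[of "\<lambda>p. \<Gamma> x p m k" l]
      3[of "\<lambda>p. \<Gamma> x p m i" "\<lambda>p. p" "\<lambda>p. j"] 3[of "\<lambda>p. \<Gamma> x p m j" "\<lambda>p. i" "\<lambda>p. p"]
    by linarith
qed

lemma trace_nabla_R:
  assumes x: "x \<in> V"
  shows "(\<Sum>:l. nabla_R x m l k l j) = nabla2 g (ricci g) x m j k"
proof -
  have "pd m (\<lambda>z. ricci g z j k) x = (\<Sum>:l. pd m (\<lambda>z. R z l k l j) x)"
    unfolding ricci_def by (simp add: pd_sum smooth_diff[OF x riemann_smooth])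
  moreover have "(\<Sum>:l p. \<Gamma> x p m l * R x l k p j) = (\<Sum>:l p. \<Gamma> x l m p * R x p k l j)"
    by (rule sum.swap)
  moreover have "(\<Sum>:l p. \<Gamma> x p m k * R x l p l j) = (\<Sum>:p. \<Gamma> x p m k * ricci g x j p)"
    unfolding ricci_def sum_distrib_left by (rule sum.swap)
  moreover have "(\<Sum>:l p. \<Gamma> x p m j * R x l k l p) = (\<Sum>:p. \<Gamma> x p m j * ricci g x p k)"
    unfolding ricci_def sum_distrib_left by (rule sum.swap)
  ultimately show ?thesis
    unfolding nabla_R_def nabla2_def by (simp add: sum.distrib sum_subtractf)
qed

lemma nabla2_sym:
  assumes x: "x \<in> V" and S: "\<And>z i j. z \<in> V \<Longrightarrow> S z i j = S z j i"
  shows "nabla2 g S x m i j = nabla2 g S x m j i"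
proof -
  have "pd m (\<lambda>z. S z i j) x = pd m (\<lambda>z. S z j i) x"
    by (rule pd_cong[OF V x]) (rule S)
  moreover have "(\<Sum>:p. c p * S x p k) = (\<Sum>:p. c p * S x k p)" for c :: "7 \<Rightarrow> real" and k
    by (simp only: S[OF x, of _ k])
  ultimately show ?thesis unfolding nabla2_def by (simp only:)
qed

text \<open>
  For a tensor that is skew in its first two lowered indices, the contraction of the last two indices is minus
  that of the first and the last. This converts the traces of curvature terms into Ricci terms.
\<close>
lemma trace_raise:
  assumes x: "x \<in> V" and C: "\<And>l k m. C l k m = (\<Sum>:b. gi x l b * L b k m)"
    and L: "\<And>l k m. L l k m = - L k l m"
  shows "(\<Sum>:m k. gi x m k * C l k m) = - (\<Sum>:b. gi x l b * (\<Sum>:m. C m b m))"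
proof -
  have "(\<Sum>:m k. gi x m k * C l k m) =
      (\<Sum>:m k b. - (gi x l b * (gi x m k * L k b m)))"
    unfolding C sum_distrib_left
  proof (intro sum.cong refl)
    fix m k b show "gi x m k * (gi x l b * L b k m) = - (gi x l b * (gi x m k * L k b m))"
      using L[of b k m] by simp
  qed
  also have "\<dots> = (\<Sum>:m b k. - (gi x l b * (gi x m k * L k b m)))"
    by (rule sum.cong[OF refl sum.swap])
  also have "\<dots> = (\<Sum>:b m k. - (gi x l b * (gi x m k * L k b m)))"
    by (rule sum.swap)
  also have "\<dots> = - (\<Sum>:b. gi x l b * (\<Sum>:m. C m b m))"
    unfolding C by (simp only: sum_negf sum_distrib_left)
  finally show ?thesis .
qed

text \<open>
  The twice contracted second Bianchi identity.
\<close>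
lemma divergence_ricci:
  assumes x: "x \<in> V"
  shows "2 * divergence g (ricci g) x j = pd j (scal g) x"
proof -
  have tr: "nabla2 g (ricci g) x m j k - nabla2 g (ricci g) x j m k + (\<Sum>:l. nabla_R x l l k j m) = 0" for m k
  proof -
    have "(\<Sum>:l. nabla_R x m l k l j + nabla_R x l l k j m + nabla_R x j l k m l) = 0"
      by (simp only: bianchi_second[OF x] sum.neutral_const)
    moreover have "(\<Sum>:l. nabla_R x j l k m l) = - (\<Sum>:l. nabla_R x j l k l m)"
      unfolding sum_negf[symmetric] by (rule sum.cong[OF refl nabla_R_swap[OF x]])
    ultimately show ?thesis by (simp add: sum.distrib trace_nabla_R[OF x])
  qed
  have "(\<Sum>:m k. gi x m k * (\<Sum>:l. nabla_R x l l k j m)) = divergence g (ricci g) x j"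
  proof -
    have "(\<Sum>:m k. gi x m k * (\<Sum>:l. nabla_R x l l k j m)) =
        (\<Sum>:l m k. gi x m k * nabla_R x l l k j m)"
    proof -
      have "(\<Sum>:m k l. gi x m k * nabla_R x l l k j m) =
          (\<Sum>:m l k. gi x m k * nabla_R x l l k j m)"
        by (rule sum.cong[OF refl sum.swap])
      also have "\<dots> = (\<Sum>:l m k. gi x m k * nabla_R x l l k j m)"
        by (rule sum.swap)
      finally show ?thesis by (simp only: sum_distrib_left)
    qed
    also have "\<dots> = (\<Sum>:l b. gi x l b * nabla2 g (ricci g) x l b j)"
    proof (rule sum.cong[OF refl])
      fix l
      have "(\<Sum>:m k. gi x m k * nabla_R x l l k j m) =
          - (\<Sum>:b. gi x l b * (\<Sum>:m. nabla_R x l m b j m))"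
        by (rule trace_raise[OF x, where L = "\<lambda>b k m. nabla_low x l b k j m"])
          (unfold nabla_low_def, rule lower_raise(1)[OF x, symmetric],
            fold nabla_low_def, rule nabla_low_antisym[OF x])
      also have "\<dots> = (\<Sum>:b. gi x l b * nabla2 g (ricci g) x l j b)"
      proof -
        have "(\<Sum>:m. nabla_R x l m b j m) = - nabla2 g (ricci g) x l j b" for b
          unfolding trace_nabla_R[OF x, symmetric] sum_negf[symmetric]
          by (rule sum.cong[OF refl nabla_R_swap[OF x]])
        then show ?thesis by (simp add: sum_negf)
      qed
      also have "\<dots> = (\<Sum>:b. gi x l b * nabla2 g (ricci g) x l b j)"
        by (simp only: nabla2_sym[OF x ricci_sym, where i = j])
      finally show "(\<Sum>:m k. gi x m k * nabla_R x l l k j m) =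
          (\<Sum>:b. gi x l b * nabla2 g (ricci g) x l b j)" .
    qed
    finally show ?thesis by (simp add: divergence_def contr_def)
  qed
  moreover have "(\<Sum>:m k. gi x m k * nabla2 g (ricci g) x m j k) = divergence g (ricci g) x j"
    unfolding divergence_def contr_def
    by (simp only: nabla2_sym[OF x ricci_sym, where i = j])
  moreover have "(\<Sum>:m k. gi x m k * nabla2 g (ricci g) x j m k) = pd j (scal g) x"
  proof -
    have "scal g = (\<lambda>z. contr g z (ricci g z))" by (rule ext) (simp add: scal_def)
    then show ?thesis using pd_contr[OF x ricci_smooth, of j] by (simp add: contr_def)
  qed
  moreover have "(\<Sum>:m k. gi x m k * (nabla2 g (ricci g) x m j k - nabla2 g (ricci g) x j m k
      + (\<Sum>:l. nabla_R x l l k j m))) = 0"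
    unfolding tr by simp
  ultimately show ?thesis
    by (simp add: distrib_left right_diff_distrib sum.distrib sum_subtractf)
qed

section \<open>The Hessian of the potential\<close>

definition hess :: "(R7 \<Rightarrow> real) \<Rightarrow> cov2" where
  "hess f x i j = pd i (pd j f) x - (\<Sum>:k. \<Gamma> x k i j * pd k f x)"

lemma laplacian_hess: "laplacian g f x = contr g x (hess f x)"
  by (simp add: laplacian_def hess_def contr_def)

context
  fixes f :: "R7 \<Rightarrow> real"
  assumes f: "smooth_on V f"
begin

lemma pdf_smooth: "smooth_on V (pd i f)"
  by (intro smooth_intros f)

lemma hess_smooth: "smooth_on V (\<lambda>x. hess f x i j)"
  unfolding hess_def by (intro smooth_intros Gamma_smooth f)

lemma hess_sym: "x \<in> V \<Longrightarrow> hess f x i j = hess f x j i"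
  unfolding hess_def using pd_commute[OF f V, of x i j] by (simp add: Gamma_sym[of x _ i j])

lemma hess_commutator:
  assumes x: "x \<in> V"
  shows "nabla2 g (hess f) x m i j - nabla2 g (hess f) x i m j = - (\<Sum>:l. R x l j m i * pd l f x)"
proof -
  note d = smooth_diff[OF x Gamma_smooth] smooth_diff[OF x pdf_smooth] smooth_diff[OF x smooth_on_pd[OF pdf_smooth]]
  define A where "A m i = (\<Sum>:k. pd m (\<lambda>z. \<Gamma> z k i j) x * pd k f x)" for m i
  define B where "B m i = (\<Sum>:k. \<Gamma> x k i j * pd m (pd k f) x)" for m i
  define C where "C m i = (\<Sum>:k p. \<Gamma> x k m p * \<Gamma> x p i j * pd k f x)" for m i
  define Q where "Q m i = (\<Sum>:p. \<Gamma> x p m i * hess f x p j)" for m i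
  have "pd m (\<lambda>z. hess f z i j) x = pd m (pd i (pd j f)) x - A m i - B m i" for m i
    unfolding hess_def A_def B_def
    by (simp add: pd_diff pd_sum pd_mult d differentiable_mult differentiable_sum sum.distrib)
  moreover have "(\<Sum>:p. \<Gamma> x p m j * hess f x i p) = B i m - C i m" for m i
  proof -
    have "(\<Sum>:p. \<Gamma> x p m j * (\<Sum>:k. \<Gamma> x k i p * pd k f x)) = C i m"
      unfolding C_def sum_distrib_left by (subst sum.swap) (simp only: mult_ac)
    then show ?thesis unfolding hess_def B_def by (simp add: right_diff_distrib sum_subtractf)
  qed
  ultimately have "nabla2 g (hess f) x m i j = pd m (pd i (pd j f)) x - A m i - B m i - Q m i - B i m + C i m" for m i
    unfolding nabla2_def by (simp add: Q_def)
  moreover have "pd m (pd i (pd j f)) x = pd i (pd m (pd j f)) x"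
    by (rule pd_commute[OF pdf_smooth V x])
  moreover have "Q m i = Q i m"
    unfolding Q_def by (intro sum.cong refl) (simp add: Gamma_sym[OF x, of _ m i])
  moreover have "(\<Sum>:l. R x l j m i * pd l f x) = A m i - A i m + C m i - C i m"
    unfolding riemann_def A_def C_def
    by (simp add: sum_subtractf sum.distrib left_diff_distrib distrib_right sum_distrib_right)
  ultimately show ?thesis by simp
qed

text \<open>
  The Bochner formula: commute the derivatives in \<open>\<nabla>\<^sup>m\<nabla>\<^sub>m\<nabla>\<^sub>jf\<close>.
\<close>
lemma divergence_hess:
  assumes x: "x \<in> V"
  shows "divergence g (hess f) x j = pd j (laplacian g f) x + (\<Sum>:b. ricci g x j b * grad g f x b)"
proof -
  have "nabla2 g (hess f) x m i j = nabla2 g (hess f) x j m i - (\<Sum>:l. R x l i m j * pd l f x)" for m i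
  proof -
    have "nabla2 g (hess f) x m i j = nabla2 g (hess f) x m j i"
      by (rule nabla2_sym[OF x hess_sym])
    then show ?thesis using hess_commutator[OF x, of m j i] by simp
  qed
  then have "divergence g (hess f) x j = contr g x (\<lambda>m i. nabla2 g (hess f) x j m i) -
      (\<Sum>:m i. gi x m i * (\<Sum>:l. R x l i m j * pd l f x))"
    by (simp add: divergence_def contr_def right_diff_distrib sum_subtractf)
  moreover have "contr g x (\<lambda>m i. nabla2 g (hess f) x j m i) = pd j (laplacian g f) x"
  proof -
    have "laplacian g f = (\<lambda>z. contr g z (hess f z))" by (rule ext) (rule laplacian_hess)
    then show ?thesis using pd_contr[OF x hess_smooth, of j] by simp
  qed
  moreover have "(\<Sum>:m i. gi x m i * (\<Sum>:l. R x l i m j * pd l f x)) =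
      - (\<Sum>:b. ricci g x j b * grad g f x b)"
  proof -
    have tr: "(\<Sum>:m i. gi x m i * R x l i m j) = - (\<Sum>:b. gi x l b * ricci g x j b)" for l
      unfolding ricci_def
      by (rule trace_raise[OF x, where L = "\<lambda>b i m. lowered x b i m j"])
        (rule riemann_raise[OF x], rule lowered_antisym[OF x])
    have "(\<Sum>:m i. gi x m i * (\<Sum>:l. R x l i m j * pd l f x)) =
        (\<Sum>:m i l. gi x m i * R x l i m j * pd l f x)"
      by (simp only: sum_distrib_left mult.assoc)
    also have "\<dots> = (\<Sum>:m l i. gi x m i * R x l i m j * pd l f x)"
      by (rule sum.cong[OF refl sum.swap])
    also have "\<dots> = (\<Sum>:l m i. gi x m i * R x l i m j * pd l f x)"
      by (rule sum.swap)
    also have "\<dots> = - (\<Sum>:l b. gi x l b * ricci g x j b * pd l f x)"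
      by (simp only: sum_distrib_right[symmetric] tr) (simp add: sum_negf sum_distrib_right)
    also have "(\<Sum>:l b. gi x l b * ricci g x j b * pd l f x) =
        (\<Sum>:b l. gi x l b * ricci g x j b * pd l f x)" by (rule sum.swap)
    also have "\<dots> = (\<Sum>:b. ricci g x j b * grad g f x b)"
      unfolding grad_def sum_distrib_left
    proof (intro sum.cong refl)
      fix b l show "gi x l b * ricci g x j b * pd l f x = ricci g x j b * (gi x b l * pd l f x)"
        using inverse_metric(3)[OF x, of l b] by simp
    qed
    finally show ?thesis .
  qed
  ultimately show ?thesis by simp
qed

lemma pd_grad_norm2:
  assumes x: "x \<in> V"
  shows "pd j (grad_norm2 g f) x = 2 * (\<Sum>:p. hess f x j p * grad g f x p)"
proof -
  let ?S = "\<lambda>z p q. pd p f z * pd q f z"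
  note d = smooth_diff[OF x pdf_smooth]
  have S: "smooth_on V (\<lambda>z. ?S z p q)" for p q by (intro smooth_intros f)
  have n: "nabla2 g ?S x j p q = hess f x j p * pd q f x + pd p f x * hess f x j q" for p q
    unfolding nabla2_def hess_def
    by (simp add: pd_mult d algebra_simps sum_distrib_left)
  have "grad_norm2 g f = (\<lambda>z. contr g z (?S z))" by (rule ext) (simp add: grad_norm2_def)
  then have "pd j (grad_norm2 g f) x = contr g x (\<lambda>p q. hess f x j p * pd q f x + pd p f x * hess f x j q)"
    using pd_contr[OF x S, of j] by (simp add: n)
  also have "\<dots> = (\<Sum>:p q. gi x p q * (hess f x j p * pd q f x)) +
      (\<Sum>:p q. gi x p q * (pd p f x * hess f x j q))"
    by (simp add: contr_def distrib_left sum.distrib)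
  also have "(\<Sum>:p q. gi x p q * (hess f x j p * pd q f x)) = (\<Sum>:p. hess f x j p * grad g f x p)"
    by (simp add: grad_def sum_distrib_left mult_ac)
  also have "(\<Sum>:p q. gi x p q * (pd p f x * hess f x j q)) = (\<Sum>:p. hess f x j p * grad g f x p)"
  proof -
    have "(\<Sum>:p q. gi x p q * (pd p f x * hess f x j q)) =
        (\<Sum>:q p. gi x p q * (pd p f x * hess f x j q))" by (rule sum.swap)
    also have "\<dots> = (\<Sum>:q. hess f x j q * grad g f x q)"
      unfolding grad_def sum_distrib_left
    proof (intro sum.cong refl)
      fix p q show "gi x p q * (pd p f x * hess f x j q) = hess f x j q * (gi x q p * pd p f x)"
        using inverse_metric(3)[OF x, of p q] by simp
    qed
    finally show ?thesis .
  qed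
  finally show ?thesis by simp
qed

end

lemma divergence_add:
  assumes x: "x \<in> V" and S: "\<And>i j. smooth_on V (\<lambda>z. S z i j)" "\<And>i j. smooth_on V (\<lambda>z. S' z i j)"
  shows "divergence g (\<lambda>z i j. S z i j + S' z i j) x j = divergence g S x j + divergence g S' x j"
  unfolding divergence_def contr_def nabla2_def
  by (simp add: pd_add smooth_diff[OF x S(1)] smooth_diff[OF x S(2)] algebra_simps sum.distrib sum_subtractf)

lemma divergence_cmult:
  assumes x: "x \<in> V" and S: "\<And>i j. smooth_on V (\<lambda>z. S z i j)"
  shows "divergence g (\<lambda>z i j. c * S z i j) x j = c * divergence g S x j"
  unfolding divergence_def contr_def nabla2_def
  by (simp add: pd_cmult smooth_diff[OF x S] algebra_simps sum_distrib_left sum_subtractf)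

lemma divergence_metric:
  assumes x: "x \<in> V" and N: "smooth_on V N"
  shows "divergence g (\<lambda>z i j. N z * g z i j) x j = pd j N x"
proof -
  have n: "nabla2 g (\<lambda>z i j. N z * g z i j) x m i j = pd m N x * g x i j" for m i j
    unfolding nabla2_def
    by (simp add: pd_mult smooth_diff[OF x N] smooth_diff[OF x g_smooth] pd_g[OF x] algebra_simps sum_distrib_left)
  have "divergence g (\<lambda>z i j. N z * g z i j) x j = (\<Sum>:m. pd m N x * (\<Sum>:i. gi x m i * g x i j))"
    unfolding divergence_def contr_def n by (simp add: sum_distrib_left mult_ac)
  then show ?thesis
    by (simp add: inverse_metric(2)[OF x] if_distrib[of "\<lambda>z. _ * z"] cong: if_cong)
qed

lemma divergence_zero:
  assumes x: "x \<in> V" and S: "\<And>z i j. z \<in> V \<Longrightarrow> S z i j = 0"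
  shows "divergence g S x j = 0"
proof -
  have "pd m (\<lambda>z. S z i j) x = 0" for m i j
    using pd_cong[OF V x, of "\<lambda>z. S z i j" "\<lambda>z. 0" m] S by simp
  then show ?thesis by (simp add: divergence_def contr_def nabla2_def S[OF x])
qed

lemma contr_g: "x \<in> V \<Longrightarrow> contr g x (g x) = 7"
proof -
  assume x: "x \<in> V"
  have "contr g x (g x) = (\<Sum>:p q. gi x p q * g x q p)"
    unfolding contr_def
  proof (intro sum.cong refl)
    fix p q show "gi x p q * g x p q = gi x p q * g x q p" using g_sym[OF x, of p q] by simp
  qed
  then show ?thesis by (simp add: inverse_metric(2)[OF x])
qed

text \<open>
  The consequences of \<open>- Ric + 3 S - N g - Hess f - (\<lambda>/3) g = 0\<close> for an arbitrary \<open>S\<close> with trace \<open>N\<close>. Trace and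
  divergence of the equation eliminate \<open>\<Delta>f\<close> and \<open>div Ric\<close>; evaluation on \<open>\<nabla>f\<close> expresses \<open>Ric(\<nabla>f)\<close> by the
  remaining terms.
\<close>
lemma soliton_identities:
  fixes f :: "R7 \<Rightarrow> real" and S :: cov2 and N :: "R7 \<Rightarrow> real" and lam :: real
  assumes f: "smooth_on V f" and S: "\<And>i j. smooth_on V (\<lambda>z. S z i j)" and N: "smooth_on V N"
    and trS: "\<And>z. z \<in> V \<Longrightarrow> contr g z (S z) = N z"
    and sol: "\<And>z i j. z \<in> V \<Longrightarrow> - ricci g z i j + 3 * S z i j - N z * g z i j - hess f z i j - lam / 3 * g z i j = 0"
    and x: "x \<in> V"
  shows "scal g x + 4 * N x + laplacian g f x + 7 / 3 * lam = 0"
    and "pd j (\<lambda>y. scal g y + 6 * N y + grad_norm2 g f y + 2 * lam / 3 * f y) x =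
      6 * (\<Sum>:m. S x j m * grad g f x m) - 6 * divergence g S x j - 2 * N x * pd j f x"
proof -
  have trace: "scal g z + 4 * N z + laplacian g f z + 7 / 3 * lam = 0" if z: "z \<in> V" for z
  proof -
    have "contr g z (\<lambda>i j. - ricci g z i j + 3 * S z i j - N z * g z i j - hess f z i j - lam / 3 * g z i j) = 0"
      unfolding contr_def sol[OF z] by simp
    moreover have "contr g z (\<lambda>i j. - ricci g z i j + 3 * S z i j - N z * g z i j - hess f z i j - lam / 3 * g z i j) =
       - scal g z + 3 * contr g z (S z) - N z * contr g z (g z) - laplacian g f z - lam / 3 * contr g z (g z)"
      unfolding scal_def laplacian_hess contr_def
      by (simp add: algebra_simps sum.distrib sum_subtractf sum_negf sum_distrib_left)
    ultimately show ?thesis by (simp add: trS[OF z] contr_g[OF z])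
  qed
  then show "scal g x + 4 * N x + laplacian g f x + 7 / 3 * lam = 0" using x by blast
  have scal_smooth: "smooth_on V (scal g)"
  proof -
    have "smooth_on V (\<lambda>z. contr g z (ricci g z))"
      unfolding contr_def by (intro smooth_intros gi_smooth ricci_smooth)
    moreover have "scal g = (\<lambda>z. contr g z (ricci g z))" by (rule ext) (simp add: scal_def)
    ultimately show ?thesis by simp
  qed
  have lap_smooth: "smooth_on V (laplacian g f)"
  proof -
    have "smooth_on V (\<lambda>z. contr g z (hess f z))"
      unfolding contr_def by (intro smooth_intros gi_smooth hess_smooth f)
    moreover have "laplacian g f = (\<lambda>z. contr g z (hess f z))" by (rule ext) (rule laplacian_hess)
    ultimately show ?thesis by simp
  qed
  have gn_smooth: "smooth_on V (grad_norm2 g f)"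
  proof -
    have "smooth_on V (\<lambda>z. contr g z (\<lambda>p q. pd p f z * pd q f z))"
      unfolding contr_def by (intro smooth_intros gi_smooth f)
    moreover have "grad_norm2 g f = (\<lambda>z. contr g z (\<lambda>p q. pd p f z * pd q f z))"
      by (rule ext) (simp add: grad_norm2_def)
    ultimately show ?thesis by simp
  qed
  note d = smooth_diff[OF x scal_smooth] smooth_diff[OF x lap_smooth] smooth_diff[OF x gn_smooth]
    smooth_diff[OF x f] smooth_diff[OF x N]
  have pd_trace: "pd j (scal g) x + 4 * pd j N x + pd j (laplacian g f) x = 0"
  proof -
    have "pd j (\<lambda>z. scal g z + 4 * N z + laplacian g f z + 7 / 3 * lam) x = pd j (\<lambda>z. 0) x"
      by (rule pd_cong[OF V x]) (rule trace)
    then show ?thesis by (simp add: pd_add pd_cmult d differentiable_mult differentiable_add)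
  qed
  have div: "- divergence g (ricci g) x j + 3 * divergence g S x j - pd j N x - divergence g (hess f) x j = 0"
  proof -
    \<comment> \<open>the left hand side of the equation, arranged as a sum of smooth summands\<close>
    define Z where "Z = (\<lambda>z i j. (- 1) * ricci g z i j + (3 * S z i j + ((- N z - lam / 3) * g z i j + (- 1) * hess f z i j)))"
    have Nl: "smooth_on V (\<lambda>z. - N z - lam / 3)"
    proof -
      have "smooth_on V (\<lambda>z. (- 1) * N z - lam / 3)" by (intro smooth_intros N)
      then show ?thesis by simp
    qed
    have "Z z i j = 0" if "z \<in> V" for z i j
      using sol[OF that, of i j] by (simp add: Z_def algebra_simps)
    then have "divergence g Z x j = 0" by (rule divergence_zero[OF x])
    moreover have "divergence g Z x j = (- 1) * divergence g (ricci g) x j + (3 * divergence g S x j +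
        (pd j (\<lambda>z. - N z - lam / 3) x + (- 1) * divergence g (hess f) x j))"
    proof -
      have s1: "smooth_on V (\<lambda>z. (- N z - lam / 3) * g z i j + (- 1) * hess f z i j)" for i j
        by (intro smooth_intros Nl g_smooth hess_smooth f)
      have s2: "smooth_on V (\<lambda>z. 3 * S z i j + ((- N z - lam / 3) * g z i j + (- 1) * hess f z i j))" for i j
        by (intro smooth_on_add[OF V] smooth_on_mult[OF V] smooth_on_const[OF V] S s1)
      have s3: "smooth_on V (\<lambda>z. c * F z)" if "smooth_on V F" for c F
        by (intro smooth_intros that)
      show ?thesis
        unfolding Z_def
        by (simp only: divergence_add[OF x s3[OF ricci_smooth] s2] divergence_add[OF x s3[OF S] s1]
            divergence_add[OF x smooth_on_mult[OF V Nl g_smooth] s3[OF hess_smooth[OF f]]]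
            divergence_cmult[OF x ricci_smooth] divergence_cmult[OF x S] divergence_cmult[OF x hess_smooth[OF f]]
            divergence_metric[OF x Nl])
    qed
    moreover have "pd j (\<lambda>z. - N z - lam / 3) x = - pd j N x"
    proof -
      have "(\<lambda>z. (- 1) * N z) differentiable (at x)"
        by (rule smooth_diff[OF x]) (intro smooth_intros N)
      then have "pd j (\<lambda>z. (- 1) * N z - lam / 3) x = pd j (\<lambda>z. (- 1) * N z) x - pd j (\<lambda>z. lam / 3) x"
        by (rule pd_diff) simp
      also have "pd j (\<lambda>z. (- 1) * N z) x = (- 1) * pd j N x"
        by (rule pd_cmult) (rule smooth_diff[OF x N])
      finally show ?thesis by simp
    qed
    ultimately show ?thesis by simp
  qed
  have ric: "(\<Sum>:b. ricci g x j b * grad g f x b) = 3 * (\<Sum>:b. S x j b * grad g f x b)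
      - N x * pd j f x - (\<Sum>:b. hess f x j b * grad g f x b) - lam / 3 * pd j f x"
  proof -
    have gg: "(\<Sum>:b. g x j b * grad g f x b) = pd j f x"
      unfolding grad_def by (rule lower_raise(2)[OF x])
    have ricb: "ricci g x j b = 3 * S x j b - N x * g x j b - hess f x j b - lam / 3 * g x j b" for b
      using sol[OF x, of j b] by simp
    have "(\<Sum>:b. ricci g x j b * grad g f x b) = 3 * (\<Sum>:b. S x j b * grad g f x b)
      - N x * (\<Sum>:b. g x j b * grad g f x b) - (\<Sum>:b. hess f x j b * grad g f x b)
      - lam / 3 * (\<Sum>:b. g x j b * grad g f x b)"
      unfolding ricb by (simp only: left_diff_distrib sum_subtractf sum_distrib_left mult.assoc)
    then show ?thesis by (simp only: gg)
  qed
  have "pd j (\<lambda>y. scal g y + 6 * N y + grad_norm2 g f y + 2 * lam / 3 * f y) x =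
      pd j (scal g) x + 6 * pd j N x + pd j (grad_norm2 g f) x + 2 * lam / 3 * pd j f x"
  proof -
    have "pd j (\<lambda>y. scal g y + 6 * N y + grad_norm2 g f y + 2 * lam / 3 * f y) x =
        pd j (\<lambda>y. scal g y + 6 * N y + grad_norm2 g f y) x + pd j (\<lambda>y. 2 * lam / 3 * f y) x"
      by (rule pd_add; rule smooth_diff[OF x]; intro smooth_intros scal_smooth N gn_smooth f)
    moreover have "pd j (\<lambda>y. 2 * lam / 3 * f y) x = 2 * lam / 3 * pd j f x"
      by (rule pd_cmult) (rule smooth_diff[OF x f])
    moreover have "pd j (\<lambda>y. scal g y + 6 * N y + grad_norm2 g f y) x =
        pd j (scal g) x + 6 * pd j N x + pd j (grad_norm2 g f) x"
      by (simp add: pd_add pd_cmult d differentiable_mult differentiable_add)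
    ultimately show ?thesis by simp
  qed
  then show "pd j (\<lambda>y. scal g y + 6 * N y + grad_norm2 g f y + 2 * lam / 3 * f y) x =
      6 * (\<Sum>:m. S x j m * grad g f x m) - 6 * divergence g S x j - 2 * N x * pd j f x"
    using pd_trace div ric divergence_ricci[OF x, of j] divergence_hess[OF f x, of j] pd_grad_norm2[OF f x, of j]
    by (simp add: field_simps)
qed

end

section \<open>The soliton equation in a chart\<close>

lemma contr_add: "contr g x (\<lambda>p q. F p q + H p q) = contr g x F + contr g x H"
  by (simp add: contr_def distrib_left sum.distrib)

lemma contr_cmult: "contr g x (\<lambda>p q. c * F p q) = c * contr g x F"
  by (simp add: contr_def sum_distrib_left mult.left_commute)

lemma contr_sum: "contr g x (\<lambda>p q. \<Sum>m\<in>A. F m p q) = (\<Sum>m\<in>A. contr g x (F m))"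
proof -
  have "contr g x (\<lambda>p q. \<Sum>m\<in>A. F m p q) = (\<Sum>:p q. \<Sum>m\<in>A. ginv g x p q * F m p q)"
    unfolding contr_def sum_distrib_left ..
  also have "\<dots> = (\<Sum>:p. \<Sum>m\<in>A. \<Sum>:q. ginv g x p q * F m p q)"
    by (rule sum.cong[OF refl sum.swap])
  also have "\<dots> = (\<Sum>m\<in>A. contr g x (F m))"
    unfolding contr_def by (rule sum.swap)
  finally show ?thesis .
qed

lemma contr_swap: "contr g x (\<lambda>i j. contr g x (\<lambda>p q. F i j p q)) = contr g x (\<lambda>p q. contr g x (\<lambda>i j. F i j p q))"
proof -
  have "contr g x (\<lambda>i j. contr g x (\<lambda>p q. F i j p q)) =
      contr g x (\<lambda>i j. \<Sum>:p q. ginv g x p q * F i j p q)"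
    by (simp add: contr_def[of g x "F _ _"])
  also have "\<dots> = contr g x (\<lambda>p q. contr g x (\<lambda>i j. F i j p q))"
    unfolding contr_sum contr_cmult by (simp add: contr_def[of g x "\<lambda>p q. contr g x (\<lambda>i j. F i j p q)"])
  finally show ?thesis .
qed

lemma diamond_add: "diamond g (\<lambda>y a b. h y a b + h' y a b) \<phi> x i j k = diamond g h \<phi> x i j k + diamond g h' \<phi> x i j k"
  by (simp add: diamond_def distrib_right contr_add)

lemma diamond_cmult: "diamond g (\<lambda>y a b. c * h y a b) \<phi> x i j k = c * diamond g h \<phi> x i j k"
  by (simp add: diamond_def mult.assoc contr_cmult distrib_left)

lemma hook4_diff: "hook4 g (\<lambda>y a. X y a - Z y a) \<psi> x i j k = hook4 g X \<psi> x i j k - hook4 g Z \<psi> x i j k"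
  by (simp add: hook4_def contr_def right_diff_distrib left_diff_distrib sum_subtractf)

context metric_chart begin

lemma contr_metric:
  assumes x: "x \<in> V"
  shows "contr g x (\<lambda>p q. g x i p * F q) = F i"
proof -
  have "contr g x (\<lambda>p q. g x i p * F q) = (\<Sum>:p. g x i p * (\<Sum>:q. gi x p q * F q))"
    unfolding contr_def sum_distrib_left by (simp only: mult.left_commute)
  then show ?thesis by (simp only: lower_raise(2)[OF x])
qed

lemma diamond_metric: "x \<in> V \<Longrightarrow> diamond g g \<phi> x i j k = 3 * \<phi> x i j k"
  unfolding diamond_def
  by (simp add: contr_metric[where F = "\<lambda>q. \<phi> x q j k"] contr_metric[where F = "\<lambda>q. \<phi> x i q k"]
      contr_metric[where F = "\<lambda>q. \<phi> x i j q"])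

text \<open>
  Replacing partial by covariant derivatives in the Lie derivative: the torsion-free connection contributes no further
  terms, and \<open>\<nabla>\<^sub>i\<nabla>\<^sup>pf\<close> is the Hessian with an index raised.
\<close>
lemma lie3_grad:
  assumes x: "x \<in> V" and f: "smooth_on V f"
  shows "lie3 (grad g f) \<phi> x i j k = (\<Sum>:p. grad g f x p * nabla3 g \<phi> x p i j k) + diamond g (hess f) \<phi> x i j k"
proof -
  note d = smooth_diff[OF x gi_smooth] smooth_diff[OF x pdf_smooth[OF f]]
  have pd_grad: "pd i (\<lambda>z. grad g f z p) x = (\<Sum>:q. gi x p q * hess f x i q) - (\<Sum>:q. \<Gamma> x p i q * grad g f x q)" for i p
  proof -
    have "pd i (\<lambda>z. grad g f z p) x = (\<Sum>:q. pd i (\<lambda>z. gi z p q) x * pd q f x + gi x p q * pd i (pd q f) x)"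
      unfolding grad_def by (simp add: pd_sum pd_mult d differentiable_mult)
    also have "\<dots> = (\<Sum>:q. gi x p q * pd i (pd q f) x) - (\<Sum>:q. (\<Sum>:r. \<Gamma> x p i r * gi x r q) * pd q f x)
        - (\<Sum>:q. (\<Sum>:r. \<Gamma> x q i r * gi x p r) * pd q f x)"
      unfolding pd_gi[OF x] by (simp add: sum.distrib sum_subtractf sum_negf left_diff_distrib)
    also have "(\<Sum>:q. (\<Sum>:r. \<Gamma> x p i r * gi x r q) * pd q f x) = (\<Sum>:r. \<Gamma> x p i r * grad g f x r)"
      unfolding grad_def sum_distrib_left sum_distrib_right by (subst sum.swap) (simp only: mult.assoc)
    also have "(\<Sum>:q. (\<Sum>:r. \<Gamma> x q i r * gi x p r) * pd q f x) =
        (\<Sum>:r. gi x p r * (\<Sum>:q. \<Gamma> x q i r * pd q f x))"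
      unfolding sum_distrib_left sum_distrib_right by (subst sum.swap) (simp only: mult_ac)
    finally show ?thesis unfolding hess_def by (simp add: right_diff_distrib sum_subtractf)
  qed
  have slot: "(\<Sum>:p. pd i (\<lambda>z. grad g f z p) x * F p) =
      contr g x (\<lambda>p q. hess f x i p * F q) - (\<Sum>:p. grad g f x p * (\<Sum>:q. \<Gamma> x q p i * F q))" for i and F :: "7 \<Rightarrow> real"
  proof -
    have "(\<Sum>:p. (\<Sum>:q. gi x p q * hess f x i q) * F p) = contr g x (\<lambda>p q. hess f x i p * F q)"
    proof -
      have "(\<Sum>:p. (\<Sum>:q. gi x p q * hess f x i q) * F p) = (\<Sum>:p q. gi x p q * hess f x i q * F p)"
        by (simp only: sum_distrib_right)
      also have "\<dots> = (\<Sum>:q p. gi x p q * hess f x i q * F p)" by (rule sum.swap)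
      also have "\<dots> = contr g x (\<lambda>p q. hess f x i p * F q)"
        unfolding contr_def
      proof (intro sum.cong refl)
        fix p q show "gi x p q * hess f x i q * F p = gi x q p * (hess f x i q * F p)"
          using inverse_metric(3)[OF x, of p q] by simp
      qed
      finally show ?thesis .
    qed
    moreover have "(\<Sum>:p. (\<Sum>:q. \<Gamma> x p i q * grad g f x q) * F p) =
        (\<Sum>:q. grad g f x q * (\<Sum>:p. \<Gamma> x p q i * F p))"
    proof -
      have "(\<Sum>:p. (\<Sum>:q. \<Gamma> x p i q * grad g f x q) * F p) =
          (\<Sum>:p q. grad g f x q * (\<Gamma> x p q i * F p))"
        unfolding sum_distrib_right
      proof (intro sum.cong refl)
        fix p q show "\<Gamma> x p i q * grad g f x q * F p = grad g f x q * (\<Gamma> x p q i * F p)"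
          using Gamma_sym[OF x, of p i q] by simp
      qed
      also have "\<dots> = (\<Sum>:q. grad g f x q * (\<Sum>:p. \<Gamma> x p q i * F p))"
        unfolding sum_distrib_left by (rule sum.swap)
      finally show ?thesis .
    qed
    ultimately show ?thesis unfolding pd_grad by (simp add: left_diff_distrib sum_subtractf)
  qed
  show ?thesis
    unfolding lie3_def nabla3_def diamond_def
    using slot[of i "\<lambda>p. \<phi> x p j k"] slot[of j "\<lambda>p. \<phi> x i p k"] slot[of k "\<lambda>p. \<phi> x i j p"]
    by (simp add: sum.distrib right_diff_distrib sum_subtractf)
qed

end

theorem lemma6p3:
  fixes M :: "'a topology" and A :: "'a chart set"
    and \<phi> :: "'a chart \<Rightarrow> cov3" and g :: "'a chart \<Rightarrow> cov2"
    and \<nu> :: "'a chart \<Rightarrow> R7 \<Rightarrow> real" and T :: "'a chart \<Rightarrow> cov2"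
    and f :: "'a \<Rightarrow> real" and lam :: real
  assumes "smooth_manifold7 M A"
    and "gradient_ricci_harmonic_soliton A \<phi> g \<nu> T f lam"
  shows "\<forall>c\<in>A. \<forall>x\<in>chart_image c.
    scal (g c) x + 4 * norm2 (g c) (T c) x + laplacian (g c) (chart_rep c f) x + 7 / 3 * lam = 0 \<and>
    (\<forall>j. pd j (\<lambda>y. scal (g c) y + 6 * norm2 (g c) (T c) y
                  + grad_norm2 (g c) (chart_rep c f) y + 2 * lam / 3 * chart_rep c f y) x
       = 6 * (\<Sum>m\<in>UNIV. transpose_mult (g c) (T c) x j m * grad (g c) (chart_rep c f) x m)
         - 6 * divergence (g c) (transpose_mult (g c) (T c)) x j
         - 2 * norm2 (g c) (T c) x * pd j (chart_rep c f) x)"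
proof (intro ballI)
  fix c x assume c: "c \<in> A" and x: "x \<in> chart_image c"
  note sol = assms(2)[unfolded gradient_ricci_harmonic_soliton_def]
  have g2: "g2_structure A \<phi> g \<nu>" and tor: "is_torsion A \<phi> g \<nu> T" and f: "smooth_function A f"
    using sol by blast+
  have eq: "diamond (g c) (\<lambda>y a b. - ricci (g c) y a b + 3 * transpose_mult (g c) (T c) y a b
                   - norm2 (g c) (T c) y * g c y a b) (\<phi> c) z i j k
        + hook4 (g c) (divergence (g c) (T c)) (hodge3 (g c) (\<nu> c) (\<phi> c)) z i j k
        = lam * \<phi> c z i j k + lie3 (grad (g c) (chart_rep c f)) (\<phi> c) z i j k"
    if "z \<in> chart_image c" for z i j k
    using sol c that by blast
  have rm: "riemannian_metric A g" and vf: "volume_form A g \<nu>" and tf: "three_form A \<phi>"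
    and wedge: "\<And>z i j. z \<in> chart_image c \<Longrightarrow>
      wedge223 (\<phi> c z i) (\<phi> c z j) (\<phi> c z) = - 6 * g c z i j * \<nu> c z"
    using g2 c unfolding g2_structure_def by blast+
  define V where "V = chart_image c"
  interpret metric_chart V "g c"
  proof
    show "open V"
      using assms(1) c unfolding smooth_manifold7_def is_chart_def V_def by blast
    show "smooth_on V (\<lambda>x. g c x i j)" for i j
      using rm c unfolding riemannian_metric_def tensor2_field_def V_def by blast
    show "g c x i j = g c x j i" if "x \<in> V" for x i j
      using rm c that unfolding riemannian_metric_def V_def by blast
    show "(\<Sum>:i j. g c x i j * v $ i * v $ j) > 0" if "x \<in> V" "v \<noteq> 0" for x v
      using rm c that unfolding riemannian_metric_def V_def by blast
  qed
  have T_smooth: "smooth_on V (\<lambda>x. T c x i j)" for i j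
    using tor c unfolding is_torsion_def tensor2_field_def V_def by blast
  have F: "smooth_on V (chart_rep c f)"
    using f c unfolding smooth_function_def V_def by blast
  define F where "F = chart_rep c f"
  note F = F[folded F_def]
  define S where "S = transpose_mult (g c) (T c)"
  define N where "N = norm2 (g c) (T c)"
  have S_smooth: "smooth_on V (\<lambda>z. S z i j)" for i j
    unfolding S_def transpose_mult_def contr_def by (intro smooth_intros gi_smooth T_smooth)
  have N_smooth: "smooth_on V N"
  proof -
    have "smooth_on V (\<lambda>z. norm2 (g c) (T c) z)"
      unfolding norm2_def contr_def by (intro smooth_intros gi_smooth T_smooth)
    then show ?thesis by (simp add: N_def)
  qed
  have S_sym: "S z i j = S z j i" if z: "z \<in> V" for z i j
  proof -
    have "S z i j = (\<Sum>:q p. gi z p q * (T c z p i * T c z q j))"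
      unfolding S_def transpose_mult_def contr_def by (rule sum.swap)
    also have "\<dots> = S z j i"
      unfolding S_def transpose_mult_def contr_def
    proof (intro sum.cong refl)
      fix p q show "gi z p q * (T c z p i * T c z q j) = gi z q p * (T c z q j * T c z p i)"
        using inverse_metric(3)[OF z, of p q] by simp
    qed
    finally show ?thesis .
  qed
  have trS: "contr (g c) z (S z) = N z" for z
    unfolding S_def N_def transpose_mult_def norm2_def by (rule contr_swap)
  define h where "h z i j = - ricci (g c) z i j + 3 * S z i j - N z * g c z i j - hess F z i j - lam / 3 * g c z i j" for z i j
  define X where "X z a = (\<Sum>:m. grad (g c) F z m * T c z m a)" for z a
  \<comment> \<open>the part of type \<open>Y \<lrcorner> \<psi>\<close> collects the divergence of \<open>T\<close> and the torsion term of the Lie derivative\<close>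
  have h0: "h z i j = 0" if z: "z \<in> V" for z i j
  proof (rule diamond_hook4_eq_0)
    show "\<phi> c z i j k = - \<phi> c z j i k" for i j k
      using tf c z unfolding three_form_def V_def by blast
    show "\<phi> c z i j k = - \<phi> c z i k j" for i j k
      using tf c z unfolding three_form_def V_def by blast
    show "g c z i j = g c z j i" for i j using g_sym[OF z] .
    show "(\<Sum>:i j. g c z i j * v $ i * v $ j) > 0" if "v \<noteq> 0" for v
      using g_pos[OF z that] .
    show "\<nu> c z \<noteq> 0"
    proof -
      have "(\<nu> c z)\<^sup>2 = det (\<chi> i j. g c z i j)"
        using vf c z unfolding volume_form_def V_def by blast
      then show ?thesis using G_invertible[OF z] by (auto simp: invertible_det_nz)
    qed
    show "wedge223 (\<phi> c z i) (\<phi> c z j) (\<phi> c z) = - 6 * g c z i j * \<nu> c z" for i j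
      using wedge z unfolding V_def by blast
    show "h z i j = h z j i" for i j
      unfolding h_def using ricci_sym[OF z, of i j] S_sym[OF z, of i j] g_sym[OF z, of i j] hess_sym[OF F z, of i j]
      by simp
    show "diamond (g c) h (\<phi> c) z i j k +
        hook4 (g c) (\<lambda>y a. divergence (g c) (T c) y a - X y a) (hodge3 (g c) (\<nu> c) (\<phi> c)) z i j k = 0" for i j k
    proof -
      let ?\<psi> = "hodge3 (g c) (\<nu> c) (\<phi> c)"
      have "(\<Sum>:m. grad (g c) F z m * nabla3 (g c) (\<phi> c) z m i j k) = hook4 (g c) X ?\<psi> z i j k"
      proof -
        have "nabla3 (g c) (\<phi> c) z m i j k = contr (g c) z (\<lambda>p q. T c z m p * ?\<psi> z q i j k)" for m
          using tor c z unfolding is_torsion_def V_def by blast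
        then have "(\<Sum>:m. grad (g c) F z m * nabla3 (g c) (\<phi> c) z m i j k) =
            contr (g c) z (\<lambda>p q. \<Sum>:m. grad (g c) F z m * (T c z m p * ?\<psi> z q i j k))"
          by (simp add: contr_sum contr_cmult)
        then show ?thesis by (simp add: hook4_def X_def sum_distrib_right mult.assoc)
      qed
      then have lie: "lie3 (grad (g c) F) (\<phi> c) z i j k = hook4 (g c) X ?\<psi> z i j k + diamond (g c) (hess F) (\<phi> c) z i j k"
        using lie3_grad[OF z F, of "\<phi> c" i j k] by simp
      have "h = (\<lambda>y a b. (- ricci (g c) y a b + 3 * S y a b - N y * g c y a b)
          + ((- 1) * hess F y a b + (- lam / 3) * g c y a b))"
        by (intro ext) (simp add: h_def)
      then have "diamond (g c) h (\<phi> c) z i j k =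
          diamond (g c) (\<lambda>y a b. - ricci (g c) y a b + 3 * S y a b - N y * g c y a b) (\<phi> c) z i j k
          - diamond (g c) (hess F) (\<phi> c) z i j k - lam * \<phi> c z i j k"
        by (simp only: diamond_add diamond_cmult diamond_metric[OF z])
      then show ?thesis
        using eq[of z i j k] z lie unfolding hook4_diff S_def N_def F_def V_def by simp
    qed
  qed
  have "x \<in> V" using x by (simp add: V_def)
  from soliton_identities[OF F S_smooth N_smooth trS h0[unfolded h_def] this]
  show "scal (g c) x + 4 * norm2 (g c) (T c) x + laplacian (g c) (chart_rep c f) x + 7 / 3 * lam = 0 \<and>
    (\<forall>j. pd j (\<lambda>y. scal (g c) y + 6 * norm2 (g c) (T c) y
                  + grad_norm2 (g c) (chart_rep c f) y + 2 * lam / 3 * chart_rep c f y) x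
       = 6 * (\<Sum>:m. transpose_mult (g c) (T c) x j m * grad (g c) (chart_rep c f) x m)
         - 6 * divergence (g c) (transpose_mult (g c) (T c)) x j
         - 2 * norm2 (g c) (T c) x * pd j (chart_rep c f) x)"
    unfolding S_def N_def F_def by blast
qed

end
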